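(* In $\overline{\mathbb{H}}^4$, among the congruent ball packings of classical balls generated by simply truncated Coxeter orthoschemes with parallel faces, i.e. by the orthoschemes with Schläfli symbols $\{4,4,3,3,\infty\}$, $\{4,4,3,4,\infty\}$, $\{6,3,3,3,\infty\}$, $\{6,3,3,4,\infty\}$, $\{6,3,3,5,\infty\}$, $\{6,3,4,3,\infty\}$, the densest is the ball configuration $\mathcal{B}_{\{4,4,3,3,\infty\}}$ given by the images of the inball of the orthoscheme with symbol $\{4,4,3,3,\infty\}$, and its density is $\approx 0.06304$.
   Context: Simply truncated Coxeter orthoschemes with parallel faces. Let $\mathbb{R}^{n+1}$ carry the Lorentzian form $\langle x,y\rangle=-x^0y^0+x^1y^1+\dots+x^ny^n$, and use the projective model of $\mathbb{H}^n$ (curvature $-1$), with $\overline{\mathbb{H}}^n=\mathbb{H}^n\cup\partial\mathbb{H}^n$. For a symbol $\{m_1,\dots,m_n,\infty\}$ let $H^0,\dots,H^{n+1}$ be hyperplanes with outward unit normals $b^0,\dots,b^{n+1}$ satisfying $\langle b^i,b^i\rangle=1$, $\langle b^{i-1},b^i\rangle=-\cos(\pi/m_i)$ for $1\le i\le n$, $\langle b^n,b^{n+1}\rangle=-1$ (i.e. $H^n,H^{n+1}$ are parallel), and $\langle b^i,b^j\rangle=0$ for $|i-j|\ge 2$. The truncated orthoscheme $\widehat{\mathcal S}$ is the polytope bounded by $H^0,\dots,H^{n+1}$ (here $H^0,\dots,H^n$ bound an orthoscheme one of whose principal vertices is an outer point, and $H^{n+1}$ is the polar hyperplane of that vertex).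 $\Gamma$ is the discrete group generated by the reflections in $H^0,\dots,H^{n+1}$; the images of $\widehat{\mathcal S}$ under $\Gamma$ tile $\overline{\mathbb{H}}^n$. Here $n=4$. Ball packings. A congruent ball packing of classical balls generated by $\widehat{\mathcal S}$ consists of the $\Gamma$-images of a ball $\mathcal B$ (of finite radius, with center in $\mathbb{H}^n$) contained in $\widehat{\mathcal S}$; its density is $\mathrm{vol}(\mathcal B)/\mathrm{vol}(\widehat{\mathcal S})$. The inball of $\widehat{\mathcal S}$ is the ball of maximal radius contained in $\widehat{\mathcal S}$, and $\delta_{opt}(\widehat{\mathcal S})=\mathrm{vol}(\mathcal B)/\mathrm{vol}(\widehat{\mathcal S})$ for $\mathcal B$ the inball. The sign $\approx$ indicates a decimal approximation accurate to within one unit of the last displayed digit. *)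

theory Defs
  imports "HOL-Analysis.Analysis"
begin

text \<open>
  Lorentzian space of signature \<open>(n,1)\<close> is \<^typ>\<open>real \<times> 'a\<close>, where \<open>'a\<close> is a Euclidean space of
  dimension \<open>n\<close> and the first component is the time coordinate.  A point of the projective model
  is written as the \<open>u :: 'a\<close> for which \<open>(1, u)\<close> represents it: hyperbolic space is
  \<open>ball 0 1\<close> and hyperbolic space with its boundary is \<open>cball 0 1\<close>.
\<close>

definition lorentz :: "real \<times> 'a::euclidean_space \<Rightarrow> real \<times> 'a \<Rightarrow> real" where
  "lorentz x y = - (fst x * fst y) + snd x \<bullet> snd y"

definition lift :: "'a::euclidean_space \<Rightarrow> real \<times> 'a" where
  "lift u = (1, u)"

definition proj :: "real \<times> 'a::euclidean_space \<Rightarrow> 'a" where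
  "proj x = snd x /\<^sub>R fst x"

definition hyp_dist :: "'a::euclidean_space \<Rightarrow> 'a \<Rightarrow> real" where
  "hyp_dist u v = arcosh (- lorentz (lift u) (lift v) /
     sqrt (lorentz (lift u) (lift u) * lorentz (lift v) (lift v)))"

definition hyp_cball :: "'a::euclidean_space \<Rightarrow> real \<Rightarrow> 'a set" where
  "hyp_cball c r = {u \<in> ball 0 1. hyp_dist c u \<le> r}"

text \<open>The density below is the Riemannian volume element of curvature \<open>-1\<close> in the projective
  model, \<open>(1 - \<bar>u\<bar>\<^sup>2) powr (- (n + 1) / 2) du\<close>.\<close>

definition hyp_measure :: "'a::euclidean_space measure" where
  "hyp_measure = density lborel (\<lambda>u. indicator (ball 0 1) u *
     ennreal ((1 - (norm u)\<^sup>2) powr (- (real DIM('a) + 1) / 2)))"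

abbreviation hyp_vol :: "'a::euclidean_space set \<Rightarrow> real" where
  "hyp_vol S \<equiv> measure hyp_measure S"

text \<open>
  \<open>normals m b\<close>: \<open>b 0, \<dots>, b (n + 1)\<close> are the outward unit normals of a simply truncated
  orthoscheme with parallel faces and Schlaefli symbol \<open>{m\<^sub>1, \<dots>, m\<^sub>n, \<infinity>}\<close>; the list \<open>m\<close> holds
  the finite entries, so that \<open>m\<^sub>i\<close> is \<open>m ! (i - 1)\<close>.  The Gram matrix determines \<open>b\<close> only up to
  Lorentz transformations that may exchange the two time directions, i.e. may turn all normals
  inward; the last conjunct says that they point outward.
\<close>

definition normals :: "nat list \<Rightarrow> (nat \<Rightarrow> real \<times> 'a::euclidean_space) \<Rightarrow> bool" where
  "normals m b \<longleftrightarrow>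
     length m = DIM('a) \<and>
     (\<forall>i \<le> DIM('a) + 1. lorentz (b i) (b i) = 1) \<and>
     (\<forall>i \<in> {1..DIM('a)}. lorentz (b (i - 1)) (b i) = - cos (pi / real (m ! (i - 1)))) \<and>
     lorentz (b DIM('a)) (b (DIM('a) + 1)) = - 1 \<and>
     (\<forall>i j. i + 2 \<le> j \<and> j \<le> DIM('a) + 1 \<longrightarrow> lorentz (b i) (b j) = 0) \<and>
     (\<exists>u \<in> ball 0 1. \<forall>i \<le> DIM('a) + 1. lorentz (lift u) (b i) < 0)"

definition truncated_orthoscheme :: "(nat \<Rightarrow> real \<times> 'a::euclidean_space) \<Rightarrow> 'a set" where
  "truncated_orthoscheme b = {u \<in> cball 0 1. \<forall>i \<le> DIM('a) + 1. lorentz (lift u) (b i) \<le> 0}"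

definition reflection :: "real \<times> 'a::euclidean_space \<Rightarrow> real \<times> 'a \<Rightarrow> real \<times> 'a" where
  "reflection e x = x - (2 * lorentz x e / lorentz e e) *\<^sub>R e"

text \<open>Reflections are involutions, so closure under inverses is automatic.\<close>

inductive_set reflection_group ::
    "(nat \<Rightarrow> real \<times> 'a::euclidean_space) \<Rightarrow> (real \<times> 'a \<Rightarrow> real \<times> 'a) set"
  for b :: "nat \<Rightarrow> real \<times> 'a" where
  one: "id \<in> reflection_group b"
| mult: "g \<in> reflection_group b \<Longrightarrow> i \<le> DIM('a) + 1 \<Longrightarrow> reflection (b i) \<circ> g \<in> reflection_group b"

definition orbit :: "(nat \<Rightarrow> real \<times> 'a::euclidean_space) \<Rightarrow> 'a set \<Rightarrow> 'a set set" where
  "orbit b B = (\<lambda>g. (\<lambda>u. proj (g (lift u))) ` B) ` reflection_group b"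

definition is_ball_in :: "'a::euclidean_space set \<Rightarrow> 'a set \<Rightarrow> bool" where
  "is_ball_in S B \<longleftrightarrow> (\<exists>c r. c \<in> ball 0 1 \<and> r > 0 \<and> B = hyp_cball c r \<and> B \<subseteq> S)"

definition is_inball :: "'a::euclidean_space set \<Rightarrow> 'a set \<Rightarrow> bool" where
  "is_inball S B \<longleftrightarrow> (\<exists>c r. c \<in> ball 0 1 \<and> r > 0 \<and> B = hyp_cball c r \<and> B \<subseteq> S \<and>
     (\<forall>c' r'. c' \<in> ball 0 1 \<and> r' > 0 \<and> hyp_cball c' r' \<subseteq> S \<longrightarrow> r' \<le> r))"

definition packing_density :: "(nat \<Rightarrow> real \<times> 'a::euclidean_space) \<Rightarrow> 'a set \<Rightarrow> real" where
  "packing_density b B = hyp_vol B / hyp_vol (truncated_orthoscheme b)"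

text \<open>\<open>P\<close> is a congruent ball packing of density \<open>d\<close> generated by the truncated orthoscheme with
  symbol \<open>m\<close>; the orthoscheme may lie anywhere in hyperbolic space.\<close>

definition ball_packing :: "nat list \<Rightarrow> 'a::euclidean_space set set \<Rightarrow> real \<Rightarrow> bool" where
  "ball_packing m P d \<longleftrightarrow> (\<exists>b B. normals m b \<and> is_ball_in (truncated_orthoscheme b) B \<and>
     P = orbit b B \<and> d = packing_density b B)"

definition inball_packing :: "nat list \<Rightarrow> 'a::euclidean_space set set \<Rightarrow> real \<Rightarrow> bool" where
  "inball_packing m P d \<longleftrightarrow> (\<exists>b B. normals m b \<and> is_inball (truncated_orthoscheme b) B \<and>
     P = orbit b B \<and> d = packing_density b B)"

definition parallel_symbols_4 :: "nat list set" where
  "parallel_symbols_4 =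
     {[4,4,3,3], [4,4,3,4], [6,3,3,3], [6,3,3,4], [6,3,3,5], [6,3,4,3]}"

end

theory Submission
  imports Defs "HOL-Library.Option_ord"
begin

text \<open>
  Each of the six orthoschemes has an ideal vertex lying on all facets except \<open>H\<^sup>3\<close>.  Seen from that
  vertex, that is, in the upper half-space model with the vertex at infinity, the polytope is the part
  of a vertical prism that lies outside the unit hemisphere \<open>H\<^sup>3\<close>.  The base of the prism is the
  product of a right triangle with legs \<open>a\<close> and \<open>a t\<close> and an interval of length \<open>h\<close>, where
  \<open>a = cos (\<pi> / m\<^sub>3)\<close>, \<open>h = cos (\<pi> / m\<^sub>4)\<close>, \<open>t = tan (\<pi> / m\<^sub>1)\<close>, with the centre of the hemisphere at the
  vertex of the triangle with angle \<open>\<pi> / m\<^sub>1\<close>.  Both the volume and the balls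
  contained in the polytope can be computed in these coordinates.

  Volumes.  The hyperbolic volume of a set is a multiple of the Lebesgue measure of the cone over the
  set, cut off by the unit hyperboloid (\<open>emeasure_hyp_measure\<close>).  A linear Lorentz map has determinant
  \<open>\<plusminus>1\<close>, so volumes are invariant, and the cone may be measured in coordinates in which one axis is
  the null direction of the ideal vertex (\<open>frame_of_normals\<close>, \<open>emeasure_cone_in_chart\<close>).  Three of the
  four integrations are elementary and leave an integral over \<open>[0, h]\<close> of an arctangent
  (\<open>emeasure_truncated_orthoscheme\<close>).  For \<open>{4,4,3,3,\<infinity>}\<close> the substitution
  \<open>w = x / sqrt (2 + 2 x\<^sup>2)\<close> turns its nonelementary part into Ahmed's integral, whose value \<open>\<pi>\<^sup>2 / 32\<close> comes from a
  symmetric double integral over the unit square; the volume is \<open>\<pi>\<^sup>2 / 288\<close>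
  (\<open>hyp_vol_orthoscheme_4433\<close>).  For the other symbols lower bounds for the volume suffice, and
  they follow from monotonicity of the integrand or a tangent bound for the arctangent.
  A ball of radius \<open>r\<close> has volume \<open>2 \<pi>\<^sup>2 / 3 (cosh r - 1)\<^sup>2 (cosh r + 2)\<close> (\<open>hyp_vol_hyp_cball\<close>).

  Radii.  A ball with centre \<open>x\<close> on the hyperboloid and radius \<open>r\<close> lies in the polytope iff
  \<open>\<langle>x, b i\<rangle> \<le> - sinh r\<close> for all \<open>i\<close>.  In the coordinates of the prism, divided by \<open>\<sigma> = sinh r\<close>, the
  centre satisfies linear inequalities, and \<open>1 / \<sigma>\<^sup>2\<close> equals \<open>- \<langle>x / \<sigma>, x / \<sigma>\<rangle>\<close>.  Pushing the centre
  into the corner farthest from the centre of the hemisphere decreases \<open>1 / \<sigma>\<^sup>2\<close>, to an increasing quadratic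
  polynomial in a parameter \<open>k\<close>; and \<open>k\<close> is bounded below because the right triangle must contain a
  disc.  This gives an upper bound for \<open>r\<close> in every case, and for \<open>{4,4,3,3,\<infinity>}\<close> the exact inradius,
  \<open>1 / sinh\<^sup>2 r = 25 + 16 sqrt 2\<close>, together with the uniqueness of the inball (\<open>inball_4433\<close>).

  The resulting density for \<open>{4,4,3,3,\<infinity>}\<close> is \<open>192 (cosh r - 1)\<^sup>2 (cosh r + 2)\<close>, about \<open>0.063042\<close>, while for
  all other symbols the bounds give densities below \<open>0.06303\<close>.
\<close>

section \<open>Lorentzian geometry and balls\<close>

lemma lorentz_commute: "lorentz x y = lorentz y x"
  by (simp add: lorentz_def inner_commute)

lemma lorentz_add_left: "lorentz (x + y) z = lorentz x z + lorentz y z"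
  by (simp add: lorentz_def inner_add_left algebra_simps)

lemma lorentz_add_right: "lorentz z (x + y) = lorentz z x + lorentz z y"
  by (simp add: lorentz_def inner_add_right algebra_simps)

lemma lorentz_diff_left: "lorentz (x - y) z = lorentz x z - lorentz y z"
  by (simp add: lorentz_def inner_diff_left algebra_simps)

lemma lorentz_diff_right: "lorentz z (x - y) = lorentz z x - lorentz z y"
  by (simp add: lorentz_def inner_diff_right algebra_simps)

lemma lorentz_scaleR_left: "lorentz (c *\<^sub>R x) z = c * lorentz x z"
  by (simp add: lorentz_def algebra_simps)

lemma lorentz_scaleR_right: "lorentz z (c *\<^sub>R x) = c * lorentz z x"
  by (simp add: lorentz_def algebra_simps)

lemma lorentz_minus_left: "lorentz (- x) z = - lorentz x z"
  by (simp add: lorentz_def)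

lemma lorentz_minus_right: "lorentz z (- x) = - lorentz z x"
  by (simp add: lorentz_def)

lemmas lorentz_bilinear = lorentz_add_left lorentz_add_right lorentz_diff_left lorentz_diff_right
  lorentz_scaleR_left lorentz_scaleR_right lorentz_minus_left lorentz_minus_right

lemma lorentz_zero: "lorentz 0 z = 0" "lorentz z 0 = 0"
  by (simp_all add: lorentz_def)

lemma continuous_on_lorentz [continuous_intros]:
  "continuous_on S f \<Longrightarrow> continuous_on S g \<Longrightarrow> continuous_on S (\<lambda>x. lorentz (f x) (g x))"
  unfolding lorentz_def by (intro continuous_intros)

text \<open>
  Adding to \<open>y\<close> the multiple of \<open>x\<close> that cancels its time coordinate leaves a vector on which the form
  is nonnegative.
\<close>

lemma reversed_Cauchy_Schwarz:
  assumes "lorentz x x < 0"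
  shows "lorentz x x * lorentz y y \<le> (lorentz x y)\<^sup>2"
proof -
  have x0: "fst x \<noteq> 0"
    using assms inner_ge_zero[of "snd x"] unfolding lorentz_def by fastforce
  define l where "l = - fst y / fst x"
  define z where "z = y + l *\<^sub>R x"
  have "fst z = 0" using x0 by (simp add: z_def l_def)
  then have "0 \<le> lorentz z z" by (simp add: lorentz_def)
  then have "lorentz x x * lorentz z z \<le> 0"
    using assms by (simp add: mult_nonpos_nonneg)
  moreover have "lorentz z z = lorentz y y + 2 * l * lorentz x y + l\<^sup>2 * lorentz x x"
    by (simp add: z_def lorentz_bilinear lorentz_commute[of y x] power2_eq_square algebra_simps)
  ultimately have "lorentz x x * lorentz y y - (lorentz x y)\<^sup>2 + (l * lorentz x x + lorentz x y)\<^sup>2 \<le> 0"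
    by (simp add: power2_eq_square algebra_simps)
  moreover have "0 \<le> (l * lorentz x x + lorentz x y)\<^sup>2" by simp
  ultimately show ?thesis by linarith
qed

text \<open>
  The reversed inequality makes the form positive semidefinite on the orthogonal complement of a
  timelike vector, so the usual discriminant argument works there.
\<close>

lemma Cauchy_Schwarz_orthogonal_timelike:
  assumes "lorentz a a < 0" "lorentz a x = 0" "lorentz a y = 0" "lorentz y y > 0"
  shows "(lorentz x y)\<^sup>2 \<le> lorentz x x * lorentz y y"
proof -
  \<comment> \<open>The minimum of the quadratic polynomial \<open>\<lambda>l. \<langle>x + l y, x + l y\<rangle>\<close> is at this \<open>l\<close>.\<close>
  define l where "l = - lorentz x y / lorentz y y"
  define z where "z = x + l *\<^sub>R y"
  have "lorentz a z = 0" using assms by (simp add: z_def lorentz_bilinear)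
  with reversed_Cauchy_Schwarz[OF assms(1), of z] assms(1)
  have "0 \<le> lorentz z z" by (simp add: mult_le_0_iff)
  then have "0 \<le> lorentz z z * lorentz y y" using assms(4) by simp
  moreover have "lorentz z z = lorentz x x + 2 * l * lorentz x y + l\<^sup>2 * lorentz y y"
    by (simp add: z_def lorentz_bilinear lorentz_commute[of y x] power2_eq_square algebra_simps)
  moreover have "l * lorentz y y = - lorentz x y" using assms(4) by (simp add: l_def)
  ultimately have "lorentz z z = lorentz x x + l * lorentz x y"
    by (simp add: power2_eq_square algebra_simps)
  then have "lorentz z z * lorentz y y = lorentz x x * lorentz y y + lorentz x y * (l * lorentz y y)"
    by (simp add: algebra_simps)
  also have "\<dots> = lorentz x x * lorentz y y - (lorentz x y)\<^sup>2"
    using \<open>l * lorentz y y = - lorentz x y\<close> by (simp add: power2_eq_square)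
  finally have "lorentz z z * lorentz y y = lorentz x x * lorentz y y - (lorentz x y)\<^sup>2" .
  with \<open>0 \<le> lorentz z z * lorentz y y\<close> show ?thesis by simp
qed

lemma timelike_norm_less: "lorentz x x < 0 \<longleftrightarrow> norm (snd x) < \<bar>fst x\<bar>"
proof -
  have "lorentz x x = (norm (snd x))\<^sup>2 - \<bar>fst x\<bar>\<^sup>2"
    by (simp add: lorentz_def power2_norm_eq_inner power2_eq_square[of "fst x"])
  then show ?thesis
    using power_mono_iff[of "\<bar>fst x\<bar>" "norm (snd x)" 2] by (simp add: not_le flip: not_less)
qed

lemma causal_norm_le: "lorentz x x \<le> 0 \<longleftrightarrow> norm (snd x) \<le> \<bar>fst x\<bar>"
proof -
  have "lorentz x x = (norm (snd x))\<^sup>2 - \<bar>fst x\<bar>\<^sup>2"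
    by (simp add: lorentz_def power2_norm_eq_inner power2_eq_square[of "fst x"])
  then show ?thesis
    using power_mono_iff[of "norm (snd x)" "\<bar>fst x\<bar>" 2] by simp
qed

lemma lorentz_future_neg:
  assumes "lorentz x x < 0" "fst x > 0" "lorentz y y \<le> 0" "fst y > 0"
  shows "lorentz x y < 0"
proof -
  have "snd x \<bullet> snd y \<le> norm (snd x) * norm (snd y)" by (rule norm_cauchy_schwarz)
  also have "\<dots> \<le> norm (snd x) * fst y"
    using assms causal_norm_le[of y] by (intro mult_left_mono) auto
  also have "\<dots> < fst x * fst y"
    using assms timelike_norm_less[of x] by (intro mult_strict_right_mono) auto
  finally show ?thesis by (simp add: lorentz_def)
qed

text \<open>
  The time orientation of a timelike vector can be read off from its product with any
  future causal vector.  This turns the condition \<open>fst x > 0\<close> into one that Lorentz maps preserve.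
\<close>

lemma future_iff:
  assumes "lorentz x x < 0" "lorentz y y \<le> 0" "fst y > 0"
  shows "fst x > 0 \<longleftrightarrow> lorentz x y < 0"
proof (cases "fst x > 0")
  case True
  then show ?thesis using lorentz_future_neg assms by blast
next
  case False
  have "fst x \<noteq> 0"
    using assms(1) timelike_norm_less[of x] norm_ge_zero[of "snd x"] by linarith
  then have "lorentz (-x) y < 0"
    using False assms by (rule_tac lorentz_future_neg) (simp_all add: lorentz_minus_left lorentz_minus_right)
  then show ?thesis using False by (simp add: lorentz_minus_left)
qed

text \<open>
  The point of the hyperboloid \<open>\<langle>x, x\<rangle> = - 1\<close> on the ray of \<open>u\<close>.  The form takes the value
  \<open>- cosh d\<close> at two such points at distance \<open>d\<close>, and \<open>\<plusminus> sinh d\<close> at such a point and a unit normal of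
  a hyperplane at distance \<open>d\<close>.
\<close>

definition unit_lift :: "'a::euclidean_space \<Rightarrow> real \<times> 'a" where
  "unit_lift u = lift u /\<^sub>R sqrt (1 - (norm u)\<^sup>2)"

lemma lorentz_lift_lift: "lorentz (lift u) (lift u) = (norm u)\<^sup>2 - 1"
  by (simp add: lorentz_def lift_def power2_norm_eq_inner)

lemma norm_sq_less_1: "u \<in> ball 0 1 \<Longrightarrow> (norm u)\<^sup>2 < 1"
  by (simp add: power_less_one_iff)

lemma unit_lift_unit: "u \<in> ball 0 1 \<Longrightarrow> lorentz (unit_lift u) (unit_lift u) = - 1"
proof -
  assume u: "u \<in> ball 0 1"
  define q where "q = 1 - (norm u)\<^sup>2"
  have q: "q > 0" using norm_sq_less_1[OF u] by (simp add: q_def)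
  have l: "lorentz (lift u) (lift u) = - q" by (simp add: q_def lorentz_lift_lift)
  have "unit_lift u = lift u /\<^sub>R sqrt q" by (simp add: unit_lift_def q_def)
  then have "lorentz (unit_lift u) (unit_lift u) = - (q / (sqrt q)\<^sup>2)"
    using q by (simp add: lorentz_bilinear l divide_simps power2_eq_square)
  then show ?thesis using q by simp
qed

lemma fst_unit_lift_pos: "u \<in> ball 0 1 \<Longrightarrow> fst (unit_lift u) > 0"
  using norm_sq_less_1 by (fastforce simp: unit_lift_def lift_def)

lemma proj_unit_lift: "u \<in> ball 0 1 \<Longrightarrow> proj (unit_lift u) = u"
  using norm_sq_less_1 by (fastforce simp: unit_lift_def lift_def proj_def)

lemma proj_in_ball:
  assumes "lorentz x x < 0"
  shows "proj x \<in> ball 0 1"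
  using assms timelike_norm_less[of x] by (auto simp: proj_def divide_simps)

lemma lift_proj: "fst x \<noteq> 0 \<Longrightarrow> lift (proj x) = x /\<^sub>R fst x"
  by (cases x) (simp add: lift_def proj_def)

lemma unit_lift_proj:
  assumes "lorentz x x < 0" "fst x > 0"
  shows "unit_lift (proj x) = x /\<^sub>R sqrt (- lorentz x x)"
proof -
  have "1 - (norm (proj x))\<^sup>2 = - lorentz (lift (proj x)) (lift (proj x))"
    by (simp add: lorentz_lift_lift)
  also have "\<dots> = - lorentz x x / (fst x)\<^sup>2"
    using assms by (simp add: lift_proj lorentz_bilinear power2_eq_square divide_simps)
  finally have "sqrt (1 - (norm (proj x))\<^sup>2) = sqrt (- lorentz x x) / fst x"
    using assms real_sqrt_divide[of "- lorentz x x" "(fst x)\<^sup>2"] by simp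
  then show ?thesis
    using assms unfolding unit_lift_def by (simp add: lift_proj inverse_eq_divide)
qed

lemma lift_eq_unit_lift: "u \<in> ball 0 1 \<Longrightarrow> lift u = sqrt (1 - (norm u)\<^sup>2) *\<^sub>R unit_lift u"
  using norm_sq_less_1 by (fastforce simp: unit_lift_def)

lemma hyp_cball_eq:
  assumes c: "c \<in> ball 0 1" and r: "r \<ge> 0"
  shows "hyp_cball c r = {u \<in> ball 0 1. - lorentz (unit_lift c) (unit_lift u) \<le> cosh r}"
proof -
  have "hyp_dist c u \<le> r \<longleftrightarrow> - lorentz (unit_lift c) (unit_lift u) \<le> cosh r" if u: "u \<in> ball 0 1" for u
  proof -
    define g where "g = - lorentz (unit_lift c) (unit_lift u)"
    have "lorentz (unit_lift c) (unit_lift u) < 0"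
      using lorentz_future_neg[of "unit_lift c" "unit_lift u"] unit_lift_unit fst_unit_lift_pos c u
      by (metis neg_less_0_iff_less less_imp_le zero_less_one)
    then have "g > 0" by (simp add: g_def)
    moreover have "1 \<le> g\<^sup>2"
      using reversed_Cauchy_Schwarz[of "unit_lift c" "unit_lift u"] unit_lift_unit[OF c] unit_lift_unit[OF u]
      by (simp add: g_def)
    ultimately have g: "1 \<le> g" by (smt (verit) power_less_one_iff zero_less_numeral pos2)
    have "hyp_dist c u = arcosh g"
    proof -
      have "lorentz (lift c) (lift c) * lorentz (lift u) (lift u)
          = (1 - (norm c)\<^sup>2) * (1 - (norm u)\<^sup>2)"
        by (simp add: lorentz_lift_lift algebra_simps)
      then have "hyp_dist c u = arcosh (- lorentz (lift c) (lift u) / (sqrt (1 - (norm c)\<^sup>2) * sqrt (1 - (norm u)\<^sup>2)))"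
        unfolding hyp_dist_def by (simp add: real_sqrt_mult)
      also have "- lorentz (lift c) (lift u) / (sqrt (1 - (norm c)\<^sup>2) * sqrt (1 - (norm u)\<^sup>2)) = g"
        by (simp add: g_def unit_lift_def lorentz_bilinear divide_simps)
      finally show ?thesis .
    qed
    moreover have "arcosh g \<le> r \<longleftrightarrow> g \<le> cosh r"
    proof
      assume "arcosh g \<le> r"
      then have "cosh (arcosh g) \<le> cosh r"
        using g r by (subst cosh_real_nonneg_le_iff) auto
      then show "g \<le> cosh r" using g by simp
    next
      assume "g \<le> cosh r"
      then have "cosh (arcosh g) \<le> cosh r" using g by simp
      then show "arcosh g \<le> r"
        using g r by (subst (asm) cosh_real_nonneg_le_iff) auto
    qed
    ultimately show ?thesis by (simp add: g_def)
  qed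
  then show ?thesis by (auto simp: hyp_cball_def)
qed

text \<open>
  If the ball lies in the half-space, so does the point that is reached from the centre by moving a
  distance \<open>r\<close> towards the hyperplane along the common perpendicular; this bounds the value at the
  centre.  The converse is the Cauchy-Schwarz inequality in the tangent space of the centre.
\<close>

lemma ball_in_halfspace_iff:
  assumes c: "c \<in> ball 0 1" and r: "r > 0" and e: "lorentz e e = 1"
  shows "(\<forall>u \<in> hyp_cball c r. lorentz (lift u) e \<le> 0) \<longleftrightarrow> lorentz (unit_lift c) e \<le> - sinh r"
proof
  define A where "A = unit_lift c"
  define \<beta> where "\<beta> = lorentz A e"
  have AA: "lorentz A A = - 1" "fst A > 0"
    using c unit_lift_unit fst_unit_lift_pos by (auto simp: A_def)
  have eA: "lorentz e A = \<beta>" by (simp add: \<beta>_def lorentz_commute)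
  {
    assume B: "\<forall>u \<in> hyp_cball c r. lorentz (lift u) e \<le> 0"
    define s where "s = sqrt (1 + \<beta>\<^sup>2)"
    have s: "s > 0" "s * s = 1 + \<beta>\<^sup>2"
      by (auto simp: s_def add_pos_nonneg)
    \<comment> \<open>The unit tangent vector at the centre that points towards the hyperplane\<close>
    define n where "n = (e + \<beta> *\<^sub>R A) /\<^sub>R s"
    have nn: "lorentz n n = 1"
    proof -
      have "lorentz n n = (1 + \<beta>\<^sup>2) / (s * s)"
        using e AA by (simp add: n_def lorentz_bilinear eA \<beta>_def[symmetric] power2_eq_square
            divide_simps)
      then show ?thesis using s by (metis divide_self_if mult_eq_0_iff less_irrefl)
    qed
    have nA: "lorentz A n = 0" "lorentz n A = 0"
      using AA by (simp_all add: n_def lorentz_bilinear eA \<beta>_def[symmetric])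
    have ne: "lorentz n e = s"
    proof -
      have "lorentz n e = (1 + \<beta>\<^sup>2) / s"
        using e AA by (simp add: n_def lorentz_bilinear eA \<beta>_def[symmetric] power2_eq_square divide_simps)
      also have "\<dots> = s * s / s" by (simp add: s(2))
      also have "\<dots> = s" using s(1) by simp
      finally show ?thesis .
    qed
    define x where "x = cosh r *\<^sub>R A + sinh r *\<^sub>R n"
    have xx: "lorentz x x = - 1"
      using AA nn nA hyperbolic_pythagoras[of r]
      by (simp add: x_def lorentz_bilinear power2_eq_square algebra_simps)
    have xA: "lorentz x A = - cosh r" "lorentz A x = - cosh r"
      using AA nA by (simp_all add: x_def lorentz_bilinear)
    have x0: "fst x > 0"
      using future_iff[of x A] xx AA xA by simp
    have px: "unit_lift (proj x) = x" using unit_lift_proj[of x] xx x0 by simp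
    have "proj x \<in> hyp_cball c r"
      using c r xx px xA proj_in_ball[of x] by (simp add: hyp_cball_eq A_def[symmetric])
    then have "lorentz (lift (proj x)) e \<le> 0" using B by blast
    then have "lorentz x e \<le> 0"
      using x0 by (simp add: lift_proj lorentz_bilinear divide_simps mult_le_0_iff)
    then have le: "cosh r * \<beta> + sinh r * s \<le> 0"
      by (simp add: x_def lorentz_bilinear ne \<beta>_def[symmetric])
    have sh: "sinh r > 0" using r by simp
    have b0: "\<beta> < 0"
    proof (rule ccontr)
      assume "\<not> \<beta> < 0"
      then have "0 \<le> cosh r * \<beta>" by simp
      moreover have "0 < sinh r * s" using sh s by simp
      ultimately show False using le by linarith
    qed
    have "sinh r * s \<le> cosh r * (- \<beta>)" using le by simp
    then have "(sinh r * s)\<^sup>2 \<le> (cosh r * (- \<beta>))\<^sup>2"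
      using sh s by (intro power_mono) auto
    then have "(sinh r)\<^sup>2 * (1 + \<beta>\<^sup>2) \<le> ((sinh r)\<^sup>2 + 1) * \<beta>\<^sup>2"
      using s by (simp add: power_mult_distrib power2_eq_square[of s] cosh_square_eq)
    then have "(sinh r)\<^sup>2 \<le> (- \<beta>)\<^sup>2" by (simp add: algebra_simps)
    then have "sinh r \<le> - \<beta>" using b0 power2_le_imp_le[of "sinh r" "- \<beta>"] by simp
    then show "lorentz (unit_lift c) e \<le> - sinh r" by (simp add: \<beta>_def A_def)
  }
  {
    assume "lorentz (unit_lift c) e \<le> - sinh r"
    then have b: "\<beta> \<le> - sinh r" by (simp add: \<beta>_def A_def)
    have sh: "sinh r > 0" using r by simp
    show "\<forall>u \<in> hyp_cball c r. lorentz (lift u) e \<le> 0"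
    proof (rule ballI)
      fix u assume "u \<in> hyp_cball c r"
      then have u: "u \<in> ball 0 1" and gc: "- lorentz A (unit_lift u) \<le> cosh r"
        using c r unfolding A_def by (simp_all add: hyp_cball_eq)
      define U where "U = unit_lift u"
      define g where "g = - lorentz A U"
      have UU: "lorentz U U = - 1" "fst U > 0"
        using u unit_lift_unit fst_unit_lift_pos by (auto simp: U_def)
      have UA: "lorentz U A = - g" "lorentz A U = - g" by (auto simp: g_def lorentz_commute)
      have g0: "g > 0" using lorentz_future_neg[of A U] AA UU by (simp add: g_def)
      have g: "g \<le> cosh r" using gc by (simp add: g_def U_def)
      have ee: "lorentz (e + \<beta> *\<^sub>R A) (e + \<beta> *\<^sub>R A) = 1 + \<beta>\<^sup>2"
        using AA e eA by (simp add: lorentz_bilinear \<beta>_def[symmetric] power2_eq_square algebra_simps)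
      then have "0 < lorentz (e + \<beta> *\<^sub>R A) (e + \<beta> *\<^sub>R A)" by (simp add: add_pos_nonneg)
      moreover have "lorentz A (U - g *\<^sub>R A) = 0"
        using AA UA by (simp add: lorentz_bilinear)
      moreover have "lorentz A (e + \<beta> *\<^sub>R A) = 0"
        using AA by (simp add: lorentz_bilinear \<beta>_def[symmetric])
      moreover have "lorentz A A < 0" using AA by simp
      ultimately have "(lorentz (U - g *\<^sub>R A) (e + \<beta> *\<^sub>R A))\<^sup>2 \<le>
          lorentz (U - g *\<^sub>R A) (U - g *\<^sub>R A) * lorentz (e + \<beta> *\<^sub>R A) (e + \<beta> *\<^sub>R A)"
        by (intro Cauchy_Schwarz_orthogonal_timelike[of A])
      also have "lorentz (U - g *\<^sub>R A) (e + \<beta> *\<^sub>R A) = lorentz U e - g * \<beta>"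
        using AA UU UA e eA by (simp add: lorentz_bilinear \<beta>_def[symmetric] algebra_simps)
      also have "lorentz (U - g *\<^sub>R A) (U - g *\<^sub>R A) = g\<^sup>2 - 1"
        using AA UU UA by (simp add: lorentz_bilinear power2_eq_square algebra_simps)
      also note ee
      finally have cs: "(lorentz U e - g * \<beta>)\<^sup>2 \<le> (g\<^sup>2 - 1) * (1 + \<beta>\<^sup>2)" .
      have "g\<^sup>2 \<le> (cosh r)\<^sup>2" using g g0 by (intro power_mono) auto
      also have "\<dots> = (sinh r)\<^sup>2 + 1" by (simp add: cosh_square_eq)
      also have "(sinh r)\<^sup>2 \<le> (- \<beta>)\<^sup>2" using b sh by (intro power_mono) auto
      finally have "g\<^sup>2 \<le> \<beta>\<^sup>2 + 1" by simp
      with cs have "(lorentz U e - g * \<beta>)\<^sup>2 \<le> (g * (- \<beta>))\<^sup>2"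
        by (simp add: power_mult_distrib algebra_simps)
      moreover have "0 \<le> - \<beta>" using b sh by linarith
      then have "0 \<le> g * (- \<beta>)" using g0 by (intro mult_nonneg_nonneg) auto
      ultimately have "lorentz U e - g * \<beta> \<le> g * (- \<beta>)" by (rule power2_le_imp_le)
      then have "lorentz U e \<le> 0" by simp
      then show "lorentz (lift u) e \<le> 0"
        using norm_sq_less_1[OF u] lift_eq_unit_lift[OF u]
        by (simp add: U_def lorentz_bilinear mult_le_0_iff)
    qed
  }
qed

lemma ball_in_truncated_orthoscheme_iff:
  fixes b :: "nat \<Rightarrow> real \<times> 'a::euclidean_space"
  assumes "c \<in> ball 0 1" "r > 0" "\<And>i. i \<le> DIM('a) + 1 \<Longrightarrow> lorentz (b i) (b i) = 1"
  shows "hyp_cball c r \<subseteq> truncated_orthoscheme b \<longleftrightarrow>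
    (\<forall>i \<le> DIM('a) + 1. lorentz (unit_lift c) (b i) \<le> - sinh r)"
proof -
  have "hyp_cball c r \<subseteq> truncated_orthoscheme b \<longleftrightarrow>
      (\<forall>i \<le> DIM('a) + 1. \<forall>u \<in> hyp_cball c r. lorentz (lift u) (b i) \<le> 0)"
    unfolding truncated_orthoscheme_def hyp_cball_def by auto
  then show ?thesis using assms ball_in_halfspace_iff by blast
qed

section \<open>Lorentz maps preserve Lebesgue measure\<close>

lemma linear_borel_measurable:
  fixes f :: "'a::euclidean_space \<Rightarrow> 'b::euclidean_space"
  shows "linear f \<Longrightarrow> f \<in> borel_measurable borel"
  by (intro borel_measurable_continuous_onI linear_continuous_on) (simp add: linear_conv_bounded_linear)

lemma inner_image_of_basis_bijection:
  fixes T :: "'a::euclidean_space \<Rightarrow> 'b::euclidean_space"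
  assumes "linear T" "bij_betw T Basis Basis" "b \<in> Basis"
  shows "T x \<bullet> T b = x \<bullet> b"
proof -
  have inB: "T c \<in> Basis" if "c \<in> Basis" for c using assms(2) that by (auto simp: bij_betw_def)
  have inj: "T c = T d \<longleftrightarrow> c = d" if "c \<in> Basis" "d \<in> Basis" for c d
    using assms(2) that by (auto simp: bij_betw_def inj_on_def)
  have "T x = T (\<Sum>c\<in>Basis. (x \<bullet> c) *\<^sub>R c)" by (simp add: euclidean_representation)
  also have "\<dots> = (\<Sum>c\<in>Basis. (x \<bullet> c) *\<^sub>R T c)"
    using assms(1) by (simp add: linear_sum linear_scale)
  finally have "T x \<bullet> T b = (\<Sum>c\<in>Basis. (x \<bullet> c) * (T c \<bullet> T b))"
    by (simp add: inner_sum_left)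
  also have "\<dots> = (\<Sum>c\<in>Basis. if c = b then x \<bullet> c else 0)"
    using assms(3) by (intro sum.cong refl) (auto simp: inner_Basis inB inj)
  finally show ?thesis using assms(3) by simp
qed

lemma lborel_distr_basis_bijection:
  fixes T :: "'a::euclidean_space \<Rightarrow> 'b::euclidean_space"
  assumes T: "linear T" and bij: "bij_betw T Basis Basis"
  shows "distr lborel borel T = lborel"
proof (rule lborel_eqI[symmetric])
  show "sets (distr lborel borel T) = sets borel" by simp
  fix l u :: 'b assume le: "\<And>b. b \<in> Basis \<Longrightarrow> l \<bullet> b \<le> u \<bullet> b"
  define l' where "l' = (\<Sum>b\<in>Basis. (l \<bullet> T b) *\<^sub>R b)"
  define u' where "u' = (\<Sum>b\<in>Basis. (u \<bullet> T b) *\<^sub>R b)"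
  have l': "l' \<bullet> b = l \<bullet> T b" and u': "u' \<bullet> b = u \<bullet> T b" if "b \<in> Basis" for b
    using that by (simp_all add: l'_def u'_def inner_sum_left_Basis)
  have img: "Basis = T ` Basis" using bij by (simp add: bij_betw_def)
  have [measurable]: "T \<in> borel_measurable borel"
    by (rule linear_borel_measurable[OF T])
  have "T -` box l u = box l' u'"
    unfolding box_def
    by (subst (1) img) (auto simp: inner_image_of_basis_bijection[OF T bij] l' u')
  moreover have "l' \<bullet> b \<le> u' \<bullet> b" if "b \<in> Basis" for b
    using le[of "T b"] that img by (auto simp: l' u')
  ultimately have "emeasure (distr lborel borel T) (box l u) = (\<Prod>b\<in>Basis. (u' - l') \<bullet> b)"
    by (subst emeasure_distr) (auto intro: emeasure_lborel_box)
  also have "(\<Prod>b\<in>Basis. (u' - l') \<bullet> b) = (\<Prod>b\<in>Basis. (u - l) \<bullet> T b)"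
    by (intro prod.cong) (auto simp: l' u' inner_diff_left)
  also have "\<dots> = (\<Prod>b\<in>Basis. (u - l) \<bullet> b)"
    using prod.reindex_bij_betw[OF bij] .
  finally show "emeasure (distr lborel borel T) (box l u) = (\<Prod>b\<in>Basis. (u - l) \<bullet> b)" .
qed

lemma lborel_distr_unimodular:
  fixes g :: "real ^ 'm::{finite,wellorder} \<Rightarrow> real ^ 'm::{finite,wellorder}"
  assumes g: "linear g" and det: "\<bar>det (matrix g)\<bar> = 1"
  shows "distr lborel borel g = lborel"
proof (rule lborel_eqI[symmetric])
  show "sets (distr lborel borel g) = sets borel" by simp
  fix l u :: "real ^ 'm::{finite,wellorder}" assume le: "\<And>b. b \<in> Basis \<Longrightarrow> l \<bullet> b \<le> u \<bullet> b"
  have [measurable]: "g \<in> borel_measurable borel"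
    by (rule linear_borel_measurable[OF g])
  have "inj g" using det det_nz_iff_inj[OF g] by fastforce
  then obtain h where h: "linear h" "\<And>x. h (g x) = x" "\<And>x. g (h x) = x"
    using linear_injective_isomorphism[OF g] by blast
  define S where "S = g -` box l u"
  have hS: "S = h ` box l u" unfolding S_def by (auto simp: h(3) image_iff) (metis h(2))
  have gS: "g ` S = box l u" unfolding hS by (simp add: image_image h(3))
  have Sm: "S \<in> lmeasurable"
    unfolding hS by (rule measurable_linear_image[OF h(1)]) simp
  have Sb: "S \<in> sets borel" unfolding S_def using measurable_sets_borel[of g borel "box l u"] by simp
  have "measure lebesgue (box l u) = measure lebesgue S"
    using measure_linear_image[OF g Sm] det by (simp add: gS)
  moreover have "emeasure lebesgue S = measure lebesgue S"
    using Sm by (rule emeasure_eq_measure2)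
  moreover have "emeasure lebesgue (box l u) = measure lebesgue (box l u)"
    by (intro emeasure_eq_measure2) simp
  ultimately have "emeasure lebesgue S = emeasure lebesgue (box l u)" by simp
  then have "emeasure lborel S = emeasure lborel (box l u)"
    using Sb by (simp add: emeasure_completion)
  then show "emeasure (distr lborel borel g) (box l u) = (\<Prod>b\<in>Basis. (u - l) \<bullet> b)"
    using le by (subst emeasure_distr) (auto simp: S_def)
qed

text \<open>
  Determinants are defined for matrices, hence for \<^typ>\<open>real ^ 'm\<close>.  The index type
  \<^typ>\<open>'n option\<close> adds the time axis as the index \<^term>\<open>None\<close>.
\<close>

definition pair_of_vec :: "real ^ ('n option) \<Rightarrow> real \<times> (real ^ 'n)" where
  "pair_of_vec v = (v $ None, \<chi> i. v $ Some i)"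

definition vec_of_pair :: "real \<times> (real ^ 'n) \<Rightarrow> real ^ ('n option)" where
  "vec_of_pair x = (\<chi> i. case i of None \<Rightarrow> fst x | Some j \<Rightarrow> snd x $ j)"

lemma pair_of_vec_inverse [simp]: "vec_of_pair (pair_of_vec v) = v"
  by (simp add: vec_of_pair_def pair_of_vec_def vec_eq_iff split: option.split)

lemma vec_of_pair_inverse [simp]: "pair_of_vec (vec_of_pair x) = x"
  by (simp add: vec_of_pair_def pair_of_vec_def vec_eq_iff prod_eq_iff)

lemma linear_pair_of_vec: "linear pair_of_vec"
  by (rule linearI) (simp_all add: pair_of_vec_def vec_eq_iff)

lemma linear_vec_of_pair: "linear vec_of_pair"
  by (rule linearI) (simp_all add: vec_of_pair_def vec_eq_iff split: option.split)

lemma pair_of_vec_axis: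
  "pair_of_vec (axis None 1) = (1, 0)" "pair_of_vec (axis (Some i) 1) = (0, axis i 1)"
  by (simp_all add: pair_of_vec_def axis_def vec_eq_iff)

lemma vec_of_pair_axis:
  "vec_of_pair (1, 0) = axis None 1" "vec_of_pair (0, axis i 1) = axis (Some i) 1"
  by (simp_all add: vec_of_pair_def axis_def vec_eq_iff split: option.split)

lemma pair_of_vec_Basis: "b \<in> Basis \<Longrightarrow> pair_of_vec b \<in> Basis"
proof -
  assume "b \<in> Basis"
  then obtain i where "b = axis i 1" by (auto simp: Basis_vec_def)
  then show ?thesis
    by (cases i) (auto simp: pair_of_vec_axis Basis_prod_def Basis_vec_def)
qed

lemma vec_of_pair_Basis: "b \<in> Basis \<Longrightarrow> vec_of_pair b \<in> Basis"
  by (auto simp: Basis_prod_def Basis_vec_def vec_of_pair_axis)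

lemma bij_betw_pair_of_vec: "bij_betw pair_of_vec (Basis :: (real ^ ('n::{finite,wellorder} option)) set) Basis"
  by (intro bij_betwI[where g = vec_of_pair]) (auto intro: pair_of_vec_Basis vec_of_pair_Basis)

lemma bij_betw_vec_of_pair: "bij_betw vec_of_pair Basis (Basis :: (real ^ ('n::{finite,wellorder} option)) set)"
  by (intro bij_betwI[where g = pair_of_vec]) (auto intro: pair_of_vec_Basis vec_of_pair_Basis)

text \<open>
  With the Gram matrix \<open>G\<close> of the form, preservation says \<open>A\<^sup>T G A = G\<close>; hence \<open>(det A)\<^sup>2 = 1\<close>.
\<close>

lemma lborel_distr_lorentz:
  fixes f :: "real \<times> (real ^ 'n::{finite,wellorder}) \<Rightarrow> real \<times> (real ^ 'n::{finite,wellorder})"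
  assumes f: "linear f" and pres: "\<And>x y. lorentz (f x) (f y) = lorentz x y"
  shows "distr lborel borel f = lborel"
proof -
  define g :: "real ^ ('n::{finite,wellorder} option) \<Rightarrow> real ^ ('n::{finite,wellorder} option)" where "g = vec_of_pair \<circ> f \<circ> pair_of_vec"
  define A where "A = matrix g"
  define G :: "real ^ ('n::{finite,wellorder} option) ^ ('n::{finite,wellorder} option)" where
    "G = (\<chi> i j. if i = j then (if i = None then - 1 else 1) else 0)"
  have g: "linear g" unfolding g_def
    by (intro linear_compose linear_pair_of_vec linear_vec_of_pair f)
  have UNIVo: "(UNIV :: 'n::{finite,wellorder} option set) = insert None (range Some)"
    by (auto simp: image_def)
  have form: "lorentz (pair_of_vec x) (pair_of_vec y) = x \<bullet> (G *v y)" for x y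
  proof -
    have Gy: "(G *v y) $ i = (if i = None then - 1 else 1) * y $ i" for i
      unfolding G_def matrix_vector_mult_def by (simp add: if_distrib[where f = "\<lambda>t. t * _"] cong: if_cong)
    show ?thesis
      by (simp add: inner_vec_def Gy UNIVo sum.reindex lorentz_def pair_of_vec_def)
  qed
  have "x \<bullet> ((transpose A ** G ** A) *v y) = x \<bullet> (G *v y)" for x y
  proof -
    have "x \<bullet> ((transpose A ** G ** A) *v y) = (A *v x) \<bullet> (G *v (A *v y))"
      by (metis dot_lmul_matrix inner_commute matrix_vector_mul_assoc transpose_matrix_vector)
    also have "\<dots> = lorentz (pair_of_vec (g x)) (pair_of_vec (g y))"
      using g by (simp add: form A_def matrix_works)
    also have "\<dots> = x \<bullet> (G *v y)"
      by (simp add: g_def pres form)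
    finally show ?thesis .
  qed
  then have "transpose A ** G ** A = G"
    by (metis matrix_eq vector_eq_ldot)
  then have "det A * det G * det A = det G"
    by (metis det_mul det_transpose)
  moreover have "det G \<noteq> 0"
    by (subst det_diagonal) (auto simp: G_def)
  ultimately have "(det A)\<^sup>2 = 1"
    by (simp add: power2_eq_square)
  then have "\<bar>det A\<bar> = 1" by (simp add: abs_square_eq_1)
  then have dg: "distr lborel borel g = lborel"
    using lborel_distr_unimodular[OF g] by (simp add: A_def)
  note [measurable] = linear_borel_measurable[OF g] linear_borel_measurable[OF linear_pair_of_vec]
    linear_borel_measurable[OF linear_vec_of_pair]
  have "f = pair_of_vec \<circ> g \<circ> vec_of_pair" by (simp add: g_def fun_eq_iff)
  then have "distr lborel borel f = distr (distr (distr lborel borel vec_of_pair) borel g) borel pair_of_vec"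
    by (simp add: distr_distr comp_assoc)
  also have "\<dots> = lborel"
    by (simp add: lborel_distr_basis_bijection linear_pair_of_vec linear_vec_of_pair
        bij_betw_vec_of_pair bij_betw_pair_of_vec dg)
  finally show ?thesis .
qed

section \<open>Hyperbolic volume as the measure of a cone\<close>

text \<open>
  For \<open>u \<in> S\<close> with \<open>0 < f u\<close>, on the ray through \<open>(1, u)\<close> the set is the interval \<open>0 < s \<le> f u powr (- 1 / 2)\<close>, and the change of
  variables \<open>y = s u\<close> contributes \<open>s ^ n\<close>, which integrates to \<open>f u powr (- (n + 1) / 2) / (n + 1)\<close>.
  The lemma is used for two affine charts of the same cone: the projective model, with
  \<open>f u = 1 - \<bar>u\<bar>\<^sup>2\<close>, and the chart in which a null coordinate equals \<open>1\<close>.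
\<close>

lemma emeasure_cone_in_chart:
  fixes f :: "'a::euclidean_space \<Rightarrow> real"
  assumes [measurable]: "f \<in> borel_measurable borel" "S \<in> sets borel"
  shows "emeasure lborel {(s, y). 0 < s \<and> y /\<^sub>R s \<in> S \<and> 0 < s\<^sup>2 * f (y /\<^sub>R s) \<and> s\<^sup>2 * f (y /\<^sub>R s) \<le> 1}
    = (\<integral>\<^sup>+u. indicator {u \<in> S. 0 < f u} u *
         ennreal (f u powr (- (real DIM('a) + 1) / 2) / (real DIM('a) + 1)) \<partial>lborel)"
    (is "emeasure lborel ?C = _")
proof -
  define n where "n = DIM('a)"
  have n: "n > 0" by (simp add: n_def)
  have "Measurable.pred (borel \<Otimes>\<^sub>M borel) (\<lambda>x::real \<times> 'a. 0 < fst x \<and> snd x /\<^sub>R fst x \<in> S \<and>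
      0 < (fst x)\<^sup>2 * f (snd x /\<^sub>R fst x) \<and> (fst x)\<^sup>2 * f (snd x /\<^sub>R fst x) \<le> 1)"
    by measurable
  then have [measurable]: "?C \<in> sets (borel \<Otimes>\<^sub>M borel)"
    by (simp add: pred_def space_pair_measure case_prod_unfold)
  then have C: "?C \<in> sets (lborel \<Otimes>\<^sub>M lborel)" by simp
  have scale: "(\<integral>\<^sup>+y. g y \<partial>lborel) = ennreal (s ^ n) * (\<integral>\<^sup>+u. g (s *\<^sub>R u) \<partial>lborel)"
    if "s > 0" "g \<in> borel_measurable borel" for s and g :: "'a \<Rightarrow> ennreal"
  proof -
    note [measurable] = that(2)
    have "(\<integral>\<^sup>+y. g y \<partial>lborel) = (\<integral>\<^sup>+y. g y \<partial>density (distr lborel borel (\<lambda>x. 0 + s *\<^sub>R x)) (\<lambda>_. \<bar>s\<bar>^DIM('a)))"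
      using lborel_affine[of s "0::'a"] that(1) by simp
    also have "\<dots> = ennreal (s ^ n) * (\<integral>\<^sup>+u. g (s *\<^sub>R u) \<partial>lborel)"
      using that(1) by (simp add: nn_integral_density nn_integral_distr nn_integral_cmult n_def)
    finally show ?thesis .
  qed
  have "emeasure lborel ?C = (\<integral>\<^sup>+s. \<integral>\<^sup>+y. indicator ?C (s, y) \<partial>lborel \<partial>lborel)"
    using C by (simp add: lborel_prod[symmetric] lborel.emeasure_pair_measure)
  also have "\<dots> = (\<integral>\<^sup>+s. \<integral>\<^sup>+u. ennreal (s ^ n) * indicator {0<..} s *
       indicator {(s, u). u \<in> S \<and> 0 < s\<^sup>2 * f u \<and> s\<^sup>2 * f u \<le> 1} (s, u) \<partial>lborel \<partial>lborel)"
  proof (rule nn_integral_cong)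
    fix s :: real
    show "(\<integral>\<^sup>+y. indicator ?C (s, y) \<partial>lborel) = (\<integral>\<^sup>+u. ennreal (s ^ n) * indicator {0<..} s *
       indicator {(s, u). u \<in> S \<and> 0 < s\<^sup>2 * f u \<and> s\<^sup>2 * f u \<le> 1} (s, u) \<partial>lborel)"
    proof (cases "s > 0")
      case True
      have "(\<integral>\<^sup>+y. indicator ?C (s, y) \<partial>lborel) = ennreal (s ^ n) * (\<integral>\<^sup>+u. indicator ?C (s, s *\<^sub>R u) \<partial>lborel)"
        by (rule scale[OF True]) measurable
      also have "\<dots> = (\<integral>\<^sup>+u. ennreal (s ^ n) * indicator ?C (s, s *\<^sub>R u) \<partial>lborel)"
        by (subst nn_integral_cmult) auto
      also have "\<dots> = (\<integral>\<^sup>+u. ennreal (s ^ n) * indicator {0<..} s *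
         indicator {(s, u). u \<in> S \<and> 0 < s\<^sup>2 * f u \<and> s\<^sup>2 * f u \<le> 1} (s, u) \<partial>lborel)"
        using True by (intro nn_integral_cong) (auto split: split_indicator)
      finally show ?thesis .
    qed auto
  qed
  also have "\<dots> = (\<integral>\<^sup>+u. \<integral>\<^sup>+s. ennreal (s ^ n) * indicator {0<..} s *
       indicator {(s, u). u \<in> S \<and> 0 < s\<^sup>2 * f u \<and> s\<^sup>2 * f u \<le> 1} (s, u) \<partial>lborel \<partial>lborel)"
    by (rule lborel_pair.Fubini') measurable
  also have "\<dots> = (\<integral>\<^sup>+u. indicator {u \<in> S. 0 < f u} u *
         ennreal (f u powr (- (real DIM('a) + 1) / 2) / (real DIM('a) + 1)) \<partial>lborel)"
  proof (rule nn_integral_cong)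
    fix u :: 'a
    show "(\<integral>\<^sup>+s. ennreal (s ^ n) * indicator {0<..} s *
       indicator {(s, u). u \<in> S \<and> 0 < s\<^sup>2 * f u \<and> s\<^sup>2 * f u \<le> 1} (s, u) \<partial>lborel)
       = indicator {u \<in> S. 0 < f u} u * ennreal (f u powr (- (real DIM('a) + 1) / 2) / (real DIM('a) + 1))"
    proof (cases "u \<in> S \<and> 0 < f u")
      case True
      define R where "R = f u powr (- 1 / 2)"
      have R: "R > 0" using True by (simp add: R_def)
      have "R = inverse (sqrt (f u))"
        using True by (simp add: R_def powr_minus powr_half_sqrt)
      then have R2: "R\<^sup>2 = inverse (f u)"
        using True by (simp add: power_inverse)
      have le: "s\<^sup>2 * f u \<le> 1 \<longleftrightarrow> s \<le> R" if "s > 0" for s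
      proof -
        have "s\<^sup>2 * f u \<le> 1 \<longleftrightarrow> s\<^sup>2 \<le> R\<^sup>2" using True by (simp add: R2 divide_simps)
        also have "\<dots> \<longleftrightarrow> s \<le> R" using that R by (intro power_mono_iff) auto
        finally show ?thesis .
      qed
      have "(\<integral>\<^sup>+s. ennreal (s ^ n) * indicator {0<..} s *
           indicator {(s, u). u \<in> S \<and> 0 < s\<^sup>2 * f u \<and> s\<^sup>2 * f u \<le> 1} (s, u) \<partial>lborel)
         = (\<integral>\<^sup>+s. ennreal (s ^ n) * indicator {0..R} s \<partial>lborel)"
        using True n by (intro nn_integral_cong) (auto split: split_indicator simp: le)
      also have "\<dots> = ennreal (R ^ Suc n / Suc n - 0 ^ Suc n / Suc n)"
        proof (rule nn_integral_FTC_Icc)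
        show "((\<lambda>s. s ^ Suc n / Suc n) has_real_derivative s ^ n) (at s)" for s :: real
          using DERIV_cdivide[OF DERIV_pow[of "Suc n" s], of "real (Suc n)"] by simp
      qed (use R in auto)
      also have "R ^ Suc n / Suc n - 0 ^ Suc n / Suc n = R powr (real n + 1) / (real n + 1)"
        using R by (simp add: powr_realpow powr_add mult.commute add.commute)
      also have "R powr (real n + 1) = f u powr (- (real n + 1) / 2)"
        by (simp add: R_def powr_powr diff_divide_distrib add_divide_distrib)
      finally show ?thesis using True by (simp add: n_def)
    next
      case False
      have "(\<integral>\<^sup>+s. ennreal (s ^ n) * indicator {0<..} s *
           indicator {(s, u). u \<in> S \<and> 0 < s\<^sup>2 * f u \<and> s\<^sup>2 * f u \<le> 1} (s, u) \<partial>lborel) = (\<integral>\<^sup>+s. 0 \<partial>(lborel :: real measure))"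
        using False by (intro nn_integral_cong) (auto split: split_indicator simp: zero_less_mult_iff)
      then show ?thesis using False by simp
    qed
  qed
  finally show ?thesis .
qed

definition cone_over :: "'a::euclidean_space set \<Rightarrow> (real \<times> 'a) set" where
  "cone_over S = {x. 0 < fst x \<and> proj x \<in> S \<and> lorentz x x < 0 \<and> - 1 \<le> lorentz x x}"

text \<open>
  The density of the hyperbolic volume is the one that the chart lemma produces for the form itself.
  Invariance of the volume under Lorentz maps is thereby reduced to that of Lebesgue measure.
\<close>

lemma emeasure_hyp_measure:
  fixes S :: "'a::euclidean_space set"
  assumes [measurable]: "S \<in> sets borel"
  shows "emeasure hyp_measure S = ennreal (real DIM('a) + 1) * emeasure lborel (cone_over S)"
proof -
  define n where "n = real DIM('a)"
  let ?f = "\<lambda>u::'a. 1 - (norm u)\<^sup>2"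
  have n: "n \<ge> 0" by (simp add: n_def)
  have C: "cone_over S = {(s, y). 0 < s \<and> y /\<^sub>R s \<in> S \<and> 0 < s\<^sup>2 * ?f (y /\<^sub>R s) \<and> s\<^sup>2 * ?f (y /\<^sub>R s) \<le> 1}"
  proof -
    have "s\<^sup>2 * ?f (y /\<^sub>R s) = - lorentz (s, y) (s, y)" if "s > 0" for s and y :: 'a
      using that by (simp add: lorentz_def dot_square_norm power2_eq_square field_simps)
    then show ?thesis
      by (auto simp: cone_over_def proj_def)
  qed
  have ball: "0 < ?f u \<longleftrightarrow> u \<in> ball 0 1" for u :: 'a
    by (simp add: power_less_one_iff)
  have dens: "(\<lambda>u. indicator (ball 0 1) u * ennreal (?f u powr (- (n + 1) / 2))) \<in> borel_measurable borel"
  proof (rule borel_measurable_times_ennreal)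
    show "(indicator (ball 0 1) :: 'a \<Rightarrow> ennreal) \<in> borel_measurable borel"
      by (rule borel_measurable_indicator) simp
  qed measurable
  have "emeasure hyp_measure S = (\<integral>\<^sup>+u. indicator (ball 0 1) u * ennreal (?f u powr (- (n + 1) / 2)) * indicator S u \<partial>lborel)"
    unfolding hyp_measure_def n_def using dens unfolding n_def by (intro emeasure_density) simp_all
  also have "\<dots> = (\<integral>\<^sup>+u. ennreal (n + 1) * (indicator {u \<in> S. 0 < ?f u} u * ennreal (?f u powr (- (n + 1) / 2) / (n + 1))) \<partial>lborel)"
  proof (rule nn_integral_cong)
    fix u :: 'a
    have "ennreal (?f u powr (- (n + 1) / 2)) = ennreal (n + 1) * ennreal (?f u powr (- (n + 1) / 2) / (n + 1))"
      using n by (subst ennreal_mult[symmetric]) auto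
    then show "indicator (ball 0 1) u * ennreal (?f u powr (- (n + 1) / 2)) * indicator S u =
        ennreal (n + 1) * (indicator {u \<in> S. 0 < ?f u} u * ennreal (?f u powr (- (n + 1) / 2) / (n + 1)))"
      using ball[of u] by (cases "u \<in> S"; cases "0 < ?f u") (simp_all del: ennreal_plus mem_ball)
  qed
  also have "\<dots> = ennreal (n + 1) * (\<integral>\<^sup>+u. indicator {u \<in> S. 0 < ?f u} u * ennreal (?f u powr (- (n + 1) / 2) / (n + 1)) \<partial>lborel)"
    by (rule nn_integral_cmult) measurable
  also have "\<dots> = ennreal (n + 1) * emeasure lborel (cone_over S)"
    unfolding C n_def by (subst emeasure_cone_in_chart) auto
  finally show ?thesis by (simp add: n_def)
qed

lemma emeasure_lorentz_vimage:
  fixes f :: "real \<times> (real ^ 'n::{finite,wellorder}) \<Rightarrow> real \<times> (real ^ 'n::{finite,wellorder})"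
  assumes "linear f" "\<And>x y. lorentz (f x) (f y) = lorentz x y" "C \<in> sets borel"
  shows "emeasure lborel (f -` C) = emeasure lborel C"
proof -
  have "emeasure lborel C = emeasure (distr lborel borel f) C"
    using lborel_distr_lorentz[OF assms(1,2)] by simp
  also have "\<dots> = emeasure lborel (f -` C)"
    using assms linear_borel_measurable[OF assms(1)] by (subst emeasure_distr) auto
  finally show ?thesis by simp
qed

section \<open>The volume of a ball\<close>

lemma linear_reflection: "linear (reflection e)"
proof (rule linearI)
  show "reflection e (x + y) = reflection e x + reflection e y" for x y
    by (simp add: reflection_def lorentz_bilinear distrib_left add_divide_distrib scaleR_add_left)
  show "reflection e (k *\<^sub>R x) = k *\<^sub>R reflection e x" for k x
    by (simp add: reflection_def lorentz_bilinear scaleR_diff_right mult.left_commute)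
qed

lemma lorentz_reflection:
  assumes "lorentz e e \<noteq> 0"
  shows "lorentz (reflection e x) (reflection e y) = lorentz x y"
proof -
  define k where "k = 2 * lorentz x e / lorentz e e"
  define l where "l = 2 * lorentz y e / lorentz e e"
  have k: "k * lorentz e e = 2 * lorentz x e" and l: "l * lorentz e e = 2 * lorentz y e"
    using assms by (simp_all add: k_def l_def)
  have "lorentz (x - k *\<^sub>R e) (y - l *\<^sub>R e)
      = lorentz x y - l * lorentz x e - k * lorentz y e + k * (l * lorentz e e)"
    by (simp add: lorentz_bilinear lorentz_commute[of e y] algebra_simps)
  also have "\<dots> = lorentz x y + k * lorentz y e - l * lorentz x e"
    by (simp add: l)
  also have "k * lorentz y e = l * lorentz x e"
    by (simp add: k_def l_def)
  finally show ?thesis by (simp add: reflection_def k_def l_def)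
qed

text \<open>
  The description involves only the form and the centre, so that a Lorentz map carrying one centre to
  another carries one cone to the other.
\<close>

lemma cone_over_hyp_cball:
  assumes "c \<in> ball 0 1" "r \<ge> 0"
  shows "cone_over (hyp_cball c r) = {x. lorentz x x < 0 \<and> - 1 \<le> lorentz x x \<and>
    lorentz x (unit_lift c) < 0 \<and> - lorentz x (unit_lift c) \<le> cosh r * sqrt (- lorentz x x)}"
proof -
  have fut: "0 < fst x \<longleftrightarrow> lorentz x (unit_lift c) < 0" if "lorentz x x < 0" for x
    by (rule future_iff) (use assms that unit_lift_unit[of c] fst_unit_lift_pos[of c] in auto)
  have "proj x \<in> hyp_cball c r \<longleftrightarrow> - lorentz x (unit_lift c) \<le> cosh r * sqrt (- lorentz x x)"
    if "lorentz x x < 0" "0 < fst x" for x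
    using that proj_in_ball[of x] assms
    by (simp add: hyp_cball_eq unit_lift_proj lorentz_bilinear lorentz_commute[of "unit_lift c"] field_simps)
  then show ?thesis using fut by (fastforce simp: cone_over_def)
qed

lemma sets_hyp_cball: 
  assumes "c \<in> ball 0 1" "r \<ge> 0"
  shows "hyp_cball c r \<in> sets borel"
proof -
  have "hyp_cball c r = {u \<in> ball 0 1. - lorentz (unit_lift c) (lift u) \<le> cosh r * sqrt (1 - (norm u)\<^sup>2)}"
  proof -
    have "- lorentz (unit_lift c) (unit_lift u) \<le> cosh r \<longleftrightarrow>
        - lorentz (unit_lift c) (lift u) \<le> cosh r * sqrt (1 - (norm u)\<^sup>2)" if "u \<in> ball 0 1" for u
    proof -
      define q where "q = sqrt (1 - (norm u)\<^sup>2)"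
      have "q > 0" "lift u = q *\<^sub>R unit_lift u"
        using norm_sq_less_1[OF that] lift_eq_unit_lift[OF that] by (auto simp: q_def)
      then show ?thesis
        using mult_le_cancel_left_pos[of q "- lorentz (unit_lift c) (unit_lift u)" "cosh r"]
        by (simp add: lorentz_bilinear q_def[symmetric] mult.commute)
    qed
    then show ?thesis using assms by (auto simp: hyp_cball_eq)
  qed
  also have "\<dots> = ball 0 1 \<inter> {u. - lorentz (unit_lift c) (lift u) \<le> cosh r * sqrt (1 - (norm u)\<^sup>2)}" by auto
  also have "\<dots> \<in> sets borel"
    unfolding lift_def by (intro sets.Int borel_closed closed_Collect_le continuous_intros borel_open) auto
  finally show ?thesis .
qed

text \<open>
  The reflection in the hyperplane orthogonal to \<open>C - (1, 0)\<close> exchanges \<open>C\<close> and \<open>(1, 0)\<close>.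
\<close>

lemma timelike_to_time_axis:
  fixes C :: "real \<times> 'a::euclidean_space"
  assumes "lorentz C C = - 1" "fst C > 0"
  obtains f :: "real \<times> 'a \<Rightarrow> real \<times> 'a"
  where "linear f" "\<And>x y. lorentz (f x) (f y) = lorentz x y" "f C = (1, 0)"
proof (cases "C = (1, 0)")
  case True
  then show ?thesis using that[of id] by (simp add: linear_id)
next
  case False
  define w where "w = C - (1, 0)"
  have CC: "(fst C)\<^sup>2 = 1 + (norm (snd C))\<^sup>2"
    using assms(1) by (simp add: lorentz_def dot_square_norm power2_eq_square[of "fst C"])
  have "fst C \<noteq> 1"
  proof
    assume "fst C = 1"
    then have "snd C = 0" using CC by simp
    then show False using \<open>fst C = 1\<close> False by (simp add: prod_eq_iff)
  qed
  have e: "lorentz C (1, 0) = - fst C" "lorentz (1, 0) C = - fst C" "lorentz (1, 0) (1, 0 :: 'a) = - 1"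
    by (simp_all add: lorentz_def)
  have ww: "lorentz w w = 2 * (fst C - 1)"
    using assms(1) by (simp add: w_def lorentz_bilinear e)
  have "lorentz C w = fst C - 1"
    using assms(1) by (simp add: w_def lorentz_bilinear e)
  then have "reflection w C = C - w"
    using \<open>fst C \<noteq> 1\<close> by (simp add: reflection_def ww)
  then have "reflection w C = (1, 0)" by (simp add: w_def)
  then show ?thesis
    using \<open>fst C \<noteq> 1\<close> by (intro that[of "reflection w"] linear_reflection lorentz_reflection) (simp_all add: ww)
qed

lemma unit_lift_0: "unit_lift 0 = (1, 0)"
  by (simp add: unit_lift_def lift_def)

lemma emeasure_hyp_cball_center:
  fixes c :: "real ^ 'n::{finite,wellorder}"
  assumes c: "c \<in> ball 0 1" and r: "r \<ge> 0"
  shows "emeasure hyp_measure (hyp_cball c r) = emeasure hyp_measure (hyp_cball (0 :: real ^ 'n::{finite,wellorder}) r)"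
proof -
  obtain f :: "real \<times> (real ^ 'n::{finite,wellorder}) \<Rightarrow> real \<times> (real ^ 'n::{finite,wellorder})"
    where f: "linear f" "\<And>x y. lorentz (f x) (f y) = lorentz x y" "f (unit_lift c) = (1, 0)"
    using timelike_to_time_axis[of "unit_lift c"] unit_lift_unit[OF c] fst_unit_lift_pos[OF c] by blast
  have fc: "lorentz (f x) (1, 0) = lorentz x (unit_lift c)" for x
    using f(2)[of x "unit_lift c"] f(3) by simp
  have "cone_over (hyp_cball c r) = f -` cone_over (hyp_cball 0 r)"
    using c r by (simp add: cone_over_hyp_cball unit_lift_0 f(2) fc)
  moreover have "cone_over (hyp_cball (0 :: real ^ 'n::{finite,wellorder}) r) \<in> sets borel"
  proof -
    have "cone_over (hyp_cball (0 :: real ^ 'n::{finite,wellorder}) r) =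
       {x. lorentz x x < 0} \<inter> {x. - 1 \<le> lorentz x x} \<inter> {x. lorentz x (unit_lift 0) < 0} \<inter>
       {x. - lorentz x (unit_lift 0) \<le> cosh r * sqrt (- lorentz x x)}"
      using r by (auto simp: cone_over_hyp_cball)
    also have "\<dots> \<in> sets borel"
      by (intro sets.Int borel_open[OF open_Collect_less] borel_closed[OF closed_Collect_le] continuous_intros)
    finally show ?thesis .
  qed
  ultimately show ?thesis
    using emeasure_lorentz_vimage[OF f(1,2)] sets_hyp_cball[OF c r] r
      sets_hyp_cball[of "0 :: real ^ 'n::{finite,wellorder}" r]
    by (simp add: emeasure_hyp_measure)
qed

text \<open>
  The section at time \<open>t\<close> of the cone over a ball around the origin is the Euclidean ball of radius
  \<open>t tanh r\<close>, from which for \<open>t > 1\<close> the open ball of radius \<open>sqrt (t\<^sup>2 - 1)\<close> is removed; it is empty for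
  \<open>t > cosh r\<close>.
\<close>

lemma emeasure_hyp_cball_0:
  fixes r :: real
  assumes r: "r > 0"
  shows "emeasure hyp_measure (hyp_cball (0 :: real ^ 4) r)
    = ennreal (2 * pi\<^sup>2 / 3 * ((cosh r - 1)\<^sup>2 * (cosh r + 2)))"
proof -
  define C where "C = cosh r"
  define \<tau> where "\<tau> = sinh r / cosh r"
  define \<beta> where "\<beta> = pi\<^sup>2 / 2"
  have C: "C > 1" using r cosh_real_nonneg_less_iff[of 0 r] by (simp add: C_def)
  have \<beta>: "\<beta> > 0" by (simp add: \<beta>_def)
  have \<tau>: "\<tau> > 0" using r by (simp add: \<tau>_def)
  have \<tau>2: "\<tau>\<^sup>2 = 1 - 1 / C\<^sup>2"
    by (simp add: \<tau>_def C_def power_divide sinh_square_eq diff_divide_distrib)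
  have \<tau>1: "\<tau> < 1"
  proof -
    have "\<tau>\<^sup>2 < 1" using C by (simp add: \<tau>2)
    then show ?thesis by (smt (verit) \<tau> one_le_power)
  qed
  have vol: "emeasure lborel (cball (0 :: real ^ 4) s) = ennreal (\<beta> * s ^ 4)"
    "emeasure lborel (ball (0 :: real ^ 4) s) = ennreal (\<beta> * s ^ 4)" if "s \<ge> 0" for s
    using that by (simp_all add: emeasure_cball emeasure_ball unit_ball_vol_4 \<beta>_def)
  define K where "K = cone_over (hyp_cball (0 :: real ^ 4) r)"
  have K: "(t, y) \<in> K \<longleftrightarrow> 0 < t \<and> norm y \<le> \<tau> * t \<and> t\<^sup>2 - 1 \<le> (norm y)\<^sup>2" for t y
  proof -
    have l: "lorentz (t, y) (t, y) = (norm y)\<^sup>2 - t\<^sup>2" "lorentz (t, y) (1, 0) = - t"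
      by (simp_all add: lorentz_def dot_square_norm power2_eq_square[of t])
    have *: "norm y \<le> \<tau> * t \<longleftrightarrow> (norm y)\<^sup>2 < t\<^sup>2 \<and> t \<le> C * sqrt (t\<^sup>2 - (norm y)\<^sup>2)" if t: "0 < t"
    proof -
      have "norm y \<le> \<tau> * t \<longleftrightarrow> (norm y)\<^sup>2 \<le> (\<tau> * t)\<^sup>2"
        using \<tau> t power_mono_iff[of "norm y" "\<tau> * t" 2] by simp
      also have "\<dots> \<longleftrightarrow> t\<^sup>2 \<le> C\<^sup>2 * (t\<^sup>2 - (norm y)\<^sup>2)"
        using C by (simp add: power_mult_distrib \<tau>2 field_simps)
      also have "\<dots> \<longleftrightarrow> (norm y)\<^sup>2 < t\<^sup>2 \<and> t \<le> C * sqrt (t\<^sup>2 - (norm y)\<^sup>2)"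
      proof (cases "(norm y)\<^sup>2 < t\<^sup>2")
        case True
        have "0 \<le> C * sqrt (t\<^sup>2 - (norm y)\<^sup>2)" using True C by simp
        then have "t \<le> C * sqrt (t\<^sup>2 - (norm y)\<^sup>2) \<longleftrightarrow> t\<^sup>2 \<le> (C * sqrt (t\<^sup>2 - (norm y)\<^sup>2))\<^sup>2"
          using t power_mono_iff[of t "C * sqrt (t\<^sup>2 - (norm y)\<^sup>2)" 2] by simp
        then show ?thesis using True by (simp add: power_mult_distrib)
      next
        case False
        then have "C\<^sup>2 * (t\<^sup>2 - (norm y)\<^sup>2) \<le> 0" by (simp add: mult_nonneg_nonpos)
        then show ?thesis using False t by (smt (verit) zero_less_power)
      qed
      finally show ?thesis .
    qed
    have "(t, y) \<in> K \<longleftrightarrow> (norm y)\<^sup>2 < t\<^sup>2 \<and> t\<^sup>2 - 1 \<le> (norm y)\<^sup>2 \<and> 0 < t \<and> t \<le> C * sqrt (t\<^sup>2 - (norm y)\<^sup>2)"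
      using r by (auto simp: K_def cone_over_hyp_cball unit_lift_0 l C_def)
    then show ?thesis using * by auto
  qed
  have Km: "K \<in> sets (lborel \<Otimes>\<^sub>M lborel)"
  proof -
    have "K = {x. 0 < fst x} \<inter> {x. norm (snd x) \<le> \<tau> * fst x} \<inter> {x. (fst x)\<^sup>2 - 1 \<le> (norm (snd x))\<^sup>2}"
      using K by auto
    also have "\<dots> \<in> sets borel"
      by (intro sets.Int borel_open[OF open_Collect_less] borel_closed[OF closed_Collect_le] continuous_intros)
    finally show ?thesis using lborel_prod sets_lborel by metis
  qed
  have slice: "emeasure lborel (Pair t -` K) = ennreal (\<beta> * \<tau> ^ 4 * t ^ 4) * indicator {0..1} t
      + ennreal (\<beta> * (\<tau> ^ 4 * t ^ 4 - (t\<^sup>2 - 1)\<^sup>2)) * indicator {1..C} t" if t1: "t \<noteq> 1" for t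
  proof -
    consider "t \<le> 0" | "0 < t" "t < 1" | "1 < t" "t \<le> C" | "C < t" using t1 by linarith
    then show ?thesis
    proof cases
      case 1
      then have "Pair t -` K = {}" by (auto simp: K)
      then show ?thesis using 1 C by (auto split: split_indicator)
    next
      case 2
      have "t\<^sup>2 < 1" using 2 by (simp add: power_less_one_iff)
      then have "t\<^sup>2 - 1 \<le> (norm y)\<^sup>2" for y :: "real ^ 4"
        using zero_le_power2[of "norm y"] by linarith
      then have "Pair t -` K = cball 0 (\<tau> * t)"
        using 2 by (auto simp: K)
      then show ?thesis using 2 C \<tau> by (auto simp: vol power_mult_distrib mult.assoc split: split_indicator)
    next
      case 3
      define s where "s = sqrt (t\<^sup>2 - 1)"
      have t2: "t\<^sup>2 > 1" using 3 by simp
      have s: "s \<ge> 0" "s\<^sup>2 = t\<^sup>2 - 1" using t2 by (auto simp: s_def)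
      have "t\<^sup>2 \<le> C\<^sup>2" using 3 by (intro power_mono) auto
      then have "s\<^sup>2 \<le> (\<tau> * t)\<^sup>2"
        using C by (simp add: s power_mult_distrib \<tau>2 field_simps)
      then have st: "s \<le> \<tau> * t" using 3 \<tau> by (auto intro: power2_le_imp_le)
      have "Pair t -` K = cball 0 (\<tau> * t) - ball 0 s"
      proof -
        have "t\<^sup>2 - 1 \<le> (norm y)\<^sup>2 \<longleftrightarrow> s \<le> norm y" for y :: "real ^ 4"
          using s power_mono_iff[of s "norm y" 2] by simp
        then show ?thesis using 3 by (auto simp: K)
      qed
      moreover have "emeasure lborel (cball 0 (\<tau> * t) - ball (0 :: real ^ 4) s)
          = emeasure lborel (cball (0 :: real ^ 4) (\<tau> * t)) - emeasure lborel (ball (0 :: real ^ 4) s)"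
        using st s(1) by (intro emeasure_Diff) (auto simp: vol)
      ultimately have "emeasure lborel (Pair t -` K) = ennreal (\<beta> * (\<tau> * t) ^ 4) - ennreal (\<beta> * s ^ 4)"
        using s(1) 3 \<tau> by (simp add: vol)
      also have "\<dots> = ennreal (\<beta> * (\<tau> * t) ^ 4 - \<beta> * s ^ 4)"
        using \<beta> s by (subst ennreal_minus) auto
      also have "s ^ 4 = (t\<^sup>2 - 1)\<^sup>2"
        using power_mult[of s 2 2] s(2) by simp
      finally show ?thesis using 3 by (simp add: power_mult_distrib algebra_simps)
    next
      case 4
      have "C\<^sup>2 < t\<^sup>2" using 4 C by (intro power_strict_mono) auto
      have "(t, y) \<notin> K" for y
      proof
        assume "(t, y) \<in> K"
        then have "norm y \<le> \<tau> * t" "t\<^sup>2 - 1 \<le> (norm y)\<^sup>2" by (auto simp: K)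
        then have "t\<^sup>2 - 1 \<le> (\<tau> * t)\<^sup>2" by (smt (verit) norm_ge_zero power_mono)
        then have "t\<^sup>2 \<le> C\<^sup>2" using C by (simp add: power_mult_distrib \<tau>2 field_simps)
        then show False using \<open>C\<^sup>2 < t\<^sup>2\<close> by simp
      qed
      then have "Pair t -` K = {}" by auto
      then show ?thesis using 4 C by (auto split: split_indicator)
    qed
  qed
  have pos: "0 \<le> \<tau> ^ 4 * t ^ 4 - (t\<^sup>2 - 1)\<^sup>2" if "1 \<le> t" "t \<le> C" for t
  proof -
    have "t\<^sup>2 \<le> C\<^sup>2" using that by (intro power_mono) auto
    then have "t\<^sup>2 - 1 \<le> (\<tau> * t)\<^sup>2"
      using C by (simp add: power_mult_distrib \<tau>2 field_simps)
    then have "(t\<^sup>2 - 1)\<^sup>2 \<le> ((\<tau> * t)\<^sup>2)\<^sup>2" using that by (intro power_mono) auto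
    also have "\<dots> = \<tau> ^ 4 * t ^ 4" by (simp add: power_mult_distrib power_mult[symmetric])
    finally show ?thesis by simp
  qed
  have dF: "((\<lambda>t. \<beta> * (\<tau> ^ 4 * t ^ 5 / 5 - (t ^ 5 / 5 - 2 * t ^ 3 / 3 + t))) has_real_derivative
        \<beta> * (\<tau> ^ 4 * t ^ 4 - (t\<^sup>2 - 1)\<^sup>2)) (at t)" for t
    by (auto intro!: derivative_eq_intros simp: power2_eq_square power4_eq_xxxx algebra_simps)
  have "emeasure lborel K = (\<integral>\<^sup>+t. emeasure lborel (Pair t -` K) \<partial>lborel)"
    using Km by (simp add: lborel_prod[symmetric] lborel.emeasure_pair_measure_alt)
  also have "\<dots> = (\<integral>\<^sup>+t. ennreal (\<beta> * \<tau> ^ 4 * t ^ 4) * indicator {0..1} t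
      + ennreal (\<beta> * (\<tau> ^ 4 * t ^ 4 - (t\<^sup>2 - 1)\<^sup>2)) * indicator {1..C} t \<partial>lborel)"
    using slice by (intro nn_integral_cong_AE) (use AE_lborel_singleton[of "1::real"] in \<open>auto elim!: eventually_mono\<close>)
  also have "\<dots> = (\<integral>\<^sup>+t. ennreal (\<beta> * \<tau> ^ 4 * t ^ 4) * indicator {0..1} t \<partial>lborel)
      + (\<integral>\<^sup>+t. ennreal (\<beta> * (\<tau> ^ 4 * t ^ 4 - (t\<^sup>2 - 1)\<^sup>2)) * indicator {1..C} t \<partial>lborel)"
    by (rule nn_integral_add) auto
  also have "(\<integral>\<^sup>+t. ennreal (\<beta> * \<tau> ^ 4 * t ^ 4) * indicator {0..1} t \<partial>lborel)
      = ennreal (\<beta> * \<tau> ^ 4 * 1 ^ 5 / 5 - \<beta> * \<tau> ^ 4 * 0 ^ 5 / 5)"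
    by (rule nn_integral_FTC_Icc) (use \<beta> in \<open>auto intro!: derivative_eq_intros\<close>)
  also have "(\<integral>\<^sup>+t. ennreal (\<beta> * (\<tau> ^ 4 * t ^ 4 - (t\<^sup>2 - 1)\<^sup>2)) * indicator {1..C} t \<partial>lborel)
      = ennreal (\<beta> * (\<tau> ^ 4 * C ^ 5 / 5 - (C ^ 5 / 5 - 2 * C ^ 3 / 3 + C))
        - \<beta> * (\<tau> ^ 4 * 1 ^ 5 / 5 - (1 ^ 5 / 5 - 2 * 1 ^ 3 / 3 + 1)))"
  proof (rule nn_integral_FTC_Icc[where F = "\<lambda>t. \<beta> * (\<tau> ^ 4 * t ^ 5 / 5 - (t ^ 5 / 5 - 2 * t ^ 3 / 3 + t))"])
    show "0 \<le> \<beta> * (\<tau> ^ 4 * t ^ 4 - (t\<^sup>2 - 1)\<^sup>2)" if "t \<in> {1..C}" for t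
      using \<beta> pos[of t] that by simp
  qed (use C dF in auto)
  also have "ennreal (\<beta> * \<tau> ^ 4 * 1 ^ 5 / 5 - \<beta> * \<tau> ^ 4 * 0 ^ 5 / 5) + \<dots> =
     ennreal (\<beta> * (\<tau> ^ 4 * C ^ 5 / 5 - (C ^ 5 / 5 - 2 * C ^ 3 / 3 + C) + 8 / 15))"
  proof -
    define F where "F t = \<beta> * (\<tau> ^ 4 * t ^ 5 / 5 - (t ^ 5 / 5 - 2 * t ^ 3 / 3 + t))" for t :: real
    have "F 1 \<le> F C"
    proof (rule DERIV_nonneg_imp_nondecreasing[of 1 C F])
      fix t assume "1 \<le> t" "t \<le> C"
      then show "\<exists>y. (F has_real_derivative y) (at t) \<and> 0 \<le> y"
        using dF[of t] \<beta> pos[of t] unfolding F_def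
        by (intro exI[of _ "\<beta> * (\<tau> ^ 4 * t ^ 4 - (t\<^sup>2 - 1)\<^sup>2)"]) simp
    qed (use C in simp)
    then have "0 \<le> F C - F 1" by simp
    moreover have "0 \<le> \<beta> * \<tau> ^ 4 * 1 ^ 5 / 5 - \<beta> * \<tau> ^ 4 * 0 ^ 5 / 5" using \<beta> by simp
    ultimately have "ennreal (\<beta> * \<tau> ^ 4 * 1 ^ 5 / 5 - \<beta> * \<tau> ^ 4 * 0 ^ 5 / 5) + ennreal (F C - F 1)
        = ennreal (\<beta> * \<tau> ^ 4 * 1 ^ 5 / 5 - \<beta> * \<tau> ^ 4 * 0 ^ 5 / 5 + (F C - F 1))"
      by (simp add: ennreal_plus del: ennreal_minus)
    also have "\<beta> * \<tau> ^ 4 * 1 ^ 5 / 5 - \<beta> * \<tau> ^ 4 * 0 ^ 5 / 5 + (F C - F 1)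
        = \<beta> * (\<tau> ^ 4 * C ^ 5 / 5 - (C ^ 5 / 5 - 2 * C ^ 3 / 3 + C) + 8 / 15)"
      by (simp add: F_def algebra_simps)
    finally show ?thesis by (simp only: F_def)
  qed
  finally have vK: "emeasure lborel K = ennreal (\<beta> * (\<tau> ^ 4 * C ^ 5 / 5 - (C ^ 5 / 5 - 2 * C ^ 3 / 3 + C) + 8 / 15))" .
  have "\<tau> ^ 4 * C ^ 5 = (C\<^sup>2 - 1)\<^sup>2 * C"
  proof -
    have "\<tau> ^ 4 * C ^ 5 = (\<tau>\<^sup>2 * C\<^sup>2)\<^sup>2 * C" by (simp add: power2_eq_square eval_nat_numeral)
    also have "\<tau>\<^sup>2 * C\<^sup>2 = C\<^sup>2 - 1" using C by (simp add: \<tau>2 field_simps)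
    finally show ?thesis .
  qed
  then have "5 * (\<beta> * (\<tau> ^ 4 * C ^ 5 / 5 - (C ^ 5 / 5 - 2 * C ^ 3 / 3 + C) + 8 / 15))
      = \<beta> * ((C\<^sup>2 - 1)\<^sup>2 * C - C ^ 5 + 10 * C ^ 3 / 3 - 5 * C + 8 / 3)"
    by (simp add: algebra_simps)
  also have "(C\<^sup>2 - 1)\<^sup>2 * C - C ^ 5 + 10 * C ^ 3 / 3 - 5 * C + 8 / 3 = 4 / 3 * ((C - 1)\<^sup>2 * (C + 2))"
  proof -
    have "3 * ((C\<^sup>2 - 1)\<^sup>2 * C - C ^ 5) + 10 * C ^ 3 - 15 * C + 8 = 4 * ((C - 1)\<^sup>2 * (C + 2))"
      by algebra
    moreover have "3 * (p - q) + 10 * r - 15 * x + 8 = 4 * w \<Longrightarrow>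
        p - q + 10 * r / 3 - 5 * x + 8 / 3 = 4 / 3 * w" for p q r x w :: real
      by (simp add: field_simps)
    ultimately show ?thesis by blast
  qed
  finally have eq: "5 * (\<beta> * (\<tau> ^ 4 * C ^ 5 / 5 - (C ^ 5 / 5 - 2 * C ^ 3 / 3 + C) + 8 / 15))
     = 2 * pi\<^sup>2 / 3 * ((C - 1)\<^sup>2 * (C + 2))"
    by (simp add: \<beta>_def)
  have "emeasure hyp_measure (hyp_cball (0 :: real ^ 4) r) = ennreal 5 * emeasure lborel K"
    using r sets_hyp_cball[of "0 :: real ^ 4" r] by (simp add: emeasure_hyp_measure K_def)
  also have "\<dots> = ennreal (5 * (\<beta> * (\<tau> ^ 4 * C ^ 5 / 5 - (C ^ 5 / 5 - 2 * C ^ 3 / 3 + C) + 8 / 15)))"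
    by (simp only: vK) (subst ennreal_mult'; simp)
  finally show ?thesis unfolding eq by (simp only: C_def)
qed

lemma hyp_vol_hyp_cball:
  assumes "c \<in> ball (0 :: real ^ 4) 1" "r > 0"
  shows "hyp_vol (hyp_cball c r) = 2 * pi\<^sup>2 / 3 * ((cosh r - 1)\<^sup>2 * (cosh r + 2))"
proof -
  have "0 \<le> 2 * pi\<^sup>2 / 3 * ((cosh r - 1)\<^sup>2 * (cosh r + 2))"
    using cosh_real_pos[of r] by (intro mult_nonneg_nonneg) auto
  moreover have "emeasure hyp_measure (hyp_cball c r) = ennreal (2 * pi\<^sup>2 / 3 * ((cosh r - 1)\<^sup>2 * (cosh r + 2)))"
    using emeasure_hyp_cball_center[OF assms(1), of r] emeasure_hyp_cball_0[OF assms(2)] assms(2) by simp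
  ultimately show ?thesis by (simp add: measure_def)
qed

section \<open>Coordinates adapted to the ideal vertex\<close>

lemma vector_4 [simp]:
  "(vector [w, x, y, z] :: 'a::zero ^ 4) $ 1 = w"
  "(vector [w, x, y, z] :: 'a::zero ^ 4) $ 2 = x"
  "(vector [w, x, y, z] :: 'a::zero ^ 4) $ 3 = y"
  "(vector [w, x, y, z] :: 'a::zero ^ 4) $ 4 = z"
  unfolding vector_def by simp_all

lemma lorentz_coordinates:
  fixes x y :: "real \<times> (real ^ 4)"
  shows "lorentz x y = - (fst x * fst y) + snd x $ 1 * snd y $ 1 + snd x $ 2 * snd y $ 2
    + snd x $ 3 * snd y $ 3 + snd x $ 4 * snd y $ 4"
  by (simp add: lorentz_def inner_vec_def sum_4)

text \<open>
  The normals of the two parallel facets add up to a null vector, which represents the ideal point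
  that these facets share.  The interior point in the definition of \<^const>\<open>normals\<close> shows that
  it points to the future, and a vector on the inner side of all facets pairs nonpositively with it.
\<close>

lemma future_if_inside:
  fixes b :: "nat \<Rightarrow> real \<times> 'a::euclidean_space"
  assumes b: "normals m b" and x: "lorentz x x < 0" "\<And>i. i \<le> DIM('a) + 1 \<Longrightarrow> lorentz x (b i) \<le> 0"
  shows "fst x > 0"
proof -
  define N where "N = b DIM('a) + b (DIM('a) + 1)"
  have unit: "lorentz (b i) (b i) = 1" if "i \<le> DIM('a) + 1" for i
    using b that by (auto simp: normals_def)
  have par: "lorentz (b DIM('a)) (b (DIM('a) + 1)) = - 1"
    using b unfolding normals_def by blast
  have NN: "lorentz N N = 0"
    using unit[of "DIM('a)"] unit[of "DIM('a) + 1"] par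
      lorentz_commute[of "b (DIM('a) + 1)" "b DIM('a)"]
    by (simp add: N_def lorentz_bilinear)
  obtain u where u: "u \<in> ball 0 1" "\<And>i. i \<le> DIM('a) + 1 \<Longrightarrow> lorentz (lift u) (b i) < 0"
    using b unfolding normals_def by blast
  have "lorentz (lift u) (b DIM('a)) < 0" "lorentz (lift u) (b (DIM('a) + 1)) < 0"
    using u(2) by simp_all
  then have uN: "lorentz (lift u) N < 0" by (simp add: N_def lorentz_bilinear)
  have lu: "lorentz (lift u) (lift u) < 0" "fst (lift u) > 0"
    using norm_sq_less_1[OF u(1)] by (simp_all only: lorentz_lift_lift) (auto simp: lift_def)
  have N0: "fst N > 0"
  proof (rule ccontr)
    assume "\<not> fst N > 0"
    moreover have "fst N \<noteq> 0"
    proof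
      assume "fst N = 0"
      then have "snd N = 0" using NN causal_norm_le[of N] by simp
      then show False using uN \<open>fst N = 0\<close> by (simp add: lorentz_def)
    qed
    ultimately have "lorentz (lift u) (- N) < 0"
      using lu NN by (rule_tac lorentz_future_neg) (simp_all add: lorentz_minus_left lorentz_minus_right)
    then show False using uN by (simp add: lorentz_minus_right)
  qed
  have xN: "lorentz x N \<le> 0"
    using x(2)[of "DIM('a)"] x(2)[of "DIM('a) + 1"] by (simp add: N_def lorentz_bilinear)
  show ?thesis
  proof (rule ccontr)
    assume "\<not> fst x > 0"
    moreover have "fst x \<noteq> 0"
      using x(1) timelike_norm_less[of x] norm_ge_zero[of "snd x"] by linarith
    ultimately have "lorentz (- x) N < 0"
      using x(1) NN N0 by (rule_tac lorentz_future_neg) (simp_all add: lorentz_minus_left lorentz_minus_right)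
    then show False using xN by (simp add: lorentz_minus_left)
  qed
qed

text \<open>
  The time orientation need not be stated: the inequalities of the facets imply it.
\<close>

lemma cone_over_truncated_orthoscheme:
  fixes b :: "nat \<Rightarrow> real \<times> 'a::euclidean_space"
  assumes "normals m b"
  shows "cone_over (truncated_orthoscheme b) =
    {x. lorentz x x < 0 \<and> - 1 \<le> lorentz x x \<and> (\<forall>i \<le> DIM('a) + 1. lorentz x (b i) \<le> 0)}"
proof -
  have "x \<in> cone_over (truncated_orthoscheme b) \<longleftrightarrow>
      lorentz x x < 0 \<and> - 1 \<le> lorentz x x \<and> (\<forall>i \<le> DIM('a) + 1. lorentz x (b i) \<le> 0)" for x
  proof -
    have *: "proj x \<in> truncated_orthoscheme b \<longleftrightarrow> (\<forall>i \<le> DIM('a) + 1. lorentz x (b i) \<le> 0)"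
      if "lorentz x x < 0" "fst x > 0"
    proof -
      have "lorentz (lift (proj x)) (b i) \<le> 0 \<longleftrightarrow> lorentz x (b i) \<le> 0" for i
        using that by (simp add: lift_proj lorentz_bilinear mult_le_0_iff)
      moreover have "proj x \<in> cball 0 1" using proj_in_ball[OF that(1)] by simp
      ultimately show ?thesis by (simp add: truncated_orthoscheme_def)
    qed
    show ?thesis
      using * future_if_inside[OF assms, of x] unfolding cone_over_def by blast
  qed
  then show ?thesis by blast
qed

text \<open>
  A standard position: the null vector \<open>p = (1, (0, 0, 0, 1))\<close> represents the ideal vertex,
  \<open>r = x\<^sub>0 - x\<^sub>4 = - \<langle>x, p\<rangle>\<close> is the null coordinate, and \<open>q\<^sub>i = x\<^sub>i / r\<close> for \<open>i = 1, 2, 3\<close> are the horizontal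
  coordinates of the upper half-space model with the vertex at infinity.  In this order, the normals
  stand for \<open>q\<^sub>2 \<ge> 0\<close>, \<open>c q\<^sub>2 \<le> s q\<^sub>1\<close>, \<open>q\<^sub>1 \<le> a\<close>, the exterior of the unit hemisphere, \<open>q\<^sub>3 \<le> h\<close> and
  \<open>q\<^sub>3 \<ge> 0\<close>, where \<open>c\<close> and \<open>s\<close> are the cosine and the sine of \<open>\<pi> / m\<^sub>1\<close>.
\<close>

definition model_normals :: "real \<Rightarrow> real \<Rightarrow> real \<Rightarrow> real \<Rightarrow> nat \<Rightarrow> real \<times> (real ^ 4)" where
  "model_normals c s a h i =
     (if i = 0 then (0, vector [0, -1, 0, 0])
      else if i = 1 then (0, vector [- s, c, 0, 0])
      else if i = 2 then (a, vector [1, 0, 0, a])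
      else if i = 3 then (0, vector [0, 0, 0, -1])
      else if i = 4 then (h, vector [0, 0, 1, h])
      else (0, vector [0, 0, -1, 0]))"

lemma model_normals_simps [simp]:
  "model_normals c s a h 0 = (0, vector [0, -1, 0, 0])"
  "model_normals c s a h (Suc 0) = (0, vector [- s, c, 0, 0])"
  "model_normals c s a h 1 = (0, vector [- s, c, 0, 0])"
  "model_normals c s a h 2 = (a, vector [1, 0, 0, a])"
  "model_normals c s a h 3 = (0, vector [0, 0, 0, -1])"
  "model_normals c s a h 4 = (h, vector [0, 0, 1, h])"
  "model_normals c s a h 5 = (0, vector [0, 0, -1, 0])"
  by (simp_all add: model_normals_def)

lemma all_le_5: "(\<forall>i \<le> 5. P i) \<longleftrightarrow> P 0 \<and> P 1 \<and> P 2 \<and> P 3 \<and> P 4 \<and> P (5::nat)"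
proof -
  have "(\<forall>i \<le> 5. P i) \<longleftrightarrow> (\<forall>i \<in> {..5}. P i)" by blast
  also have "{..5} = {0, 1, 2, 3, 4, 5::nat}" by (simp add: set_eq_iff) arith
  finally show ?thesis by simp
qed

lemma all_1_to_4: "(\<forall>i \<in> {1..4}. P i) \<longleftrightarrow> P 1 \<and> P 2 \<and> P 3 \<and> P (4::nat)"
proof -
  have "{1..4} = {1, 2, 3, 4::nat}" by (simp add: set_eq_iff) arith
  then show ?thesis by simp
qed

lemma all_distant_pairs: "(\<forall>i j. i + 2 \<le> j \<and> j \<le> 5 \<longrightarrow> P i j) \<longleftrightarrow>
   P 0 2 \<and> P 0 3 \<and> P 0 4 \<and> P 0 (5::nat) \<and> P 1 3 \<and> P 1 4 \<and> P 1 5 \<and> P 2 4 \<and> P 2 5 \<and> P 3 (5::nat)"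
proof -
  define S where "S = {(0,2),(0,3),(0,4),(0,5),(1,3),(1,4),(1,5),(2,4),(2,5),(3::nat,5::nat)}"
  have "i + 2 \<le> j \<and> j \<le> 5 \<longleftrightarrow> (i, j) \<in> S" for i j :: nat
    unfolding S_def by (simp only: insert_iff prod.inject empty_iff) arith
  then have "(\<forall>i j. i + 2 \<le> j \<and> j \<le> 5 \<longrightarrow> P i j) \<longleftrightarrow> (\<forall>(i, j) \<in> S. P i j)" by blast
  then show ?thesis by (simp add: S_def)
qed

lemma normals_4:
  fixes b :: "nat \<Rightarrow> real \<times> (real ^ 4)"
  shows "normals [m1, m2, m3, m4] b \<longleftrightarrow>
    (\<forall>i \<le> 5. lorentz (b i) (b i) = 1) \<and>
    lorentz (b 0) (b 1) = - cos (pi / m1) \<and> lorentz (b 1) (b 2) = - cos (pi / m2) \<and>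
    lorentz (b 2) (b 3) = - cos (pi / m3) \<and> lorentz (b 3) (b 4) = - cos (pi / m4) \<and>
    lorentz (b 4) (b 5) = - 1 \<and>
    lorentz (b 0) (b 2) = 0 \<and> lorentz (b 0) (b 3) = 0 \<and> lorentz (b 0) (b 4) = 0 \<and> lorentz (b 0) (b 5) = 0 \<and>
    lorentz (b 1) (b 3) = 0 \<and> lorentz (b 1) (b 4) = 0 \<and> lorentz (b 1) (b 5) = 0 \<and>
    lorentz (b 2) (b 4) = 0 \<and> lorentz (b 2) (b 5) = 0 \<and> lorentz (b 3) (b 5) = 0 \<and>
    (\<exists>u \<in> ball 0 1. \<forall>i \<le> 5. lorentz (lift u) (b i) < 0)"
proof -
  have D: "DIM(real ^ 4) = 4" "(4::nat) + 1 = 5" by simp_all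
  show ?thesis
    unfolding normals_def D all_1_to_4 all_distant_pairs by simp
qed

text \<open>
  The Gram matrix is read off from the coordinates; the condition on \<open>m\<^sub>2\<close> says that the triangle at
  the ideal vertex is Euclidean, its angles being \<open>\<pi> / m\<^sub>1\<close>, \<open>\<pi> / m\<^sub>2\<close> and \<open>\<pi> / 2\<close>.
\<close>

lemma model_normals_are_normals:
  assumes pos: "cos (pi / m1) > 0" "sin (pi / m1) > 0" "cos (pi / m3) > 0" "cos (pi / m4) > 0"
    and m2: "sin (pi / m1) = cos (pi / m2)"
  shows "normals [m1, m2, m3, m4] (model_normals (cos (pi / m1)) (sin (pi / m1)) (cos (pi / m3)) (cos (pi / m4)))"
proof -
  define c where "c = cos (pi / m1)"
  define s where "s = sin (pi / m1)"
  define a where "a = cos (pi / m3)"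
  define h where "h = cos (pi / m4)"
  have cs: "c * c + s * s = 1" using sin_cos_squared_add3[of "pi / m1"] by (simp add: c_def s_def)
  have pos: "c > 0" "s > 0" "a > 0" "h > 0" using pos by (simp_all add: c_def s_def a_def h_def)
  let ?b = "model_normals c s a h"
  \<comment> \<open>An interior point: \<open>a / 2\<close>, \<open>q\<close>, \<open>h / 2\<close> are horizontal coordinates inside the prism, and the last
    coordinate is large enough to make \<open>y\<close> timelike.\<close>
  define q where "q = s / c * (a / 2) / 2"
  define y :: "real \<times> (real ^ 4)" where
    "y = (2 + (a / 2)\<^sup>2 + q\<^sup>2 + (h / 2)\<^sup>2, vector [a / 2, q, h / 2, 1 + (a / 2)\<^sup>2 + q\<^sup>2 + (h / 2)\<^sup>2])"
  have q: "q > 0" "c * q < s * (a / 2)" using pos by (simp_all add: q_def)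
  have yy: "lorentz y y < 0"
  proof -
    define z where "z = (a / 2)\<^sup>2 + q\<^sup>2 + (h / 2)\<^sup>2"
    have "z \<ge> 0" by (simp add: z_def)
    have "lorentz y y = z - (2 + z)\<^sup>2 + (1 + z)\<^sup>2"
      unfolding y_def z_def by (simp add: lorentz_coordinates power2_eq_square algebra_simps)
    also have "\<dots> = - 3 - z" by (simp add: power2_eq_square algebra_simps)
    finally show ?thesis using \<open>z \<ge> 0\<close> by simp
  qed
  have y0: "fst y > 0" by (simp add: y_def add_pos_nonneg)
  have yb: "lorentz y (?b i) < 0" if "i \<le> 5" for i
  proof -
    have "- 1 < q\<^sup>2 + ((a / 2)\<^sup>2 + (h / 2)\<^sup>2)"
      using zero_le_power2[of q] zero_le_power2[of "a / 2"] zero_le_power2[of "h / 2"] by linarith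
    then have "\<forall>i \<le> 5. lorentz y (?b i) < 0"
      using pos q by (simp add: all_le_5 lorentz_coordinates y_def algebra_simps add_pos_nonneg)
    then show ?thesis using that by blast
  qed
  have "\<exists>u \<in> ball 0 1. \<forall>i \<le> 5. lorentz (lift u) (?b i) < 0"
  proof (intro bexI[of _ "proj y"] allI impI)
    fix i :: nat assume "i \<le> 5"
    then show "lorentz (lift (proj y)) (?b i) < 0"
      using y0 yb[of i] by (simp add: lift_proj lorentz_bilinear mult_less_0_iff)
  qed (rule proj_in_ball[OF yy])
  then show ?thesis
    unfolding normals_4 c_def[symmetric] s_def[symmetric] a_def[symmetric] h_def[symmetric]
    using m2 cs by (simp add: all_le_5 lorentz_coordinates s_def[symmetric] algebra_simps)
qed

text \<open>
  The Gram matrix determines the normals up to a Lorentz map.  The normals \<open>b 0\<close>, \<open>b 1\<close>, \<open>b 3\<close>, \<open>b 4\<close>, \<open>b 5\<close>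
  yield an orthonormal frame, obtained by solving the model equations for the standard basis,
  and \<open>L\<close> maps the standard basis to this frame.  The products of the frame with all six normals are
  those of the model, which is all that is needed to describe the polytope.
\<close>

lemma frame_of_normals:
  fixes b :: "nat \<Rightarrow> real \<times> (real ^ 4)"
  assumes b: "normals [m1, m2, m3, m4] b"
    and nz: "sin (pi / m1) \<noteq> 0" "cos (pi / m4) \<noteq> 0" and m2: "sin (pi / m1) = cos (pi / m2)"
  obtains L :: "real \<times> (real ^ 4) \<Rightarrow> real \<times> (real ^ 4)"
  where "linear L" "\<And>x y. lorentz (L x) (L y) = lorentz x y" "surj L"
    "\<And>y i. i \<le> 5 \<Longrightarrow> lorentz (L y) (b i) =
       lorentz y (model_normals (cos (pi / m1)) (sin (pi / m1)) (cos (pi / m3)) (cos (pi / m4)) i)"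
proof -
  define c where "c = cos (pi / m1)"
  define s where "s = sin (pi / m1)"
  define a where "a = cos (pi / m3)"
  define h where "h = cos (pi / m4)"
  have cs: "c * c + s * s = 1" using sin_cos_squared_add3[of "pi / m1"] by (simp add: c_def s_def)
  have nz: "s \<noteq> 0" "h \<noteq> 0" using nz by (simp_all add: s_def h_def)
  have G: "lorentz (b 0) (b 0) = 1" "lorentz (b 1) (b 1) = 1" "lorentz (b 2) (b 2) = 1"
    "lorentz (b 3) (b 3) = 1" "lorentz (b 4) (b 4) = 1" "lorentz (b 5) (b 5) = 1"
    "lorentz (b 0) (b 1) = - c" "lorentz (b 1) (b 2) = - s"
    "lorentz (b 2) (b 3) = - a" "lorentz (b 3) (b 4) = - h" "lorentz (b 4) (b 5) = - 1"
    "lorentz (b 0) (b 2) = 0" "lorentz (b 0) (b 3) = 0" "lorentz (b 0) (b 4) = 0" "lorentz (b 0) (b 5) = 0"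
    "lorentz (b 1) (b 3) = 0" "lorentz (b 1) (b 4) = 0" "lorentz (b 1) (b 5) = 0"
    "lorentz (b 2) (b 4) = 0" "lorentz (b 2) (b 5) = 0" "lorentz (b 3) (b 5) = 0"
    using b m2 unfolding normals_4 all_le_5 c_def s_def a_def h_def by auto
  have G': "lorentz (b 1) (b 0) = - c" "lorentz (b 2) (b 1) = - s"
    "lorentz (b 3) (b 2) = - a" "lorentz (b 4) (b 3) = - h" "lorentz (b 5) (b 4) = - 1"
    "lorentz (b 2) (b 0) = 0" "lorentz (b 3) (b 0) = 0" "lorentz (b 4) (b 0) = 0" "lorentz (b 5) (b 0) = 0"
    "lorentz (b 3) (b 1) = 0" "lorentz (b 4) (b 1) = 0" "lorentz (b 5) (b 1) = 0"
    "lorentz (b 4) (b 2) = 0" "lorentz (b 5) (b 2) = 0" "lorentz (b 5) (b 3) = 0"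
    using G by (simp_all add: lorentz_commute)
  \<comment> \<open>The null vector of the ideal vertex is \<open>(b 4 + b 5) / h\<close>, and it equals \<open>e0 + e4\<close>.\<close>
  define e1 where "e1 = (- 1 / s) *\<^sub>R (b 1 + c *\<^sub>R b 0)"
  define e2 where "e2 = - b 0"
  define e3 where "e3 = - b 5"
  define e4 where "e4 = - b 3"
  define e0 where "e0 = (1 / h) *\<^sub>R (b 4 + b 5) + b 3"
  note e = e0_def e1_def e2_def e3_def e4_def
  have ss: "s * s = 1 - c * c" using cs by simp
  have E: "lorentz e0 e0 = - 1" "lorentz e1 e1 = 1" "lorentz e2 e2 = 1" "lorentz e3 e3 = 1" "lorentz e4 e4 = 1"
    "lorentz e0 e1 = 0" "lorentz e0 e2 = 0" "lorentz e0 e3 = 0" "lorentz e0 e4 = 0" "lorentz e1 e2 = 0"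
    "lorentz e1 e3 = 0" "lorentz e1 e4 = 0" "lorentz e2 e3 = 0" "lorentz e2 e4 = 0" "lorentz e3 e4 = 0"
    using nz ss by (simp_all add: e lorentz_bilinear G G' field_simps del: One_nat_def)
  have E': "lorentz e1 e0 = 0" "lorentz e2 e0 = 0" "lorentz e3 e0 = 0" "lorentz e4 e0 = 0" "lorentz e2 e1 = 0"
    "lorentz e3 e1 = 0" "lorentz e4 e1 = 0" "lorentz e3 e2 = 0" "lorentz e4 e2 = 0" "lorentz e4 e3 = 0"
    using E by (simp_all add: lorentz_commute)
  define L where "L y = fst y *\<^sub>R e0 + snd y $ 1 *\<^sub>R e1 + snd y $ 2 *\<^sub>R e2 + snd y $ 3 *\<^sub>R e3 + snd y $ 4 *\<^sub>R e4"
    for y :: "real \<times> (real ^ 4)"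
  have lin: "linear L"
    by (rule linearI) (simp_all add: L_def scaleR_add_left scaleR_add_right)
  have pres: "lorentz (L x) (L y) = lorentz x y" for x y
    by (simp add: L_def lorentz_bilinear E E' lorentz_coordinates[of x y])
  have "inj L"
  proof (rule linear_injective_0[OF lin, THEN iffD2], intro allI impI)
    fix x assume "L x = 0"
    then have "lorentz x (- fst x, snd x) = 0"
      by (metis lorentz_zero(1) pres)
    then have "(fst x)\<^sup>2 + (norm (snd x))\<^sup>2 = 0"
      by (simp add: lorentz_def dot_square_norm power2_eq_square[of "fst x"])
    then have "fst x = 0" "snd x = 0" by (simp_all add: add_nonneg_eq_0_iff)
    then show "x = 0" by (simp add: prod_eq_iff)
  qed
  then have "surj L" using linear_injective_imp_surjective[OF lin] by blast
  have bE: "lorentz e0 (b 0) = 0" "lorentz e0 (b 1) = 0" "lorentz e0 (b 2) = - a" "lorentz e0 (b 3) = 0"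
    "lorentz e0 (b 4) = - h" "lorentz e0 (b 5) = 0"
    "lorentz e1 (b 0) = 0" "lorentz e1 (b 1) = - s" "lorentz e1 (b 2) = 1" "lorentz e1 (b 3) = 0"
    "lorentz e1 (b 4) = 0" "lorentz e1 (b 5) = 0"
    "lorentz e2 (b 0) = - 1" "lorentz e2 (b 1) = c" "lorentz e2 (b 2) = 0" "lorentz e2 (b 3) = 0"
    "lorentz e2 (b 4) = 0" "lorentz e2 (b 5) = 0"
    "lorentz e3 (b 0) = 0" "lorentz e3 (b 1) = 0" "lorentz e3 (b 2) = 0" "lorentz e3 (b 3) = 0"
    "lorentz e3 (b 4) = 1" "lorentz e3 (b 5) = - 1"
    "lorentz e4 (b 0) = 0" "lorentz e4 (b 1) = 0" "lorentz e4 (b 2) = a" "lorentz e4 (b 3) = - 1"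
    "lorentz e4 (b 4) = h" "lorentz e4 (b 5) = 0"
    using nz ss by (simp_all add: e lorentz_bilinear G G' field_simps del: One_nat_def)
  have "\<forall>i \<le> 5. lorentz (L y) (b i) = lorentz y (model_normals c s a h i)" for y
    by (simp add: all_le_5 L_def lorentz_bilinear bE lorentz_coordinates[of y] algebra_simps
        del: One_nat_def)
  then show ?thesis
    using that[OF lin pres \<open>surj L\<close>] unfolding c_def s_def a_def h_def by blast
qed

section \<open>The volume of an orthoscheme as a single integral\<close>

text \<open>
  Passing from the time coordinate to the null coordinate \<open>x\<^sub>0 - x\<^sub>4\<close> is a shear.
\<close>

lemma emeasure_shear:
  fixes C :: "(real \<times> 'a::euclidean_space) set" and g :: "'a \<Rightarrow> real"
  assumes [measurable]: "C \<in> sets borel" "g \<in> borel_measurable borel"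
  shows "emeasure lborel {(s, x). (s + g x, x) \<in> C} = emeasure lborel C"
proof -
  define D where "D = {(s, x). (s + g x, x) \<in> C}"
  have "D = (\<lambda>p. (fst p + g (snd p), snd p)) -` C" by (auto simp: D_def)
  moreover have "(\<lambda>p::real \<times> 'a. (fst p + g (snd p), snd p)) \<in> borel_measurable (borel \<Otimes>\<^sub>M borel)"
    by (rule borel_measurable_Pair) measurable
  ultimately have D: "D \<in> sets borel"
    using measurable_sets_borel[of "\<lambda>p::real \<times> 'a. (fst p + g (snd p), snd p)" borel C]
    by (simp add: borel_prod)
  have sets_lb: "sets (lborel \<Otimes>\<^sub>M lborel) = sets (borel :: (real \<times> 'a) measure)"
    using lborel_prod sets_lborel by metis
  have trans: "emeasure lborel ((\<lambda>s. s + e) -` X) = emeasure lborel X" if "X \<in> sets borel" for X and e :: real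
  proof -
    have "emeasure lborel X = emeasure (distr lborel borel ((+) e)) X"
      by (simp add: lborel_distr_plus)
    also have "\<dots> = emeasure lborel ((+) e -` X)"
      using that by (subst emeasure_distr) auto
    also have "(+) e = (\<lambda>s. s + e)" by (simp add: fun_eq_iff)
    finally show ?thesis by simp
  qed
  have "emeasure lborel D = (\<integral>\<^sup>+x. emeasure lborel ((\<lambda>s. (s, x)) -` D) \<partial>lborel)"
    using D sets_lb by (simp add: lborel_prod[symmetric] lborel_pair.emeasure_pair_measure_alt2)
  also have "\<dots> = (\<integral>\<^sup>+x. emeasure lborel ((\<lambda>s. (s, x)) -` C) \<partial>lborel)"
  proof (rule nn_integral_cong)
    fix x :: 'a
    have "(\<lambda>s. (s, x)) -` C \<in> sets borel"
      using measurable_sets_borel[of "\<lambda>s::real. (s, x)" borel C] by simp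
    moreover have "(\<lambda>s. (s, x)) -` D = (\<lambda>s. s + g x) -` ((\<lambda>s. (s, x)) -` C)"
      by (auto simp: D_def)
    ultimately show "emeasure lborel ((\<lambda>s. (s, x)) -` D) = emeasure lborel ((\<lambda>s. (s, x)) -` C)"
      by (simp add: trans)
  qed
  also have "\<dots> = emeasure lborel C"
    using assms(1) sets_lb by (simp add: lborel_prod[symmetric] lborel_pair.emeasure_pair_measure_alt2)
  finally show ?thesis by (simp add: D_def)
qed

lemma nn_integral_lborel_pair:
  fixes f :: "'a::euclidean_space \<times> 'b::euclidean_space \<Rightarrow> ennreal"
  assumes "f \<in> borel_measurable borel"
  shows "(\<integral>\<^sup>+p. f p \<partial>lborel) = (\<integral>\<^sup>+x. \<integral>\<^sup>+y. f (x, y) \<partial>lborel \<partial>lborel)"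
proof -
  have "f \<in> borel_measurable (lborel \<Otimes>\<^sub>M lborel)"
    using assms by (simp add: lborel_prod)
  then show ?thesis by (simp add: lborel.nn_integral_fst lborel_prod)
qed

text \<open>
  The order of integration is the one used below: the third coordinate runs over the interval
  \<open>[0, h]\<close> and stays as the last variable, the first two run over the triangle, and the fourth is
  the unbounded direction towards the ideal vertex.
\<close>

lemma nn_integral_vec4:
  fixes g :: "real ^ 4 \<Rightarrow> ennreal"
  assumes g: "g \<in> borel_measurable borel"
  shows "(\<integral>\<^sup>+u. g u \<partial>lborel) =
    (\<integral>\<^sup>+w. \<integral>\<^sup>+x. \<integral>\<^sup>+y. \<integral>\<^sup>+z. g (vector [x, y, w, z]) \<partial>lborel \<partial>lborel \<partial>lborel \<partial>lborel)"
proof -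
  define T :: "real \<times> real \<times> real \<times> real \<Rightarrow> real ^ 4" where
    "T p = vector [fst (snd p), fst (snd (snd p)), fst p, snd (snd (snd p))]" for p
  have T: "linear T"
    by (rule linearI) (simp_all add: T_def vec_eq_iff forall_4)
  define R :: "real ^ 4 \<Rightarrow> real \<times> real \<times> real \<times> real" where
    "R v = (v $ 3, v $ 1, v $ 2, v $ 4)" for v
  have TR: "T (R v) = v" and RT: "R (T p) = p" for v p
    by (simp_all add: T_def R_def vec_eq_iff forall_4)
  have "R (axis i 1) \<in> Basis" for i
    using exhaust_4[of i] by (auto simp: R_def axis_def Basis_prod_def zero_prod_def)
  then have R: "R v \<in> Basis" if "v \<in> Basis" for v
    using that by (auto simp: Basis_vec_def)
  have ax: "T (1, 0) = axis 3 1" "T (0, 1, 0) = axis 1 1" "T (0, 0, 1, 0) = axis 2 1" "T (0, 0, 0, 1) = axis 4 1"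
    by (simp_all add: T_def vec_eq_iff forall_4 axis_def)
  then have "T p \<in> Basis" if "p \<in> Basis" for p
    using that by (auto simp: Basis_prod_def zero_prod_def Basis_vec_def)
  then have "bij_betw T Basis Basis"
    by (intro bij_betwI[where g = R]) (auto simp: R TR RT)
  then have dT: "distr lborel borel T = lborel" by (rule lborel_distr_basis_bijection[OF T])
  have Tm: "T \<in> borel_measurable borel" by (rule linear_borel_measurable[OF T])
  have gT: "(\<lambda>p. g (T p)) \<in> borel_measurable borel"
    using measurable_compose[OF Tm g] .
  have pm: "(\<lambda>y. f (x, y)) \<in> borel_measurable borel" if "f \<in> borel_measurable borel"
    for f :: "'a::euclidean_space \<times> 'b::euclidean_space \<Rightarrow> ennreal" and x
    using that by (rule measurable_compose[rotated])
      (intro borel_measurable_continuous_onI continuous_intros)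
  have "(\<integral>\<^sup>+u. g u \<partial>lborel) = (\<integral>\<^sup>+u. g u \<partial>distr lborel borel T)" by (simp add: dT)
  also have "\<dots> = (\<integral>\<^sup>+p. g (T p) \<partial>lborel)"
    using Tm g by (subst nn_integral_distr) auto
  also have "\<dots> = (\<integral>\<^sup>+w. \<integral>\<^sup>+p. g (T (w, p)) \<partial>lborel \<partial>lborel)"
    by (rule nn_integral_lborel_pair[OF gT])
  also have "\<dots> = (\<integral>\<^sup>+w. \<integral>\<^sup>+x. \<integral>\<^sup>+p. g (T (w, x, p)) \<partial>lborel \<partial>lborel \<partial>lborel)"
    by (rule nn_integral_cong, rule nn_integral_lborel_pair[OF pm[OF gT]])
  also have "\<dots> = (\<integral>\<^sup>+w. \<integral>\<^sup>+x. \<integral>\<^sup>+y. \<integral>\<^sup>+z. g (T (w, x, y, z)) \<partial>lborel \<partial>lborel \<partial>lborel \<partial>lborel)"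
    by (rule nn_integral_cong, rule nn_integral_cong, rule nn_integral_lborel_pair[OF pm[OF pm[OF gT]]])
  finally show ?thesis by (simp add: T_def)
qed

text \<open>
  The integral of \<open>(1 - w\<^sup>2 - x\<^sup>2 - y\<^sup>2) powr (- 3 / 2)\<close> over the right triangle
  \<open>0 \<le> x \<le> a\<close>, \<open>0 \<le> y \<le> t x\<close>, where \<open>\<kappa> = a\<^sup>2 (1 + t\<^sup>2)\<close> is the square of its hypotenuse.
\<close>

definition slice_density :: "real \<Rightarrow> real \<Rightarrow> real \<Rightarrow> real" where
  "slice_density t \<kappa> w =
     (arctan (t * sqrt (1 - w\<^sup>2) / sqrt (1 - w\<^sup>2 - \<kappa>)) - arctan t) / sqrt (1 - w\<^sup>2)"

text \<open>
  The following lemmas carry out the integrations along the ray to the ideal vertex, along the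
  leg of length \<open>t x\<close>, and along the leg of length \<open>a\<close>.
\<close>

lemma nn_integral_height:
  fixes q :: real
  assumes q: "q > 0"
  shows "(\<integral>\<^sup>+z. ennreal ((q + 2 * z) powr (- 5 / 2)) * indicator {0..} z \<partial>lborel) = ennreal (q powr (- 3 / 2) / 3)"
proof -
  have "(\<integral>\<^sup>+z. ennreal ((q + 2 * z) powr (- 5 / 2)) * indicator {0..} z \<partial>lborel)
      = ennreal (0 - (- ((q + 2 * 0) powr (- 3 / 2)) / 3))"
  proof (rule nn_integral_FTC_atLeast)
    fix z :: real assume z: "0 \<le> z"
    have "((\<lambda>z. - ((q + 2 * z) powr (- 3 / 2)) / 3) has_real_derivative
        - ((- 3 / 2) * (q + 2 * z) powr (- 3 / 2 - 1) * 2) / 3) (at z)"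
      using q z by (auto intro!: derivative_eq_intros)
    then show "((\<lambda>z. - ((q + 2 * z) powr (- 3 / 2)) / 3) has_real_derivative (q + 2 * z) powr (- 5 / 2)) (at z)"
      by simp
  next
    have "((\<lambda>z. (q + 2 * z) powr (- 3 / 2)) \<longlongrightarrow> 0) at_top"
      by (rule tendsto_neg_powr)
         (auto intro!: filterlim_tendsto_add_at_top[OF tendsto_const]
            filterlim_tendsto_pos_mult_at_top[OF tendsto_const] filterlim_ident)
    then show "((\<lambda>z. - ((q + 2 * z) powr (- 3 / 2)) / 3) \<longlongrightarrow> 0) at_top"
      using tendsto_mult_right_zero[of _ _ "- 1 / 3"] tendsto_mult[OF tendsto_const[of "- 1 / 3"], of _ 0 at_top] by fastforce
  qed auto
  then show ?thesis by simp
qed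

lemma nn_integral_width:
  fixes B l :: real
  assumes l: "0 \<le> l" "l\<^sup>2 < B"
  shows "(\<integral>\<^sup>+y. ennreal ((B - y\<^sup>2) powr (- 3 / 2) / 3) * indicator {0..l} y \<partial>lborel)
    = ennreal (l / (B * sqrt (B - l\<^sup>2)) / 3)"
proof -
  have B: "B > 0" using l(2) zero_le_power2[of l] by linarith
  have pos: "B - y\<^sup>2 > 0" if "y \<in> {0..l}" for y
    using power_mono[of y l 2] that l(2) by (simp del: power_mono_iff)
  have "(\<integral>\<^sup>+y. ennreal ((B - y\<^sup>2) powr (- 3 / 2) / 3) * indicator {0..l} y \<partial>lborel)
    = ennreal (l * (B - l\<^sup>2) powr (- 1 / 2) / (3 * B) - 0 * (B - 0\<^sup>2) powr (- 1 / 2) / (3 * B))"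
  proof (rule nn_integral_FTC_Icc[where F = "\<lambda>y. y * (B - y\<^sup>2) powr (- 1 / 2) / (3 * B)"])
    fix y assume y: "y \<in> {0..l}"
    define d where "d = B - y\<^sup>2"
    have d: "d > 0" using pos[OF y] by (simp add: d_def)
    have "((\<lambda>y. y * (B - y\<^sup>2) powr (- 1 / 2)) has_real_derivative
        d powr (- 1 / 2) + y * ((- 1 / 2) * d powr (- 1 / 2 - 1) * (- (2 * y)))) (at y)"
      using d unfolding d_def by (auto intro!: derivative_eq_intros)
    then have "((\<lambda>y. y * (B - y\<^sup>2) powr (- 1 / 2) / (3 * B)) has_real_derivative
        (d powr (- 1 / 2) + y * ((- 1 / 2) * d powr (- 1 / 2 - 1) * (- (2 * y)))) / (3 * B)) (at y)"
      by (rule DERIV_cdivide)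
    moreover have "d powr (- 1 / 2) = d * d powr (- 3 / 2)"
      using d powr_mult_base[of d "- 3 / 2"] by simp
    then have "(d powr (- 1 / 2) + y * ((- 1 / 2) * d powr (- 1 / 2 - 1) * (- (2 * y)))) / (3 * B)
        = (d + y\<^sup>2) * d powr (- 3 / 2) / (3 * B)"
      by (simp add: power2_eq_square algebra_simps)
    moreover have "\<dots> = d powr (- 3 / 2) / 3" using B by (simp add: d_def)
    ultimately show "((\<lambda>y. y * (B - y\<^sup>2) powr (- 1 / 2) / (3 * B)) has_real_derivative
        (B - y\<^sup>2) powr (- 3 / 2) / 3) (at y)"
      by (simp only: d_def)
  qed (use l in auto)
  moreover have "(B - l\<^sup>2) powr (- 1 / 2) = 1 / sqrt (B - l\<^sup>2)"
    using l by (simp add: powr_minus powr_half_sqrt inverse_eq_divide)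
  ultimately show ?thesis by (simp add: field_simps)
qed

lemma nn_integral_triangle:
  fixes A t a :: real
  assumes t: "0 < t" and a: "0 \<le> a" "a\<^sup>2 * (1 + t\<^sup>2) < A"
  shows "(\<integral>\<^sup>+x. ennreal (t * x / ((A - x\<^sup>2) * sqrt (A - x\<^sup>2 - (t * x)\<^sup>2)) / 3) * indicator {0..a} x \<partial>lborel)
    = ennreal ((arctan (t * sqrt A / sqrt (A - a\<^sup>2 * (1 + t\<^sup>2))) - arctan t) / sqrt A / 3)"
proof -
  have A: "A > 0" using a(2) zero_le_power2[of a] zero_le_power2[of t]
    by (smt (verit) mult_nonneg_nonneg)
  have pos: "x\<^sup>2 * (1 + t\<^sup>2) < A" if "x \<in> {0..a}" for x
  proof -
    have "x\<^sup>2 * (1 + t\<^sup>2) \<le> a\<^sup>2 * (1 + t\<^sup>2)" using that by (intro mult_right_mono power_mono) auto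
    then show ?thesis using a(2) by linarith
  qed
  define F where "F x = arctan (t * sqrt A / sqrt (A - x\<^sup>2 * (1 + t\<^sup>2))) / sqrt A / 3" for x
  have "(\<integral>\<^sup>+x. ennreal (t * x / ((A - x\<^sup>2) * sqrt (A - x\<^sup>2 - (t * x)\<^sup>2)) / 3) * indicator {0..a} x \<partial>lborel)
    = ennreal (F a - F 0)"
  proof (rule nn_integral_FTC_Icc[where F = F])
    fix x assume x: "x \<in> {0..a}"
    define R where "R = sqrt (A - x\<^sup>2 * (1 + t\<^sup>2))"
    have R: "R > 0" using pos[OF x] by (simp add: R_def)
    have R2: "R\<^sup>2 = A - x\<^sup>2 * (1 + t\<^sup>2)" using pos[OF x] by (simp add: R_def)
    have Ax: "A - x\<^sup>2 > 0" using pos[OF x] by (simp add: algebra_simps) (smt (verit) mult_nonneg_nonneg zero_le_power2)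
    have Req: "sqrt (A - x\<^sup>2 - (t * x)\<^sup>2) = R"
      by (simp add: R_def power_mult_distrib algebra_simps)
    define r where "r = sqrt A"
    have r: "r > 0" "r\<^sup>2 = A" using A by (simp_all add: r_def)
    have dR: "((\<lambda>x. sqrt (A - x\<^sup>2 * (1 + t\<^sup>2))) has_real_derivative - (x * (1 + t\<^sup>2)) / R) (at x)"
      using pos[OF x] R unfolding R_def by (auto intro!: derivative_eq_intros simp: field_simps)
    have "((\<lambda>x. t * r / sqrt (A - x\<^sup>2 * (1 + t\<^sup>2))) has_real_derivative
        (0 * R - t * r * (- (x * (1 + t\<^sup>2)) / R)) / (R * R)) (at x)"
      using DERIV_divide[OF DERIV_const[of "t * r"] dR] R unfolding R_def by simp
    then have "((\<lambda>x. t * r / sqrt (A - x\<^sup>2 * (1 + t\<^sup>2))) has_real_derivative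
        - (t * r * (- (x * (1 + t\<^sup>2)) / R)) / (R * R)) (at x)"
      by simp
    from DERIV_chain2[OF DERIV_arctan this]
    have "(F has_real_derivative
        (inverse (1 + (t * r / R)\<^sup>2) * (- (t * r * (- (x * (1 + t\<^sup>2)) / R)) / (R * R))) / r / 3) (at x)"
      unfolding F_def r_def[symmetric] R_def[symmetric] by (intro DERIV_cdivide)
    moreover have "(inverse (1 + (t * r / R)\<^sup>2) * (- (t * r * (- (x * (1 + t\<^sup>2)) / R)) / (R * R))) / r / 3
        = t * x / ((A - x\<^sup>2) * R) / 3"
    proof -
      have "1 + (t * r / R)\<^sup>2 = (1 + t\<^sup>2) * (A - x\<^sup>2) / R\<^sup>2"
        using R by (simp add: power_divide power_mult_distrib r(2) field_simps) (simp add: R2 algebra_simps)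
      then have "inverse (1 + (t * r / R)\<^sup>2) = R\<^sup>2 / ((1 + t\<^sup>2) * (A - x\<^sup>2))"
        by simp
      moreover have "1 + t\<^sup>2 \<noteq> 0" by (smt (verit) zero_le_power2)
      moreover have "R\<^sup>2 / (N * D) * (- (t * r * (- (x * N) / R)) / (R * R)) / r / 3 = t * x / (D * R) / 3"
        if "N \<noteq> 0" "D \<noteq> 0" for N D
        using R r(1) that by (simp add: power2_eq_square[of R])
      ultimately show ?thesis
        using Ax by simp
    qed
    ultimately show "(F has_real_derivative t * x / ((A - x\<^sup>2) * sqrt (A - x\<^sup>2 - (t * x)\<^sup>2)) / 3) (at x)"
      by (simp add: Req)
    show "0 \<le> t * x / ((A - x\<^sup>2) * sqrt (A - x\<^sup>2 - (t * x)\<^sup>2)) / 3"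
      using x t R Ax by (simp add: Req)
  qed (use a in auto)
  moreover have "F 0 = arctan t / sqrt A / 3" using A by (simp add: F_def)
  ultimately show ?thesis by (simp add: F_def diff_divide_distrib)
qed


lemma sets_polyhedral_cone:
  fixes e :: "nat \<Rightarrow> real \<times> 'a::euclidean_space"
  shows "{x. lorentz x x < 0 \<and> - 1 \<le> lorentz x x \<and> (\<forall>i \<le> n. lorentz x (e i) \<le> 0)} \<in> sets borel"
proof -
  have "{x. lorentz x x < 0 \<and> - 1 \<le> lorentz x x \<and> (\<forall>i \<le> n. lorentz x (e i) \<le> 0)} =
      {x. lorentz x x < 0} \<inter> {x. - 1 \<le> lorentz x x} \<inter> (\<Inter>i\<in>{..n}. {x. lorentz x (e i) \<le> 0})"
    by auto
  also have "\<dots> \<in> sets borel"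
    by (intro sets.Int borel_open[OF open_Collect_less] borel_closed[OF closed_Collect_le]
        borel_closed[OF closed_INT] ballI closed_Collect_le continuous_intros)
  finally show ?thesis .
qed

text \<open>
  The cone over the polytope is transported to the model, sheared, and measured in the chart where the
  null coordinate is \<open>1\<close>.  There \<open>- \<langle>x, x\<rangle>\<close> is \<open>1 + 2 z - x\<^sup>2 - y\<^sup>2 - w\<^sup>2\<close>, and the polytope is the
  product of the prism with the half-line \<open>z \<ge> 0\<close>.  The inequality between \<open>a\<close>, \<open>t\<close> and \<open>h\<close> says that
  the base of the prism lies in the closed unit ball; equality occurs when the farthest corner is a
  second ideal vertex.
\<close>

lemma emeasure_truncated_orthoscheme:
  fixes b :: "nat \<Rightarrow> real \<times> (real ^ 4)"
  assumes b: "normals [m1, m2, m3, m4] b"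
    and pos: "cos (pi / m1) > 0" "sin (pi / m1) > 0" "cos (pi / m3) > 0" "cos (pi / m4) > 0"
    and m2: "sin (pi / m1) = cos (pi / m2)"
    and t: "t = tan (pi / m1)" and a: "a = cos (pi / m3)" and h: "h = cos (pi / m4)"
    and le: "a\<^sup>2 * (1 + t\<^sup>2) + h\<^sup>2 \<le> 1"
  shows "emeasure hyp_measure (truncated_orthoscheme b)
    = (\<integral>\<^sup>+w. ennreal (slice_density t (a\<^sup>2 * (1 + t\<^sup>2)) w / 3) * indicator {0..<h} w \<partial>lborel)"
proof -
  define c where "c = cos (pi / m1)"
  define s where "s = sin (pi / m1)"
  have pos: "c > 0" "s > 0" "a > 0" "h > 0" using pos by (simp_all add: c_def s_def a h)
  have t': "t = s / c" "t > 0" using pos by (simp_all add: t tan_def c_def s_def)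
  define \<kappa> where "\<kappa> = a\<^sup>2 * (1 + t\<^sup>2)"
  obtain L where L: "linear L" "\<And>x y. lorentz (L x) (L y) = lorentz x y"
    "\<And>y i. i \<le> 5 \<Longrightarrow> lorentz (L y) (b i) = lorentz y (model_normals c s a h i)"
    using frame_of_normals[OF b] pos m2 unfolding c_def s_def a h by (metis less_irrefl)
  define M where "M = {y. lorentz y y < 0 \<and> - 1 \<le> lorentz y y \<and> (\<forall>i \<le> 5. lorentz y (model_normals c s a h i) \<le> 0)}"
  define K where "K = cone_over (truncated_orthoscheme b)"
  have K: "K = {x. lorentz x x < 0 \<and> - 1 \<le> lorentz x x \<and> (\<forall>i \<le> 5. lorentz x (b i) \<le> 0)}"
    using cone_over_truncated_orthoscheme[OF b] by (simp add: K_def)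
  have Kb: "K \<in> sets borel" and Mb: "M \<in> sets borel"
    unfolding K M_def by (rule sets_polyhedral_cone)+
  have Tb: "truncated_orthoscheme b \<in> sets borel"
  proof -
    have "truncated_orthoscheme b = cball 0 1 \<inter> (\<Inter>i\<in>{..5}. {u. lorentz (lift u) (b i) \<le> 0})"
      by (auto simp: truncated_orthoscheme_def)
    also have "\<dots> \<in> sets borel"
      unfolding lift_def
      by (intro borel_closed closed_Int closed_cball closed_INT ballI closed_Collect_le continuous_intros)
    finally show ?thesis .
  qed
  have "L -` K = M"
    by (auto simp: K M_def L)
  then have "emeasure lborel K = emeasure lborel M"
    using emeasure_lorentz_vimage[OF L(1,2) Kb] by simp
  define S where "S = {u :: real ^ 4. 0 \<le> u $ 2 \<and> c * u $ 2 \<le> s * u $ 1 \<and> u $ 1 \<le> a \<and> 0 \<le> u $ 4 \<and> 0 \<le> u $ 3 \<and> u $ 3 \<le> h}"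
  define f where "f u = 1 + 2 * u $ 4 - ((u $ 1)\<^sup>2 + (u $ 2)\<^sup>2 + (u $ 3)\<^sup>2)" for u :: "real ^ 4"
  have fm: "f \<in> borel_measurable borel"
    unfolding f_def by (intro borel_measurable_continuous_onI continuous_intros)
  have Sm: "S \<in> sets borel"
  proof -
    have "closed S" unfolding S_def by (intro closed_Collect_conj closed_Collect_le continuous_intros)
    then show ?thesis by simp
  qed
  note [measurable] = fm Sm
  \<comment> \<open>Positivity of the null coordinate \<open>r\<close> follows from \<open>0 \<le> x $ 1 \<le> a r\<close>.\<close>
  have chart: "{(r, x). (r + x $ 4, x) \<in> M} =
      {(r, x). 0 < r \<and> x /\<^sub>R r \<in> S \<and> 0 < r\<^sup>2 * f (x /\<^sub>R r) \<and> r\<^sup>2 * f (x /\<^sub>R r) \<le> 1}"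
  proof -
    have "(r + x $ 4, x) \<in> M \<longleftrightarrow> 0 < r \<and> x /\<^sub>R r \<in> S \<and> 0 < r\<^sup>2 * f (x /\<^sub>R r) \<and> r\<^sup>2 * f (x /\<^sub>R r) \<le> 1" for r x
    proof -
      have M': "(r + x $ 4, x) \<in> M \<longleftrightarrow>
          0 < r\<^sup>2 + 2 * r * x $ 4 - ((x $ 1)\<^sup>2 + (x $ 2)\<^sup>2 + (x $ 3)\<^sup>2) \<and>
          r\<^sup>2 + 2 * r * x $ 4 - ((x $ 1)\<^sup>2 + (x $ 2)\<^sup>2 + (x $ 3)\<^sup>2) \<le> 1 \<and>
          0 \<le> x $ 2 \<and> c * x $ 2 \<le> s * x $ 1 \<and> x $ 1 \<le> a * r \<and> 0 \<le> x $ 4 \<and> x $ 3 \<le> h * r \<and> 0 \<le> x $ 3"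
      proof -
        have "lorentz (r + x $ 4, x) (r + x $ 4, x) = - (r\<^sup>2 + 2 * r * x $ 4 - ((x $ 1)\<^sup>2 + (x $ 2)\<^sup>2 + (x $ 3)\<^sup>2))"
          by (simp add: lorentz_coordinates power2_eq_square algebra_simps)
        moreover have "lorentz (r + x $ 4, x) (model_normals c s a h 0) = - x $ 2"
          "lorentz (r + x $ 4, x) (model_normals c s a h 1) = c * x $ 2 - s * x $ 1"
          "lorentz (r + x $ 4, x) (model_normals c s a h 2) = x $ 1 - a * r"
          "lorentz (r + x $ 4, x) (model_normals c s a h 3) = - x $ 4"
          "lorentz (r + x $ 4, x) (model_normals c s a h 4) = x $ 3 - h * r"
          "lorentz (r + x $ 4, x) (model_normals c s a h 5) = - x $ 3"
          by (simp_all add: lorentz_coordinates algebra_simps del: One_nat_def)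
        ultimately show ?thesis
          unfolding M_def mem_Collect_eq all_le_5 by (simp only:) linarith
      qed
      show ?thesis
      proof (cases "r > 0")
        case True
        have "r\<^sup>2 * f (x /\<^sub>R r) = r\<^sup>2 + 2 * r * x $ 4 - ((x $ 1)\<^sup>2 + (x $ 2)\<^sup>2 + (x $ 3)\<^sup>2)"
          using True by (simp add: f_def power2_eq_square field_simps)
        moreover have "x /\<^sub>R r \<in> S \<longleftrightarrow> 0 \<le> x $ 2 \<and> c * x $ 2 \<le> s * x $ 1 \<and> x $ 1 \<le> a * r \<and> 0 \<le> x $ 4 \<and> x $ 3 \<le> h * r \<and> 0 \<le> x $ 3"
          using True by (auto simp: S_def field_simps)
        ultimately show ?thesis using True M' by auto
      next
        case False
        have "(r + x $ 4, x) \<notin> M"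
        proof
          assume "(r + x $ 4, x) \<in> M"
          with M' have x: "0 < r\<^sup>2 + 2 * r * x $ 4 - ((x $ 1)\<^sup>2 + (x $ 2)\<^sup>2 + (x $ 3)\<^sup>2)"
            "0 \<le> x $ 2" "c * x $ 2 \<le> s * x $ 1" "x $ 1 \<le> a * r" by auto
          have "0 \<le> s * x $ 1" using x(2,3) pos by (smt (verit) mult_nonneg_nonneg)
          then have "0 \<le> x $ 1" using pos by (simp add: zero_le_mult_iff)
          then have "0 \<le> a * r" using x(4) by simp
          then have "r = 0" using False pos by (simp add: zero_le_mult_iff)
          then show False
            using x(1) zero_le_power2[of "x $ 1"] zero_le_power2[of "x $ 2"] zero_le_power2[of "x $ 3"] by simp
        qed
        then show ?thesis using False by simp
      qed
    qed
    then show ?thesis by blast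
  qed
  have "emeasure lborel M = emeasure lborel {(r, x). (r + x $ 4, x) \<in> M}"
    by (rule emeasure_shear[symmetric, OF Mb]) (intro borel_measurable_continuous_onI continuous_intros)
  also have "\<dots> = (\<integral>\<^sup>+u. indicator {u \<in> S. 0 < f u} u * ennreal (f u powr (- (real DIM(real ^ 4) + 1) / 2) / (real DIM(real ^ 4) + 1)) \<partial>lborel)"
    unfolding chart by (rule emeasure_cone_in_chart[OF fm Sm])
  finally have vM: "emeasure lborel M = (\<integral>\<^sup>+u. indicator {u \<in> S. 0 < f u} u * ennreal (f u powr (- 5 / 2) / 5) \<partial>lborel)"
    by simp
  have "emeasure hyp_measure (truncated_orthoscheme b) = ennreal 5 * emeasure lborel K"
    using emeasure_hyp_measure[OF Tb] by (simp add: K_def)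
  also have "\<dots> = ennreal 5 * (\<integral>\<^sup>+u. indicator {u \<in> S. 0 < f u} u * ennreal (f u powr (- 5 / 2) / 5) \<partial>lborel)"
    using vM \<open>emeasure lborel K = emeasure lborel M\<close> by simp
  also have "\<dots> = (\<integral>\<^sup>+u. ennreal 5 * (indicator {u \<in> S. 0 < f u} u * ennreal (f u powr (- 5 / 2) / 5)) \<partial>lborel)"
    by (rule nn_integral_cmult[symmetric]) measurable
  also have "\<dots> = (\<integral>\<^sup>+u. indicator {u \<in> S. 0 < f u} u * ennreal (f u powr (- 5 / 2)) \<partial>lborel)"
  proof (rule nn_integral_cong)
    fix u
    have "ennreal (f u powr (- 5 / 2)) = ennreal 5 * ennreal (f u powr (- 5 / 2) / 5)"
      by (subst ennreal_mult[symmetric]) auto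
    then show "ennreal 5 * (indicator {u \<in> S. 0 < f u} u * ennreal (f u powr (- 5 / 2) / 5)) =
        indicator {u \<in> S. 0 < f u} u * ennreal (f u powr (- 5 / 2))"
      by (simp add: mult_ac)
  qed
  also have "\<dots> = (\<integral>\<^sup>+w. \<integral>\<^sup>+x. \<integral>\<^sup>+y. \<integral>\<^sup>+z. indicator {u \<in> S. 0 < f u} (vector [x, y, w, z]) *
       ennreal (f (vector [x, y, w, z]) powr (- 5 / 2)) \<partial>lborel \<partial>lborel \<partial>lborel \<partial>lborel)"
    by (rule nn_integral_vec4) measurable
  also have "\<dots> = (\<integral>\<^sup>+w. ennreal (slice_density t \<kappa> w / 3) * indicator {0..<h} w \<partial>lborel)"
  proof (rule nn_integral_cong_AE)
    let ?G = "\<lambda>w x y z. indicator {u \<in> S. 0 < f u} (vector [x, y, w, z] :: real ^ 4) *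
       ennreal (f (vector [x, y, w, z]) powr (- 5 / 2))"
    have inS: "vector [x, y, w, z] \<in> S \<longleftrightarrow> w \<in> {0..h} \<and> x \<in> {0..a} \<and> y \<in> {0..t * x} \<and> z \<in> {0..}" for w x y z
    proof -
      have "c * y \<le> s * x \<longleftrightarrow> y \<le> t * x" using pos by (simp add: t' field_simps)
      moreover have "0 \<le> y \<and> y \<le> t * x \<Longrightarrow> 0 \<le> x"
        using t'(2) by (smt (verit) mult_pos_neg)
      ultimately show ?thesis by (auto simp: S_def)
    qed
    \<comment> \<open>At \<open>w = h\<close> the corner of the prism may lie on the unit sphere, where the integrand is singular.\<close>
    have main: "(\<integral>\<^sup>+x. \<integral>\<^sup>+y. \<integral>\<^sup>+z. ?G w x y z \<partial>lborel \<partial>lborel \<partial>lborel) =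
        ennreal (slice_density t \<kappa> w / 3) * indicator {0..<h} w" if wh: "w \<noteq> h" for w
    proof (cases "w \<in> {0..<h}")
      case False
      then have "vector [x, y, w, z] \<notin> S" for x y z using wh by (auto simp: inS)
      then show ?thesis using False by simp
    next
      case True
      define A where "A = 1 - w\<^sup>2"
      have "w\<^sup>2 < h\<^sup>2" using True by (intro power_strict_mono) auto
      then have A: "a\<^sup>2 * (1 + t\<^sup>2) < A" using le by (simp add: A_def)
      have 3: "(\<integral>\<^sup>+z. ?G w x y z \<partial>lborel) = ennreal ((A - x\<^sup>2 - y\<^sup>2) powr (- 3 / 2) / 3)"
        if x: "x \<in> {0..a}" and y: "y \<in> {0..t * x}" for x y
      proof -
        have "y\<^sup>2 \<le> (t * x)\<^sup>2" using y by (intro power_mono) auto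
        moreover have "x\<^sup>2 * (1 + t\<^sup>2) \<le> a\<^sup>2 * (1 + t\<^sup>2)"
          using x by (intro mult_right_mono power_mono) auto
        ultimately have q: "A - x\<^sup>2 - y\<^sup>2 > 0" using A by (simp add: power_mult_distrib algebra_simps)
        have "(\<integral>\<^sup>+z. ?G w x y z \<partial>lborel) = (\<integral>\<^sup>+z. ennreal ((A - x\<^sup>2 - y\<^sup>2 + 2 * z) powr (- 5 / 2)) * indicator {0..} z \<partial>lborel)"
        proof (rule nn_integral_cong)
          fix z
          have "f (vector [x, y, w, z]) = A - x\<^sup>2 - y\<^sup>2 + 2 * z" by (simp add: f_def A_def)
          then show "?G w x y z = ennreal ((A - x\<^sup>2 - y\<^sup>2 + 2 * z) powr (- 5 / 2)) * indicator {0..} z"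
            using q x y True by (cases "z \<ge> 0") (simp_all add: inS)
        qed
        then show ?thesis using nn_integral_height[OF q] by simp
      qed
      have 2: "(\<integral>\<^sup>+y. \<integral>\<^sup>+z. ?G w x y z \<partial>lborel \<partial>lborel) =
          ennreal (t * x / ((A - x\<^sup>2) * sqrt (A - x\<^sup>2 - (t * x)\<^sup>2)) / 3) * indicator {0..a} x" for x
      proof (cases "x \<in> {0..a}")
        case False
        then have "vector [x, y, w, z] \<notin> S" for y z by (auto simp: inS)
        then show ?thesis using False by simp
      next
        case x: True
        have "x\<^sup>2 * (1 + t\<^sup>2) \<le> a\<^sup>2 * (1 + t\<^sup>2)"
          using x by (intro mult_right_mono power_mono) auto
        then have l: "(t * x)\<^sup>2 < A - x\<^sup>2" using A by (simp add: power_mult_distrib algebra_simps)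
        have "(\<integral>\<^sup>+y. \<integral>\<^sup>+z. ?G w x y z \<partial>lborel \<partial>lborel) =
            (\<integral>\<^sup>+y. ennreal ((A - x\<^sup>2 - y\<^sup>2) powr (- 3 / 2) / 3) * indicator {0..t * x} y \<partial>lborel)"
        proof (rule nn_integral_cong)
          fix y
          show "(\<integral>\<^sup>+z. ?G w x y z \<partial>lborel) = ennreal ((A - x\<^sup>2 - y\<^sup>2) powr (- 3 / 2) / 3) * indicator {0..t * x} y"
          proof (cases "y \<in> {0..t * x}")
            case True
            then show ?thesis using 3[OF x] by simp
          next
            case False
            then have "vector [x, y, w, z] \<notin> S" for z by (auto simp: inS)
            then show ?thesis using False by simp
          qed
        qed
        also have "\<dots> = ennreal (t * x / ((A - x\<^sup>2) * sqrt (A - x\<^sup>2 - (t * x)\<^sup>2)) / 3)"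
          using l x t'(2) by (intro nn_integral_width) auto
        finally show ?thesis using x by simp
      qed
      have "(\<integral>\<^sup>+x. \<integral>\<^sup>+y. \<integral>\<^sup>+z. ?G w x y z \<partial>lborel \<partial>lborel \<partial>lborel) =
          ennreal ((arctan (t * sqrt A / sqrt (A - a\<^sup>2 * (1 + t\<^sup>2))) - arctan t) / sqrt A / 3)"
        unfolding 2 using t'(2) pos A by (intro nn_integral_triangle) auto
      then show ?thesis using True by (simp add: slice_density_def A_def \<kappa>_def)
    qed
    show "AE w in lborel. (\<integral>\<^sup>+x. \<integral>\<^sup>+y. \<integral>\<^sup>+z. ?G w x y z \<partial>lborel \<partial>lborel \<partial>lborel) =
        ennreal (slice_density t \<kappa> w / 3) * indicator {0..<h} w"
      using AE_lborel_singleton[of h] by eventually_elim (rule main)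
  qed
  finally show ?thesis by (simp only: \<kappa>_def)
qed

section \<open>Values and bounds of the volumes\<close>

lemma arctan_1: "arctan 1 = pi / 4"
  using arctan_unique[of "pi / 4" 1] tan_45 by simp

text \<open>
  Exchanging \<open>x\<close> and \<open>y\<close> does not change the integral, and since
  \<open>2 + x\<^sup>2 + y\<^sup>2 = (1 + x\<^sup>2) + (1 + y\<^sup>2)\<close> the two integrands add up to \<open>1 / ((1 + x\<^sup>2) (1 + y\<^sup>2))\<close>.
  The integral is therefore half of \<open>(\<pi> / 4)\<^sup>2\<close>.
\<close>

lemma symmetric_double_integral:
  "integral {0..1} (\<lambda>x. integral {0..1} (\<lambda>y. 1 / ((1 + x\<^sup>2) * (2 + x\<^sup>2 + y\<^sup>2)))) = pi\<^sup>2 / (32 :: real)"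
proof -
  have pos: "1 + x\<^sup>2 \<noteq> 0" "2 + x\<^sup>2 + y\<^sup>2 \<noteq> 0" for x y :: real
    using zero_le_power2[of x] zero_le_power2[of y] by linarith+
  let ?f = "\<lambda>x y :: real. 1 / ((1 + x\<^sup>2) * (2 + x\<^sup>2 + y\<^sup>2))"
  define I where "I = integral {0..1} (\<lambda>x. integral {0..1} (?f x))"
  have cont: "continuous_on (cbox (0, 0) (1, 1)) (\<lambda>(x, y). ?f x y)"
    unfolding case_prod_unfold by (intro continuous_intros ballI) (simp add: pos)
  have cont1: "continuous_on {0..1} (?f x)" "continuous_on {0..1} (\<lambda>y. ?f y x)"
    "continuous_on {0..1} (\<lambda>y. 1 / (1 + y\<^sup>2) :: real)" for x
    by (intro continuous_intros ballI; simp add: pos)+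
  have int1: "integral {0..1} (\<lambda>y. 1 / (1 + y\<^sup>2)) = pi / (4 :: real)"
  proof -
    have "((\<lambda>y. 1 / (1 + y\<^sup>2)) has_integral (arctan 1 - arctan 0)) {0..1::real}"
      by (intro fundamental_theorem_of_calculus)
         (auto intro!: derivative_eq_intros simp: has_real_derivative_iff_has_vector_derivative[symmetric] inverse_eq_divide)
    then show ?thesis by (simp add: arctan_1 integral_unique)
  qed
  have swap: "I = integral {0..1} (\<lambda>y. integral {0..1} (\<lambda>x. ?f x y))"
    using integral_swap_continuous[OF cont] by (simp add: I_def)
  have outer: "(\<lambda>x. integral {0..1} (?f x)) integrable_on {0..1}"
    "(\<lambda>x. integral {0..1} (\<lambda>y. ?f y x)) integrable_on {0..1}"
  proof -
    have "(\<lambda>x. integral (cbox 0 1) (?f x)) integrable_on (cbox 0 1)"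
      using integral_integrable_2dim[OF cont[unfolded case_prod_unfold]] by simp
    then show "(\<lambda>x. integral {0..1} (?f x)) integrable_on {0..1}" by simp
    have cont': "continuous_on (cbox (0, 0) (1, 1)) (\<lambda>p. ?f (snd p) (fst p))"
      by (intro continuous_intros ballI) (simp add: pos)
    have "(\<lambda>x. integral (cbox 0 1) (\<lambda>y. ?f y x)) integrable_on (cbox 0 1)"
      using integral_integrable_2dim[OF cont'] by simp
    then show "(\<lambda>x. integral {0..1} (\<lambda>y. ?f y x)) integrable_on {0..1}" by simp
  qed
  have "2 * I = integral {0..1} (\<lambda>x. integral {0..1} (?f x)) + integral {0..1} (\<lambda>x. integral {0..1} (\<lambda>y. ?f y x))"
    using swap by (simp add: I_def)
  also have "\<dots> = integral {0..1} (\<lambda>x. integral {0..1} (?f x) + integral {0..1} (\<lambda>y. ?f y x))"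
    using outer by (rule integral_add[symmetric])
  also have "\<dots> = integral {0..1} (\<lambda>x. integral {0..1} (\<lambda>y. ?f x y + ?f y x))"
    by (intro integral_cong integral_add[symmetric] integrable_continuous_real cont1)
  also have "\<dots> = integral {0..1} (\<lambda>x. integral {0..1} (\<lambda>y. 1 / (1 + x\<^sup>2) * (1 / (1 + y\<^sup>2))))"
  proof (intro integral_cong)
    fix x y :: real
    have "1 / (X * (X + Y)) + 1 / (Y * (X + Y)) = 1 / X * (1 / Y)" if "X > 0" "Y > 0" for X Y :: real
      using that by (simp add: divide_simps)
    from this[of "1 + x\<^sup>2" "1 + y\<^sup>2"]
    show "?f x y + ?f y x = 1 / (1 + x\<^sup>2) * (1 / (1 + y\<^sup>2))"
      by (simp add: add_pos_nonneg algebra_simps)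
  qed
  also have "\<dots> = (pi / 4)\<^sup>2"
    by (simp only: integral_mult_right int1 integral_mult_left) (simp add: power2_eq_square)
  finally show ?thesis by (simp add: I_def power2_eq_square)
qed

lemma arctan_as_integral:
  assumes c: "c > (0::real)"
  shows "((\<lambda>y. 1 / (c\<^sup>2 + y\<^sup>2)) has_integral (arctan (1 / c) / c)) {0..1}"
proof -
  have "((\<lambda>y. 1 / (c\<^sup>2 + y\<^sup>2)) has_integral (arctan (1 / c) / c - arctan (0 / c) / c)) {0..1}"
  proof (rule fundamental_theorem_of_calculus)
    fix y :: real
    have "((\<lambda>y. arctan (y / c) / c) has_real_derivative inverse (1 + (y / c)\<^sup>2) * (1 / c) / c) (at y within {0..1})"
      using c by (auto intro!: derivative_eq_intros)
    moreover have "inverse (1 + (y / c)\<^sup>2) * (1 / c) / c = 1 / (c\<^sup>2 + y\<^sup>2)"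
      using c by (simp add: divide_simps power2_eq_square)
    ultimately show "((\<lambda>y. arctan (y / c) / c) has_vector_derivative 1 / (c\<^sup>2 + y\<^sup>2)) (at y within {0..1})"
      by (simp add: has_real_derivative_iff_has_vector_derivative)
  qed auto
  then show ?thesis by simp
qed

text \<open>
  The inner integral of the symmetric double integral, evaluated.
\<close>

lemma Ahmed_integral:
  "((\<lambda>x. arctan (1 / sqrt (2 + x\<^sup>2)) / ((1 + x\<^sup>2) * sqrt (2 + x\<^sup>2))) has_integral pi\<^sup>2 / 32) {0..1::real}"
proof -
  let ?g = "\<lambda>x::real. arctan (1 / sqrt (2 + x\<^sup>2)) / ((1 + x\<^sup>2) * sqrt (2 + x\<^sup>2))"
  have pos: "1 + x\<^sup>2 > 0" "2 + x\<^sup>2 > 0" for x :: real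
    using zero_le_power2[of x] by linarith+
  have "integral {0..1} (\<lambda>y. 1 / ((1 + x\<^sup>2) * (2 + x\<^sup>2 + y\<^sup>2))) = ?g x" for x :: real
  proof -
    have "((\<lambda>y. 1 / (1 + x\<^sup>2) * (1 / ((sqrt (2 + x\<^sup>2))\<^sup>2 + y\<^sup>2))) has_integral
        1 / (1 + x\<^sup>2) * (arctan (1 / sqrt (2 + x\<^sup>2)) / sqrt (2 + x\<^sup>2))) {0..1}"
      by (intro has_integral_mult_right arctan_as_integral) (use pos in simp)
    then show ?thesis using pos[of x] by (simp add: integral_unique)
  qed
  then have "integral {0..1} ?g = pi\<^sup>2 / 32"
    using symmetric_double_integral by simp
  moreover have "?g integrable_on {0..1}"
  proof (rule integrable_continuous_real)
    show "continuous_on {0..1} ?g"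
      by (intro continuous_intros ballI) (use pos in \<open>auto simp: less_imp_neq[symmetric]\<close>)
  qed
  ultimately show ?thesis by (simp add: has_integral_iff)
qed


lemma has_integral_arcsin:
  assumes "0 \<le> l" "l \<le> u" "u < 1"
  shows "((\<lambda>w. 1 / sqrt (1 - w\<^sup>2)) has_integral (arcsin u - arcsin l)) {l..u}"
proof (rule fundamental_theorem_of_calculus)
  fix w assume "w \<in> {l..u}"
  then have "(arcsin has_real_derivative inverse (sqrt (1 - w\<^sup>2))) (at w)"
    using assms by (intro DERIV_arcsin) auto
  then show "(arcsin has_vector_derivative 1 / sqrt (1 - w\<^sup>2)) (at w within {l..u})"
    by (simp add: has_real_derivative_iff_has_vector_derivative[symmetric] inverse_eq_divide
        has_field_derivative_at_within)
qed (use assms in auto)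

lemma arcsin_cos: "0 \<le> x \<Longrightarrow> x \<le> pi \<Longrightarrow> arcsin (cos x) = pi / 2 - x"
  using arcsin_sin[of "pi / 2 - x"] by (simp add: cos_sin_eq)

text \<open>
  Mean value theorem; the derivative of the arctangent decreases on the positive half-line.
\<close>

lemma arctan_diff_ge:
  assumes "0 \<le> x" "x \<le> y"
  shows "(y - x) / (1 + y\<^sup>2) \<le> arctan y - arctan x"
proof (cases "x = y")
  case False
  then have "x < y" using assms by simp
  then obtain z where z: "x < z" "z < y" "arctan y - arctan x = (y - x) * inverse (1 + z\<^sup>2)"
    using MVT2[of x y arctan "\<lambda>z. inverse (1 + z\<^sup>2)"] DERIV_arctan by blast
  have "z\<^sup>2 \<le> y\<^sup>2" using z assms by (intro power_mono) auto
  then have "(y - x) / (1 + y\<^sup>2) \<le> (y - x) / (1 + z\<^sup>2)"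
    using \<open>x < y\<close> by (intro divide_left_mono) (auto simp: add_pos_nonneg)
  then show ?thesis using z by (simp add: divide_inverse)
qed simp

text \<open>
  For \<open>t = 1\<close> and \<open>\<kappa> = 1 / 2\<close> the complementary arctangent becomes Ahmed's integrand under
  \<open>w = x / sqrt (2 + 2 x\<^sup>2)\<close>, which maps \<open>[0, 1]\<close> onto \<open>[0, 1 / 2]\<close>.  The rest is
  \<open>\<pi> / 4 arcsin (1 / 2)\<close>.
\<close>

lemma has_integral_slice_density_square:
  "(slice_density 1 (1 / 2) has_integral pi\<^sup>2 / 96) {0..1 / 2}"
proof -
  define h where "h w = arctan (sqrt (1 - w\<^sup>2 - 1 / 2) / sqrt (1 - w\<^sup>2)) / sqrt (1 - w\<^sup>2)" for w :: real
  have A: "1 - w\<^sup>2 > 0" "1 - w\<^sup>2 - 1 / 2 > 0" if "w \<in> {0..1 / 2}" for w :: real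
  proof -
    have "w\<^sup>2 \<le> (1 / 2)\<^sup>2" using that by (intro power_mono) auto
    then show "1 - w\<^sup>2 > 0" "1 - w\<^sup>2 - 1 / 2 > 0" by (simp_all add: power2_eq_square)
  qed
  define g where "g x = x / sqrt (2 + 2 * x\<^sup>2)" for x :: real
  have pos: "1 + x\<^sup>2 > 0" "2 + x\<^sup>2 > 0" "2 + 2 * x\<^sup>2 > 0" for x :: real
    using zero_le_power2[of x] by linarith+
  have g2: "(g x)\<^sup>2 = x\<^sup>2 / (2 + 2 * x\<^sup>2)" for x
    using pos(3)[of x] by (simp add: g_def power_divide)
  have gint: "g x \<in> {0..1 / 2}" if "x \<in> {0..1}" for x
  proof -
    have "x\<^sup>2 \<le> 1" using that by (simp add: power_le_one)
    then have "(g x)\<^sup>2 \<le> (1 / 2)\<^sup>2"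
      unfolding g2 using pos(3)[of x] by (simp add: power2_eq_square[of "1 / 2"] divide_simps)
    then have "g x \<le> 1 / 2" using power2_le_imp_le[of "g x" "1 / 2"] by simp
    then show ?thesis using that pos by (simp add: g_def)
  qed
  have "((\<lambda>x. (1 / ((1 + x\<^sup>2) * sqrt (2 + 2 * x\<^sup>2))) *\<^sub>R h (g x)) has_integral integral {g 0..g 1} h) {0..1}"
  proof (rule has_integral_substitution[where g = g and f = h and c = 0 and d = "1 / 2" and
        g' = "\<lambda>x. 1 / ((1 + x\<^sup>2) * sqrt (2 + 2 * x\<^sup>2))"])
    show "continuous_on {0..1 / 2} h" unfolding h_def
      by (intro continuous_intros ballI) (use A in fastforce)+
    show "g ` {0..1} \<subseteq> {0..1 / 2}" using gint by auto
    fix x :: real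
    define R where "R = sqrt (2 + 2 * x\<^sup>2)"
    have R: "R > 0" "R * R = 2 + 2 * x\<^sup>2" using pos(3)[of x] by (auto simp: R_def)
    have "((\<lambda>x. sqrt (2 + 2 * x\<^sup>2)) has_real_derivative 2 * x / R) (at x within {0..1})"
      using pos(3)[of x] unfolding R_def by (auto intro!: derivative_eq_intros simp: field_simps)
    from DERIV_divide[OF DERIV_ident this]
    have "(g has_real_derivative (1 * R - x * (2 * x / R)) / (R * R)) (at x within {0..1})"
      using R unfolding g_def R_def[symmetric] by (simp add: R_def)
    moreover have "(1 * R - x * (2 * x / R)) / (R * R) = (R * R - 2 * x\<^sup>2) / (R * R * R)"
      using R(1) by (simp add: power2_eq_square field_simps)
    moreover have "\<dots> = 1 / ((1 + x\<^sup>2) * R)"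
      using R(1) pos[of x] unfolding R(2) by (simp add: divide_simps)
    ultimately show "(g has_real_derivative 1 / ((1 + x\<^sup>2) * sqrt (2 + 2 * x\<^sup>2))) (at x within {0..1})"
      by (simp only: R_def)
  qed (auto simp: g_def)
  moreover have "(1 / ((1 + x\<^sup>2) * sqrt (2 + 2 * x\<^sup>2))) *\<^sub>R h (g x)
      = arctan (1 / sqrt (2 + x\<^sup>2)) / ((1 + x\<^sup>2) * sqrt (2 + x\<^sup>2))" for x
  proof -
    define R where "R = sqrt (2 + 2 * x\<^sup>2)"
    have R: "R > 0" using pos(3)[of x] by (auto simp: R_def)
    define Q where "Q = sqrt (2 + x\<^sup>2)"
    have Q: "Q > 0" using pos(2)[of x] by (auto simp: Q_def)
    have "1 - (g x)\<^sup>2 = (2 + x\<^sup>2) / (2 + 2 * x\<^sup>2)" "1 - (g x)\<^sup>2 - 1 / 2 = 1 / (2 + 2 * x\<^sup>2)"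
      using pos(3)[of x] by (simp_all add: g2 field_simps)
    then have "sqrt (1 - (g x)\<^sup>2) = Q / R" "sqrt (1 - (g x)\<^sup>2 - 1 / 2) = 1 / R"
      by (simp_all add: real_sqrt_divide R_def Q_def)
    then have "h (g x) = arctan (1 / Q) / (Q / R)" using R by (simp add: h_def)
    moreover have "(1 / (P * R)) *\<^sub>R (k / (Q / R)) = k / (P * Q)" for P k :: real
      using R Q by simp
    ultimately show ?thesis unfolding R_def[symmetric] Q_def[symmetric] by (simp only:)
  qed
  ultimately have "((\<lambda>x. arctan (1 / sqrt (2 + x\<^sup>2)) / ((1 + x\<^sup>2) * sqrt (2 + x\<^sup>2))) has_integral integral {g 0..g 1} h) {0..1}"
    by simp
  then have "integral {g 0..g 1} h = pi\<^sup>2 / 32" using Ahmed_integral by (rule has_integral_unique)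
  moreover have "g 0 = 0" "g 1 = 1 / 2" by (simp_all add: g_def)
  ultimately have "integral {0..1 / 2} h = pi\<^sup>2 / 32" by simp
  moreover have "h integrable_on {0..1 / 2}" unfolding h_def
    by (intro integrable_continuous_real continuous_intros ballI) (use A in fastforce)+
  ultimately have "(h has_integral pi\<^sup>2 / 32) {0..1 / 2}" by (simp add: has_integral_iff)
  moreover have "((\<lambda>w. pi / 4 * (1 / sqrt (1 - w\<^sup>2))) has_integral pi / 4 * (arcsin (1 / 2) - arcsin 0)) {0..1 / 2}"
    by (intro has_integral_mult_right has_integral_arcsin) auto
  ultimately have "((\<lambda>w. pi / 4 * (1 / sqrt (1 - w\<^sup>2)) - h w) has_integral
      (pi / 4 * (arcsin (1 / 2) - arcsin 0) - pi\<^sup>2 / 32)) {0..1 / 2}"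
    by (intro has_integral_diff)
  moreover have "pi / 4 * (arcsin (1 / 2) - arcsin 0) - pi\<^sup>2 / 32 = pi\<^sup>2 / 96"
    using arcsin_cos[of "pi / 3"] by (simp add: cos_60 power2_eq_square)
  ultimately have "((\<lambda>w. pi / 4 * (1 / sqrt (1 - w\<^sup>2)) - h w) has_integral pi\<^sup>2 / 96) {0..1 / 2}"
    by simp
  then show ?thesis
  proof (rule has_integral_eq[rotated])
    fix w :: real assume w: "w \<in> {0..1 / 2}"
    define y where "y = sqrt (1 - w\<^sup>2 - 1 / 2) / sqrt (1 - w\<^sup>2)"
    have "y > 0" using A[OF w] by (simp add: y_def)
    then have "arctan (inverse y) = pi / 2 - arctan y" by (rule arctan_inverse)
    then have "arctan (sqrt (1 - w\<^sup>2) / sqrt (1 - w\<^sup>2 - 1 / 2)) = pi / 2 - arctan (sqrt (1 - w\<^sup>2 - 1 / 2) / sqrt (1 - w\<^sup>2))"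
      by (simp add: y_def)
    then show "pi / 4 * (1 / sqrt (1 - w\<^sup>2)) - h w = slice_density 1 (1 / 2) w"
      by (simp add: slice_density_def h_def arctan_1 diff_divide_distrib)
  qed
qed

text \<open>
  The argument of the arctangent increases with \<open>w\<close>, so on an interval it may be replaced by its
  value at the left end \<open>l\<close>; what remains integrates to an arcsine.
\<close>

lemma slice_density_ge:
  assumes t: "t > 0" and w: "0 \<le> l" "l \<le> w" "w\<^sup>2 + \<kappa> < 1" "0 \<le> \<kappa>"
  shows "(arctan (t * sqrt (1 - l\<^sup>2) / sqrt (1 - l\<^sup>2 - \<kappa>)) - arctan t) / sqrt (1 - w\<^sup>2) \<le> slice_density t \<kappa> w"
proof -
  have lw: "l\<^sup>2 \<le> w\<^sup>2" using w by (intro power_mono) auto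
  define A where "A = 1 - w\<^sup>2"
  define B where "B = 1 - l\<^sup>2"
  have AB: "0 < A - \<kappa>" "A \<le> B" "0 < A" using w lw by (auto simp: A_def B_def)
  have "B / (B - \<kappa>) \<le> A / (A - \<kappa>)"
    using AB mult_right_mono[OF AB(2) w(4)] by (simp add: divide_simps algebra_simps)
  then have "sqrt B / sqrt (B - \<kappa>) \<le> sqrt A / sqrt (A - \<kappa>)"
    by (simp flip: real_sqrt_divide)
  then have "t * sqrt B / sqrt (B - \<kappa>) \<le> t * sqrt A / sqrt (A - \<kappa>)"
    using t mult_left_mono[of _ _ t] by fastforce
  then have "arctan (t * sqrt B / sqrt (B - \<kappa>)) \<le> arctan (t * sqrt A / sqrt (A - \<kappa>))"
    by (rule arctan_monotone')
  then show ?thesis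
    using AB unfolding slice_density_def A_def[symmetric] B_def[symmetric]
    by (intro divide_right_mono) auto
qed

lemma slice_density_nonneg:
  assumes "t > 0" "0 \<le> w" "w\<^sup>2 + \<kappa> < 1" "0 \<le> \<kappa>"
  shows "0 \<le> slice_density t \<kappa> w"
proof -
  have "sqrt (1 - w\<^sup>2 - \<kappa>) \<le> sqrt (1 - w\<^sup>2)" "0 < sqrt (1 - w\<^sup>2 - \<kappa>)" using assms by auto
  then have "t * sqrt (1 - w\<^sup>2 - \<kappa>) \<le> t * sqrt (1 - w\<^sup>2)" "0 < sqrt (1 - w\<^sup>2 - \<kappa>)"
    using assms(1) by simp_all
  then have "t \<le> t * sqrt (1 - w\<^sup>2) / sqrt (1 - w\<^sup>2 - \<kappa>)" by (simp add: pos_le_divide_eq)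
  then have "arctan t \<le> arctan (t * sqrt (1 - w\<^sup>2) / sqrt (1 - w\<^sup>2 - \<kappa>))" by (rule arctan_monotone')
  moreover have "0 \<le> sqrt (1 - w\<^sup>2)" using assms by simp
  ultimately show ?thesis unfolding slice_density_def by (intro divide_nonneg_nonneg) simp_all
qed

text \<open>
  The half-open interval matters: where the corner of the prism is an ideal point, the slice density
  is singular at the right end.
\<close>

lemma nn_integral_slice_ge:
  fixes g s :: "real \<Rightarrow> real"
  assumes "(g has_integral I) {l..u}" "\<And>w. w \<in> {l..u} \<Longrightarrow> 0 \<le> g w"
    and le: "\<And>w. w \<in> {l..<u} \<Longrightarrow> g w \<le> s w"
  shows "ennreal (I / 3) \<le> (\<integral>\<^sup>+w. ennreal (s w / 3) * indicator {l..<u} w \<partial>lborel)"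
proof -
  have "((\<lambda>w. g w / 3) has_integral I / 3) {l..u}"
    using assms(1) by (rule has_integral_divide)
  then have "ennreal (I / 3) = (\<integral>\<^sup>+w. ennreal (g w / 3) * indicator {l..u} w \<partial>lborel)"
    by (rule nn_integral_has_integral_lebesgue'[symmetric, rotated]) (use assms(2) in auto)
  also have "\<dots> \<le> (\<integral>\<^sup>+w. ennreal (s w / 3) * indicator {l..<u} w \<partial>lborel)"
  proof (rule nn_integral_mono_AE)
    have "ennreal (g w / 3) * indicator {l..u} w \<le> ennreal (s w / 3) * indicator {l..<u} w" if "w \<noteq> u" for w
    proof (cases "w \<in> {l..<u}")
      case True
      then have "w \<in> {l..u}" by (simp add: less_imp_le)
      then show ?thesis using le[OF True] True by (simp add: ennreal_leI)
    next
      case False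
      then have "w \<notin> {l..u}" using that by auto
      then show ?thesis by simp
    qed
    then show "AE w in lborel. ennreal (g w / 3) * indicator {l..u} w \<le> ennreal (s w / 3) * indicator {l..<u} w"
      using AE_lborel_singleton[of u] by (auto elim!: eventually_mono)
  qed
  finally show ?thesis .
qed

lemma hyp_vol_orthoscheme_4433:
  fixes b :: "nat \<Rightarrow> real \<times> (real ^ 4)"
  assumes b: "normals [4, 4, 3, 3] b"
  shows "hyp_vol (truncated_orthoscheme b) = pi\<^sup>2 / 288"
proof -
  have v: "emeasure hyp_measure (truncated_orthoscheme b) =
      (\<integral>\<^sup>+w. ennreal (slice_density 1 ((1 / 2)\<^sup>2 * (1 + 1\<^sup>2)) w / 3) * indicator {0..<1 / 2} w \<partial>lborel)"
    by (rule emeasure_truncated_orthoscheme[OF b])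
       (simp_all add: cos_45 sin_45 cos_60 tan_45 power2_eq_square)
  also have "\<dots> = (\<integral>\<^sup>+w. ennreal (slice_density 1 (1 / 2) w / 3) * indicator {0..1 / 2} w \<partial>lborel)"
  proof (rule nn_integral_cong_AE)
    have "w \<noteq> 1 / 2 \<Longrightarrow> ennreal (slice_density 1 ((1 / 2)\<^sup>2 * (1 + 1\<^sup>2)) w / 3) * indicator {0..<1 / 2} w =
        ennreal (slice_density 1 (1 / 2) w / 3) * indicator {0..1 / 2} w" for w :: real
      by (auto simp: power2_eq_square[of "1 / 2"] split: split_indicator)
    then show "AE w in lborel. ennreal (slice_density 1 ((1 / 2)\<^sup>2 * (1 + 1\<^sup>2)) w / 3) * indicator {0..<1 / 2} w =
        ennreal (slice_density 1 (1 / 2) w / 3) * indicator {0..1 / 2} w"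
      using AE_lborel_singleton[of "1 / 2 :: real"] by (auto elim!: eventually_mono)
  qed
  also have "\<dots> = ennreal (pi\<^sup>2 / 96 / 3)"
  proof (rule nn_integral_has_integral_lebesgue')
    show "((\<lambda>w. slice_density 1 (1 / 2) w / 3) has_integral pi\<^sup>2 / 96 / 3) {0..1 / 2}"
      by (rule has_integral_divide[OF has_integral_slice_density_square])
    fix w :: real assume w: "w \<in> {0..1 / 2}"
    then have "w\<^sup>2 \<le> (1 / 2)\<^sup>2" by (intro power_mono) auto
    then have "w\<^sup>2 + 1 / 2 < 1" by (simp add: power2_eq_square)
    then show "0 \<le> slice_density 1 (1 / 2) w / 3"
      using w slice_density_nonneg[of 1 w "1 / 2"] by simp
  qed
  finally show ?thesis by (simp add: measure_def)
qed

text \<open>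
  The slice density is the one of \<open>{4,4,3,3,\<infinity>}\<close>, on the longer interval \<open>[0, sqrt 2 / 2]\<close>.  The part
  beyond \<open>1 / 2\<close> is estimated by the value of the arctangent at \<open>1 / 2\<close>.
\<close>

lemma emeasure_orthoscheme_4434_ge:
  fixes b :: "nat \<Rightarrow> real \<times> (real ^ 4)"
  assumes b: "normals [4, 4, 3, 4] b"
  shows "ennreal (5 * pi\<^sup>2 / 864) \<le> emeasure hyp_measure (truncated_orthoscheme b)"
proof -
  define h where "h = sqrt 2 / 2"
  have h: "1 / 2 < h" "h < 1" "h\<^sup>2 = 1 / 2" "h = cos (pi / 4)"
    by (simp_all add: h_def power_divide cos_45 real_less_rsqrt real_less_lsqrt power2_eq_square)
  have hw: "w\<^sup>2 + 1 / 2 < 1" if "0 \<le> w" "w < h" for w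
  proof -
    have "w\<^sup>2 < h\<^sup>2" using that by (intro power_strict_mono) auto
    then show ?thesis using h by simp
  qed
  let ?s = "slice_density 1 (1 / 2)"
  have "emeasure hyp_measure (truncated_orthoscheme b) =
      (\<integral>\<^sup>+w. ennreal (slice_density 1 ((1 / 2)\<^sup>2 * (1 + 1\<^sup>2)) w / 3) * indicator {0..<h} w \<partial>lborel)"
    by (rule emeasure_truncated_orthoscheme[OF b])
       (simp_all add: h_def cos_45 sin_45 cos_60 tan_45 power_divide)
  also have "(1 / 2)\<^sup>2 * (1 + 1\<^sup>2) = (1 / 2 :: real)" by (simp add: power2_eq_square)
  also have "(\<integral>\<^sup>+w. ennreal (?s w / 3) * indicator {0..<h} w \<partial>lborel) =
     (\<integral>\<^sup>+w. ennreal (?s w / 3) * indicator {0..<1 / 2} w + ennreal (?s w / 3) * indicator {1 / 2..<h} w \<partial>lborel)"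
    using h by (intro nn_integral_cong) (auto split: split_indicator)
  also have "\<dots> = (\<integral>\<^sup>+w. ennreal (?s w / 3) * indicator {0..<1 / 2} w \<partial>lborel) +
     (\<integral>\<^sup>+w. ennreal (?s w / 3) * indicator {1 / 2..<h} w \<partial>lborel)"
    unfolding slice_density_def by (rule nn_integral_add) measurable
  also have "\<dots> \<ge> ennreal (pi\<^sup>2 / 96 / 3) + ennreal (pi / 12 * (arcsin h - arcsin (1 / 2)) / 3)"
  proof (rule add_mono)
    show "ennreal (pi\<^sup>2 / 96 / 3) \<le> (\<integral>\<^sup>+w. ennreal (?s w / 3) * indicator {0..<1 / 2} w \<partial>lborel)"
    proof (rule nn_integral_slice_ge[OF has_integral_slice_density_square])
      fix w :: real assume "w \<in> {0..1 / 2}"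
      then show "0 \<le> ?s w" using h hw[of w] by (intro slice_density_nonneg) auto
    qed simp
    show "ennreal (pi / 12 * (arcsin h - arcsin (1 / 2)) / 3) \<le> (\<integral>\<^sup>+w. ennreal (?s w / 3) * indicator {1 / 2..<h} w \<partial>lborel)"
    proof (rule nn_integral_slice_ge)
      show "((\<lambda>w. pi / 12 * (1 / sqrt (1 - w\<^sup>2))) has_integral pi / 12 * (arcsin h - arcsin (1 / 2))) {1 / 2..h}"
        using h by (intro has_integral_mult_right has_integral_arcsin) auto
      fix w :: real assume w: "w \<in> {1 / 2..<h}"
      have "sqrt (1 - (1 / 2)\<^sup>2) / sqrt (1 - (1 / 2)\<^sup>2 - 1 / 2 :: real) = sqrt 3"
      proof -
        have "1 - (1 / 2)\<^sup>2 = (3 / 4 :: real)" "1 - (1 / 2)\<^sup>2 - 1 / 2 = (1 / 4 :: real)"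
          by (simp_all add: power2_eq_square)
        then have "sqrt (1 - (1 / 2)\<^sup>2) / sqrt (1 - (1 / 2)\<^sup>2 - 1 / 2 :: real) = sqrt (3 / 4) / sqrt (1 / 4)"
          by (simp only:)
        then show ?thesis by (simp add: real_sqrt_divide)
      qed
      moreover have "arctan (sqrt 3) = pi / 3"
        using arctan_unique[of "pi / 3" "sqrt 3"] by (simp add: tan_60)
      moreover have "(arctan (1 * sqrt (1 - (1 / 2)\<^sup>2) / sqrt (1 - (1 / 2)\<^sup>2 - 1 / 2)) - arctan 1) / sqrt (1 - w\<^sup>2) \<le> ?s w"
        using hw[of w] w by (intro slice_density_ge) auto
      ultimately have "(pi / 3 - pi / 4) / sqrt (1 - w\<^sup>2) \<le> ?s w"
        by (simp only: arctan_1 mult_1_left)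
      then show "pi / 12 * (1 / sqrt (1 - w\<^sup>2)) \<le> ?s w" by simp
    next
      fix w :: real assume w: "w \<in> {1 / 2..h}"
      then have "w\<^sup>2 \<le> h\<^sup>2" by (intro power_mono) auto
      then show "0 \<le> pi / 12 * (1 / sqrt (1 - w\<^sup>2))" using h by simp
    qed
  qed
  also have "ennreal (pi\<^sup>2 / 96 / 3) + ennreal (pi / 12 * (arcsin h - arcsin (1 / 2)) / 3) = ennreal (5 * pi\<^sup>2 / 864)"
  proof -
    have "arcsin h = pi / 4" "arcsin (1 / 2) = pi / 6"
      using arcsin_cos[of "pi / 4"] arcsin_cos[of "pi / 3"] by (simp_all add: h(4) cos_60)
    then have "ennreal (pi\<^sup>2 / 96 / 3) + ennreal (pi / 12 * (arcsin h - arcsin (1 / 2)) / 3) =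
        ennreal (pi\<^sup>2 / 96 / 3) + ennreal (pi / 12 * (pi / 4 - pi / 6) / 3)"
      by (simp only:)
    also have "\<dots> = ennreal (pi\<^sup>2 / 96 / 3 + pi / 12 * (pi / 4 - pi / 6) / 3)"
      by (rule ennreal_plus[symmetric]) simp_all
    also have "pi\<^sup>2 / 96 / 3 + pi / 12 * (pi / 4 - pi / 6) / 3 = 5 * pi\<^sup>2 / 864"
      by (simp add: power2_eq_square)
    finally show ?thesis .
  qed
  finally show ?thesis .
qed

text \<open>
  For \<open>{6,3,3,m\<^sub>4,\<infinity>}\<close> the arctangent at \<open>w = 0\<close> is \<open>arctan (1 / sqrt 2)\<close>, and the constant bounds its
  difference from \<open>arctan t\<close>, where \<open>t = 1 / sqrt 3\<close>.
\<close>

lemma hexagonal_slices_ge: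
  assumes hpos: "0 < h" and h: "h\<^sup>2 \<le> 2 / 3"
  shows "ennreal ((sqrt 2 / 2 - sqrt 3 / 3) / (3 / 2) * arcsin h / 3)
    \<le> (\<integral>\<^sup>+w. ennreal (slice_density (sqrt 3 / 3) (1 / 3) w / 3) * indicator {0..<h} w \<partial>lborel)"
proof -
  have h1: "h < 1"
    using h power2_less_imp_less[of h 1] by simp
  let ?t = "sqrt 3 / 3 :: real"
  have hw: "w\<^sup>2 + 1 / 3 < 1" if "0 \<le> w" "w < h" for w
  proof -
    have "w\<^sup>2 < h\<^sup>2" using that by (intro power_strict_mono) auto
    then show ?thesis using h by simp
  qed
  have "ennreal ((sqrt 2 / 2 - sqrt 3 / 3) / (3 / 2) * (arcsin h - arcsin 0) / 3)
    \<le> (\<integral>\<^sup>+w. ennreal (slice_density ?t (1 / 3) w / 3) * indicator {0..<h} w \<partial>lborel)"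
  proof (rule nn_integral_slice_ge)
    let ?c = "(sqrt 2 / 2 - sqrt 3 / 3) / (3 / 2) :: real"
    have st: "sqrt 3 / 3 \<le> sqrt 2 / (2::real)"
    proof (rule power2_le_imp_le)
      show "(sqrt 3 / 3)\<^sup>2 \<le> (sqrt 2 / (2::real))\<^sup>2" by (simp add: power_divide)
    qed simp
    then have c: "0 \<le> ?c" by simp
    show "((\<lambda>w. ?c * (1 / sqrt (1 - w\<^sup>2))) has_integral ?c * (arcsin h - arcsin 0)) {0..h}"
      using hpos h1 by (intro has_integral_mult_right has_integral_arcsin) auto
    fix w :: real
    {
      assume w: "w \<in> {0..<h}"
      have "?t * sqrt (1 - 0\<^sup>2) / sqrt (1 - 0\<^sup>2 - 1 / 3) = sqrt 2 / 2"
      proof -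
        have "?t = sqrt (1 / 3)" "sqrt 2 / 2 = sqrt (1 / 2)"
          by (simp_all add: real_sqrt_divide field_simps)
        moreover have "sqrt (1 / 3) / sqrt (2 / 3) = sqrt (1 / 2)" by (simp flip: real_sqrt_divide)
        ultimately show ?thesis by simp
      qed
      moreover have "(arctan (?t * sqrt (1 - 0\<^sup>2) / sqrt (1 - 0\<^sup>2 - 1 / 3)) - arctan ?t) / sqrt (1 - w\<^sup>2)
          \<le> slice_density ?t (1 / 3) w"
        using hw[of w] w by (intro slice_density_ge) auto
      ultimately have "(arctan (sqrt 2 / 2) - arctan ?t) / sqrt (1 - w\<^sup>2) \<le> slice_density ?t (1 / 3) w"
        by (simp only:)
      moreover have "?c \<le> arctan (sqrt 2 / 2) - arctan ?t"
        using arctan_diff_ge[OF _ st] by (simp add: power_divide)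
      then have "?c / sqrt (1 - w\<^sup>2) \<le> (arctan (sqrt 2 / 2) - arctan ?t) / sqrt (1 - w\<^sup>2)"
        using hw[of w] w by (intro divide_right_mono) auto
      ultimately show "?c * (1 / sqrt (1 - w\<^sup>2)) \<le> slice_density ?t (1 / 3) w" by simp
    }
    assume w: "w \<in> {0..h}"
    then have "w\<^sup>2 \<le> h\<^sup>2" by (intro power_mono) auto
    then show "0 \<le> ?c * (1 / sqrt (1 - w\<^sup>2))" using h c by simp
  qed
  then show ?thesis by simp
qed

lemma emeasure_orthoscheme_633k:
  fixes b :: "nat \<Rightarrow> real \<times> (real ^ 4)"
  assumes b: "normals [6, 3, 3, k] b" and k: "2 < k" and h: "(cos (pi / k))\<^sup>2 \<le> 2 / 3"
  shows "emeasure hyp_measure (truncated_orthoscheme b)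
    = (\<integral>\<^sup>+w. ennreal (slice_density (sqrt 3 / 3) (1 / 3) w / 3) * indicator {0..<cos (pi / k)} w \<partial>lborel)"
proof -
  let ?t = "sqrt 3 / 3 :: real"
  have t2: "?t\<^sup>2 = 1 / 3" by (simp add: power_divide)
  have "0 < cos (pi / k)" using k pi_gt_zero
    by (intro cos_gt_zero) (auto simp: divide_simps)
  then have "emeasure hyp_measure (truncated_orthoscheme b) =
      (\<integral>\<^sup>+w. ennreal (slice_density ?t ((1 / 2)\<^sup>2 * (1 + ?t\<^sup>2)) w / 3) * indicator {0..<cos (pi / k)} w \<partial>lborel)"
    by (intro emeasure_truncated_orthoscheme[OF b])
       (use h t2 in \<open>simp_all add: cos_30 sin_30 cos_60 tan_30 power2_eq_square[of "1 / 2"] real_div_sqrt field_simps\<close>)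
  also have "(1 / 2)\<^sup>2 * (1 + ?t\<^sup>2) = 1 / 3" by (simp add: t2 power2_eq_square[of "1 / 2"])
  finally show ?thesis .
qed

lemma emeasure_orthoscheme_633k_ge:
  fixes b :: "nat \<Rightarrow> real \<times> (real ^ 4)"
  assumes b: "normals [6, 3, 3, k] b" and k: "2 < k" and h: "(cos (pi / k))\<^sup>2 \<le> 2 / 3"
  shows "ennreal ((sqrt 2 / 2 - sqrt 3 / 3) / (3 / 2) * (pi / 2 - pi / k) / 3) \<le> emeasure hyp_measure (truncated_orthoscheme b)"
proof -
  have "0 < cos (pi / k)" using k pi_gt_zero
    by (intro cos_gt_zero) (auto simp: divide_simps)
  from hexagonal_slices_ge[OF this h] emeasure_orthoscheme_633k[OF assms]
  have "ennreal ((sqrt 2 / 2 - sqrt 3 / 3) / (3 / 2) * arcsin (cos (pi / k)) / 3) \<le> emeasure hyp_measure (truncated_orthoscheme b)"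
    by simp
  also have "arcsin (cos (pi / k)) = pi / 2 - pi / k"
    using k by (intro arcsin_cos) (auto simp: divide_simps)
  finally show ?thesis .
qed

text \<open>
  The equation is the factor of \<open>cos (3 x) = - cos (2 x)\<close>, at \<open>x = \<pi> / 5\<close>, that is left after division
  by \<open>cos x + 1\<close>.
\<close>

lemma cos_pi_5: "4 * (cos (pi / 5))\<^sup>2 = 2 * cos (pi / 5) + 1" "809 / 1000 \<le> cos (pi / 5)" "cos (pi / 5) \<le> 81 / 100"
proof -
  define c where "c = cos (pi / 5)"
  have c0: "c > 0" unfolding c_def by (intro cos_gt_zero) auto
  have "cos (3 * (pi / 5)) = - cos (2 * (pi / 5))"
    using cos_pi_minus[of "2 * (pi / 5)"] by (simp add: field_simps)
  then have "4 * c ^ 3 - 3 * c = - (2 * c\<^sup>2 - 1)"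
    by (simp only: cos_treble_cos cos_double_cos c_def)
  then have "(c + 1) * (4 * c\<^sup>2 - 2 * c - 1) = 0" by algebra
  then have eq: "4 * c\<^sup>2 = 2 * c + 1" using c0 by simp
  then show "4 * (cos (pi / 5))\<^sup>2 = 2 * cos (pi / 5) + 1" by (simp add: c_def)
  have "809 / 1000 \<le> c"
  proof (rule ccontr)
    assume "\<not> 809 / 1000 \<le> c"
    then have "c * (4 * c - 2) \<le> c * (4 * (809 / 1000) - 2)" "c * (4 * (809 / 1000) - 2) < 809 / 1000 * (4 * (809 / 1000) - 2)"
      using c0 by (auto intro!: mult_left_mono)
    then have "c * (4 * c - 2) < 1" by simp
    then show False using eq by (simp add: power2_eq_square algebra_simps)
  qed
  then show "809 / 1000 \<le> cos (pi / 5)" by (simp add: c_def)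
  have "c \<le> 81 / 100"
  proof (rule ccontr)
    assume "\<not> c \<le> 81 / 100"
    then have "81 / 100 * (4 * (81 / 100) - 2) \<le> c * (4 * c - 2)"
      by (intro mult_mono) auto
    then show False using eq by (simp add: power2_eq_square algebra_simps)
  qed
  then show "cos (pi / 5) \<le> 81 / 100" by (simp add: c_def)
qed

text \<open>
  Here the bound by the value at \<open>w = 0\<close> alone is too weak for the comparison of densities.  The interval is
  split at \<open>sqrt 2 / 2\<close>, where the arctangent equals \<open>\<pi> / 4\<close>.
\<close>

lemma emeasure_orthoscheme_6335_ge:
  fixes b :: "nat \<Rightarrow> real \<times> (real ^ 4)"
  assumes b: "normals [6, 3, 3, 5] b"
  shows "ennreal ((sqrt 2 / 2 - sqrt 3 / 3) / (3 / 2) * (pi / 4) / 3 + pi\<^sup>2 / 720) \<le> emeasure hyp_measure (truncated_orthoscheme b)"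
proof -
  define h where "h = cos (pi / 5)"
  have h: "809 / 1000 \<le> h" "h \<le> 81 / 100" "h\<^sup>2 \<le> 2 / 3"
    using cos_pi_5 by (auto simp: h_def)
  define u where "u = sqrt 2 / 2"
  have u: "0 < u" "u\<^sup>2 = 1 / 2" by (simp_all add: u_def power_divide)
  have "u < h"
  proof (rule power2_less_imp_less)
    have "(809 / 1000)\<^sup>2 \<le> h\<^sup>2" using h by (intro power_mono) auto
    then show "u\<^sup>2 < h\<^sup>2" unfolding u(2) by (simp add: power2_eq_square)
  qed (use h in simp)
  let ?t = "sqrt 3 / 3 :: real"
  let ?s = "slice_density ?t (1 / 3)"
  have hw: "w\<^sup>2 + 1 / 3 < 1" if "0 \<le> w" "w < h" for w
  proof -
    have "w\<^sup>2 < h\<^sup>2" using that by (intro power_strict_mono) auto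
    then show ?thesis using h by simp
  qed
  have asin: "arcsin h = 3 * pi / 10" "arcsin u = pi / 4"
    using arcsin_cos[of "pi / 5"] arcsin_cos[of "pi / 4"] by (simp_all add: h_def u_def cos_45)
  have at: "arctan ?t = pi / 6"
    using arctan_unique[of "pi / 6" ?t] by (simp add: tan_30 field_simps)
  have "emeasure hyp_measure (truncated_orthoscheme b) = (\<integral>\<^sup>+w. ennreal (?s w / 3) * indicator {0..<h} w \<partial>lborel)"
    using emeasure_orthoscheme_633k[OF b] h by (simp add: h_def)
  also have "\<dots> =
     (\<integral>\<^sup>+w. ennreal (?s w / 3) * indicator {0..<u} w + ennreal (?s w / 3) * indicator {u..<h} w \<partial>lborel)"
    using u \<open>u < h\<close> by (intro nn_integral_cong) (auto split: split_indicator)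
  also have "\<dots> = (\<integral>\<^sup>+w. ennreal (?s w / 3) * indicator {0..<u} w \<partial>lborel) +
     (\<integral>\<^sup>+w. ennreal (?s w / 3) * indicator {u..<h} w \<partial>lborel)"
    unfolding slice_density_def by (rule nn_integral_add) measurable
  also have "\<dots> \<ge> ennreal ((sqrt 2 / 2 - sqrt 3 / 3) / (3 / 2) * arcsin u / 3) + ennreal (pi / 12 * (arcsin h - arcsin u) / 3)"
  proof (rule add_mono)
    show "ennreal ((sqrt 2 / 2 - sqrt 3 / 3) / (3 / 2) * arcsin u / 3) \<le> (\<integral>\<^sup>+w. ennreal (?s w / 3) * indicator {0..<u} w \<partial>lborel)"
      using u by (intro hexagonal_slices_ge) auto
    show "ennreal (pi / 12 * (arcsin h - arcsin u) / 3) \<le> (\<integral>\<^sup>+w. ennreal (?s w / 3) * indicator {u..<h} w \<partial>lborel)"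
    proof (rule nn_integral_slice_ge)
      show "((\<lambda>w. pi / 12 * (1 / sqrt (1 - w\<^sup>2))) has_integral pi / 12 * (arcsin h - arcsin u)) {u..h}"
        using h u \<open>u < h\<close> by (intro has_integral_mult_right has_integral_arcsin) auto
      fix w :: real assume w: "w \<in> {u..<h}"
      have "?t * sqrt (1 - u\<^sup>2) / sqrt (1 - u\<^sup>2 - 1 / 3) = 1"
      proof -
        have "1 - u\<^sup>2 = (1 / 2 :: real)" "1 - u\<^sup>2 - 1 / 3 = (1 / 3 * (1 / 2) :: real)"
          by (simp_all add: u)
        moreover have "?t = sqrt (1 / 3)" by (simp add: real_sqrt_divide field_simps)
        ultimately show ?thesis by (simp only: real_sqrt_mult) simp
      qed
      moreover have "(arctan (?t * sqrt (1 - u\<^sup>2) / sqrt (1 - u\<^sup>2 - 1 / 3)) - arctan ?t) / sqrt (1 - w\<^sup>2) \<le> ?s w"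
        using hw[of w] w u by (intro slice_density_ge) auto
      ultimately have "(pi / 4 - pi / 6) / sqrt (1 - w\<^sup>2) \<le> ?s w"
        by (simp only: arctan_1 at)
      then show "pi / 12 * (1 / sqrt (1 - w\<^sup>2)) \<le> ?s w" by simp
    next
      fix w :: real assume w: "w \<in> {u..h}"
      then have "w\<^sup>2 \<le> h\<^sup>2" using u by (intro power_mono) auto
      then show "0 \<le> pi / 12 * (1 / sqrt (1 - w\<^sup>2))" using h by simp
    qed
  qed
  also have "ennreal ((sqrt 2 / 2 - sqrt 3 / 3) / (3 / 2) * arcsin u / 3) + ennreal (pi / 12 * (arcsin h - arcsin u) / 3)
      = ennreal ((sqrt 2 / 2 - sqrt 3 / 3) / (3 / 2) * (pi / 4) / 3 + pi\<^sup>2 / 720)"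
  proof -
    have "sqrt 3 / 3 \<le> sqrt 2 / (2::real)"
    proof (rule power2_le_imp_le)
      show "(sqrt 3 / 3)\<^sup>2 \<le> (sqrt 2 / (2::real))\<^sup>2" by (simp add: power_divide)
    qed simp
    then have "ennreal ((sqrt 2 / 2 - sqrt 3 / 3) / (3 / 2) * (pi / 4) / 3) + ennreal (pi / 12 * (3 * pi / 10 - pi / 4) / 3)
      = ennreal ((sqrt 2 / 2 - sqrt 3 / 3) / (3 / 2) * (pi / 4) / 3 + pi / 12 * (3 * pi / 10 - pi / 4) / 3)"
      by (intro ennreal_plus[symmetric]) auto
    moreover have "pi / 12 * (3 * pi / 10 - pi / 4) / 3 = pi\<^sup>2 / 720" by (simp add: power2_eq_square)
    ultimately show ?thesis by (simp only: asin)
  qed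
  finally show ?thesis .
qed

text \<open>
  This is the closest competitor, with about 95 percent of the optimal density, and needs a second-order bound.
  With \<open>v = w\<^sup>2 / (1 - w\<^sup>2)\<close> the arctangent is \<open>\<pi> / 2 - arctan (sqrt (1 - 2 v))\<close>; from
  \<open>sqrt (1 - 2 v) \<le> 1 - v\<close> and the slope \<open>1 / 2\<close> of the arctangent at \<open>1\<close> it is at least \<open>\<pi> / 4 + v / 2\<close>,
  and this lower bound has an elementary integral.
\<close>

lemma emeasure_orthoscheme_6343_ge:
  fixes b :: "nat \<Rightarrow> real \<times> (real ^ 4)"
  assumes b: "normals [6, 3, 4, 3] b"
  shows "ennreal ((pi\<^sup>2 / 72 + (sqrt 3 / 3 - pi / 6) / 2) / 3) \<le> emeasure hyp_measure (truncated_orthoscheme b)"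
proof -
  let ?t = "sqrt 3 / 3 :: real"
  have t2: "?t\<^sup>2 = 1 / 3" by (simp add: power_divide)
  have W: "w\<^sup>2 < 1 / 4" if "0 \<le> w" "w < 1 / 2" for w :: real
    using power_strict_mono[of w "1 / 2" 2] that by (simp add: power_divide)
  have W': "w\<^sup>2 \<le> 1 / 4" if "0 \<le> w" "w \<le> 1 / 2" for w :: real
    using power_mono[of w "1 / 2" 2] that by (simp add: power_divide)
  define g where "g w = (pi / 12 + w\<^sup>2 / (1 - w\<^sup>2) / 2) / sqrt (1 - w\<^sup>2)" for w :: real
  have "emeasure hyp_measure (truncated_orthoscheme b) =
      (\<integral>\<^sup>+w. ennreal (slice_density ?t ((sqrt 2 / 2)\<^sup>2 * (1 + ?t\<^sup>2)) w / 3) * indicator {0..<1 / 2} w \<partial>lborel)"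
    by (rule emeasure_truncated_orthoscheme[OF b])
       (use t2 in \<open>simp_all add: cos_30 sin_30 cos_60 cos_45 tan_30 power_divide real_div_sqrt field_simps\<close>)
  also have "(sqrt 2 / 2)\<^sup>2 * (1 + ?t\<^sup>2) = 2 / 3" by (simp add: t2 power_divide)
  also have "(\<integral>\<^sup>+w. ennreal (slice_density ?t (2 / 3) w / 3) * indicator {0..<1 / 2} w \<partial>lborel) \<ge>
      ennreal ((pi\<^sup>2 / 72 + (sqrt 3 / 3 - pi / 6) / 2) / 3)"
  proof (rule nn_integral_slice_ge)
    have asin: "arcsin (1 / 2) = pi / 6" using arcsin_cos[of "pi / 3"] by (simp add: cos_60)
    define G where "G w = pi / 12 * arcsin w + (w / sqrt (1 - w\<^sup>2) - arcsin w) / 2" for w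
    have "(g has_integral G (1 / 2) - G 0) {0..1 / 2}"
    proof (rule fundamental_theorem_of_calculus)
      fix w :: real assume w: "w \<in> {0..1 / 2}"
      have A: "1 - w\<^sup>2 > 0" using W'[of w] w by simp
      define R where "R = sqrt (1 - w\<^sup>2)"
      have R: "R > 0" "R * R = 1 - w\<^sup>2" using A by (auto simp: R_def)
      have a: "(arcsin has_real_derivative 1 / R) (at w)"
        using w DERIV_arcsin[of w] by (simp add: R_def inverse_eq_divide)
      have "((\<lambda>w. sqrt (1 - w\<^sup>2)) has_real_derivative - w / R) (at w)"
        using A unfolding R_def by (auto intro!: derivative_eq_intros simp: field_simps)
      from DERIV_divide[OF DERIV_ident this]
      have d: "((\<lambda>w. w / sqrt (1 - w\<^sup>2)) has_real_derivative (1 * R - w * (- w / R)) / (R * R)) (at w)"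
        using R(1) by (simp add: R_def)
      have "(G has_real_derivative (pi / 12 * (1 / R) + ((1 * R - w * (- w / R)) / (R * R) - 1 / R) / 2)) (at w)"
        unfolding G_def by (intro DERIV_add DERIV_cmult DERIV_cdivide DERIV_diff a d)
      moreover have "pi / 12 * (1 / R) + ((1 * R - w * (- w / R)) / (R * R) - 1 / R) / 2 = g w"
        unfolding g_def R_def[symmetric] R(2)[symmetric] using R(1)
        by (simp add: field_simps power2_eq_square)
      ultimately show "(G has_vector_derivative g w) (at w within {0..1 / 2})"
        by (simp add: has_real_derivative_iff_has_vector_derivative[symmetric] has_field_derivative_at_within)
    qed simp
    moreover have "G (1 / 2) - G 0 = pi\<^sup>2 / 72 + (sqrt 3 / 3 - pi / 6) / 2"
    proof -
      have "sqrt (1 - (1 / 2)\<^sup>2) = sqrt 3 / (2::real)"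
        by (simp add: power2_eq_square real_sqrt_divide)
      then show ?thesis by (simp add: G_def asin power2_eq_square field_simps)
    qed
    ultimately show "(g has_integral pi\<^sup>2 / 72 + (sqrt 3 / 3 - pi / 6) / 2) {0..1 / 2}" by simp
    fix w :: real
    {
      assume "w \<in> {0..1 / 2}"
      then show "0 \<le> g w" using W'[of w] by (simp add: g_def)
    }
    assume w: "w \<in> {0..<1 / 2}"
    define A where "A = 1 - w\<^sup>2"
    have A: "A > 3 / 4" using W[of w] w by (simp add: A_def)
    define v where "v = w\<^sup>2 / A"
    have v: "0 \<le> v" "v < 1 / 2" using A W[of w] w by (auto simp: v_def divide_simps A_def)
    define y where "y = sqrt (1 - 2 * v)"
    have y: "0 < y" "y \<le> 1" "y\<^sup>2 = 1 - 2 * v" using v by (auto simp: y_def)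
    have yv: "y \<le> 1 - v"
    proof (rule power2_le_imp_le)
      show "y\<^sup>2 \<le> (1 - v)\<^sup>2" using y by (simp add: power2_eq_square algebra_simps)
    qed (use v in simp)
    have "?t * sqrt A / sqrt (A - 2 / 3) = 1 / y"
    proof -
      have "(?t * sqrt A / sqrt (A - 2 / 3))\<^sup>2 = (1 / y)\<^sup>2"
      proof -
        have "y\<^sup>2 = 3 * (A - 2 / 3) / A" unfolding y(3) v_def using A by (simp add: A_def field_simps)
        then have "(1 / y)\<^sup>2 = A / (3 * (A - 2 / 3))" by (simp add: power_divide)
        moreover have "(?t * sqrt A / sqrt (A - 2 / 3))\<^sup>2 = ?t\<^sup>2 * A / (A - 2 / 3)"
        proof -
          have "(sqrt A)\<^sup>2 = A" "(sqrt (A - 2 / 3))\<^sup>2 = A - 2 / 3" using A by simp_all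
          then show ?thesis by (simp only: power_divide power_mult_distrib)
        qed
        ultimately show ?thesis
          unfolding t2 by (simp only: times_divide_eq_left mult_1_left divide_divide_eq_left)
      qed
      moreover have "0 \<le> ?t * sqrt A / sqrt (A - 2 / 3)" "0 \<le> 1 / y" using A y by simp_all
      ultimately show ?thesis using power2_eq_imp_eq by blast
    qed
    moreover have "arctan (1 / y) = pi / 2 - arctan y"
      using arctan_inverse[of y] y by (simp add: inverse_eq_divide)
    ultimately have "arctan (?t * sqrt A / sqrt (A - 2 / 3)) = pi / 2 - arctan y"
      by (simp only:)
    moreover have "arctan ?t = pi / 6"
      using arctan_unique[of "pi / 6" ?t] by (simp add: tan_30 field_simps)
    moreover have "v / 2 \<le> pi / 4 - arctan y"
    proof -
      have "v / 2 \<le> (1 - y) / (1 + 1\<^sup>2)" using yv by simp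
      also have "\<dots> \<le> arctan 1 - arctan y" using y by (intro arctan_diff_ge) auto
      finally show ?thesis by (simp add: arctan_1)
    qed
    ultimately have "pi / 12 + v / 2 \<le> arctan (?t * sqrt A / sqrt (A - 2 / 3)) - arctan ?t" by simp
    then show "g w \<le> slice_density ?t (2 / 3) w"
      unfolding g_def slice_density_def A_def[symmetric] v_def
      using A by (intro divide_right_mono) auto
  qed
  finally show ?thesis .
qed

section \<open>Radii of balls contained in an orthoscheme\<close>

text \<open>
  The coordinates of the centre are divided by \<open>\<sigma> = sinh r\<close>, so that all distances to facets become at least \<open>1\<close>;
  \<open>k\<close> is the null coordinate.
\<close>

lemma insphere_constraints:
  fixes y :: "real \<times> (real ^ 4)"
  assumes \<sigma>: "\<sigma> > 0" and y: "lorentz y y = - 1" "\<And>i. i \<le> 5 \<Longrightarrow> lorentz y (model_normals c s a h i) \<le> - \<sigma>"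
  obtains k u1 u2 u3 u4 where
    "y = (\<sigma> * (k + u4), \<sigma> *\<^sub>R vector [u1, u2, u3, u4])"
    "1 / \<sigma>\<^sup>2 = k\<^sup>2 + 2 * k * u4 - u1\<^sup>2 - u2\<^sup>2 - u3\<^sup>2"
    "1 \<le> u2" "c * u2 \<le> s * u1 - 1" "u1 \<le> a * k - 1" "1 \<le> u4" "1 \<le> u3" "u3 \<le> h * k - 1"
proof -
  define k where "k = (fst y - snd y $ 4) / \<sigma>"
  define u where "u i = snd y $ i / \<sigma>" for i
  have yc: "snd y $ i = \<sigma> * u i" for i using \<sigma> by (simp add: u_def)
  have y0: "fst y = \<sigma> * (k + u 4)" using \<sigma> by (simp add: u_def k_def field_simps)
  have 1: "y = (\<sigma> * (k + u 4), \<sigma> *\<^sub>R vector [u 1, u 2, u 3, u 4])"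
    by (simp add: prod_eq_iff vec_eq_iff forall_4 y0 yc)
  have "- 1 = - (\<sigma>\<^sup>2 * (k\<^sup>2 + 2 * k * u 4 - (u 1)\<^sup>2 - (u 2)\<^sup>2 - (u 3)\<^sup>2))"
    unfolding y(1)[symmetric] by (simp add: lorentz_coordinates y0 yc power2_eq_square algebra_simps)
  then have 2: "1 / \<sigma>\<^sup>2 = k\<^sup>2 + 2 * k * u 4 - (u 1)\<^sup>2 - (u 2)\<^sup>2 - (u 3)\<^sup>2"
    using \<sigma> by (simp add: divide_simps mult.commute)
  have "\<sigma> * 1 \<le> \<sigma> * u 2" using y(2)[of 0] by (simp add: lorentz_coordinates yc)
  moreover have "\<sigma> * (c * u 2) \<le> \<sigma> * (s * u 1 - 1)"
    using y(2)[of 1] by (simp add: lorentz_coordinates yc algebra_simps)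
  moreover have "\<sigma> * u 1 \<le> \<sigma> * (a * k - 1)"
    using y(2)[of 2] by (simp add: lorentz_coordinates y0 yc algebra_simps)
  moreover have "\<sigma> * 1 \<le> \<sigma> * u 4" using y(2)[of 3] by (simp add: lorentz_coordinates yc)
  moreover have "\<sigma> * u 3 \<le> \<sigma> * (h * k - 1)"
    using y(2)[of 4] by (simp add: lorentz_coordinates y0 yc algebra_simps)
  moreover have "\<sigma> * 1 \<le> \<sigma> * u 3" using y(2)[of 5] by (simp add: lorentz_coordinates yc)
  ultimately show ?thesis
    using that[OF 1 2] \<sigma> by simp
qed

lemma ball_in_orthoscheme_frame:
  fixes b :: "nat \<Rightarrow> real \<times> (real ^ 4)"
  assumes b: "normals m b" and x: "x \<in> ball 0 1" and r: "r > 0"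
    and L: "surj L" "\<And>x y. lorentz (L x) (L y) = lorentz x y"
      "\<And>y i. i \<le> 5 \<Longrightarrow> lorentz (L y) (b i) = lorentz y (N i)"
    and sub: "hyp_cball x r \<subseteq> truncated_orthoscheme b"
  obtains y where "unit_lift x = L y" "lorentz y y = - 1" "\<And>i. i \<le> 5 \<Longrightarrow> lorentz y (N i) \<le> - sinh r"
proof -
  obtain y where y: "unit_lift x = L y" using L(1) by (metis surjD)
  have "lorentz (b i) (b i) = 1" if "i \<le> DIM(real ^ 4) + 1" for i
    using b that by (simp add: normals_def)
  then have "\<forall>i \<le> DIM(real ^ 4) + 1. lorentz (unit_lift x) (b i) \<le> - sinh r"
    using ball_in_truncated_orthoscheme_iff[OF x r] sub by blast
  then have "lorentz y (N i) \<le> - sinh r" if "i \<le> 5" for i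
    using that by (simp add: y L(3)[symmetric])
  moreover have "lorentz y y = - 1"
    using unit_lift_unit[OF x] by (simp add: y L(2))
  ultimately show ?thesis using that y by blast
qed

text \<open>
  The case of the triangle with angles \<open>\<pi> / 4, \<pi> / 4, \<pi> / 2\<close> and \<open>a = 1 / 2\<close>.  The upper bounds for
  \<open>u1\<close>, \<open>u2\<close>, \<open>u3\<close> and the lower bound for \<open>u4\<close> can be attained simultaneously, by the centre in the
  corner farthest from the centre of the hemisphere; equality forces all four.
\<close>

lemma square_faced_radius_bound:
  assumes c: "c = sqrt 2 / 2" "s = sqrt 2 / 2"
    and eq: "R = k\<^sup>2 + 2 * k * u4 - u1\<^sup>2 - u2\<^sup>2 - u3\<^sup>2"
    and u: "1 \<le> u2" "c * u2 \<le> s * u1 - 1" "u1 \<le> k / 2 - 1" "1 \<le> u4" "1 \<le> u3" "u3 \<le> h * k - 1"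
  shows "4 + 2 * sqrt 2 \<le> k"
    and "(1 / 2 - h\<^sup>2) * k\<^sup>2 + (4 + sqrt 2 + 2 * h) * k - (5 + 2 * sqrt 2) \<le> R"
    and "R \<le> (1 / 2 - h\<^sup>2) * k\<^sup>2 + (4 + sqrt 2 + 2 * h) * k - (5 + 2 * sqrt 2) \<Longrightarrow>
      u1 = k / 2 - 1 \<and> u2 = k / 2 - 1 - sqrt 2 \<and> u3 = h * k - 1 \<and> u4 = 1"
proof -
  have "sqrt 2 * (sqrt 2 / 2 * u2) \<le> sqrt 2 * (sqrt 2 / 2 * u1 - 1)"
    using u(2) c by (intro mult_left_mono) auto
  then have u21: "u2 \<le> u1 - sqrt 2" by (simp add: algebra_simps)
  show k: "4 + 2 * sqrt 2 \<le> k" using u21 u by simp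
  have s2: "0 \<le> sqrt 2" by simp
  have k0: "0 < k" using k s2 by linarith
  have u1: "0 \<le> u1" using u21 u(1) s2 by linarith
  have u2: "u2 \<le> k / 2 - 1 - sqrt 2" using u21 u by simp
  define D1 where "D1 = (k / 2 - 1)\<^sup>2 - u1\<^sup>2"
  define D2 where "D2 = (k / 2 - 1 - sqrt 2)\<^sup>2 - u2\<^sup>2"
  define D3 where "D3 = (h * k - 1)\<^sup>2 - u3\<^sup>2"
  define D4 where "D4 = 2 * k * (u4 - 1)"
  have D: "0 \<le> D1" "0 \<le> D2" "0 \<le> D3" "0 \<le> D4"
    using u u1 u2 k0 by (auto simp: D1_def D2_def D3_def D4_def intro!: power_mono)
  define T where "T = (1 / 2 - h\<^sup>2) * k\<^sup>2 + (4 + sqrt 2 + 2 * h) * k - (5 + 2 * sqrt 2)"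
  have T: "R = T + D1 + D2 + D3 + D4"
    unfolding eq T_def D1_def D2_def D3_def D4_def by (simp add: power2_eq_square field_simps)
  show "T \<le> R" using T D by linarith
  assume "R \<le> T"
  then have "D1 = 0" "D2 = 0" "D3 = 0" "D4 = 0" using T D by linarith+
  then have "u1\<^sup>2 = (k / 2 - 1)\<^sup>2" "u2\<^sup>2 = (k / 2 - 1 - sqrt 2)\<^sup>2" "u3\<^sup>2 = (h * k - 1)\<^sup>2" "u4 = 1"
    using k0 by (simp_all add: D1_def D2_def D3_def D4_def)
  then show "u1 = k / 2 - 1 \<and> u2 = k / 2 - 1 - sqrt 2 \<and> u3 = h * k - 1 \<and> u4 = 1"
    using u u1 u2 power2_eq_imp_eq[of u1 "k / 2 - 1"] power2_eq_imp_eq[of u2 "k / 2 - 1 - sqrt 2"]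
      power2_eq_imp_eq[of u3 "h * k - 1"] by simp
qed

text \<open>
  The same estimate for the triangle with angles \<open>\<pi> / 6, \<pi> / 3, \<pi> / 2\<close>.
\<close>

lemma hexagon_faced_radius_bound:
  assumes c: "c = sqrt 3 / 2" "s = 1 / 2" and a: "0 < a"
    and eq: "R = k\<^sup>2 + 2 * k * u4 - u1\<^sup>2 - u2\<^sup>2 - u3\<^sup>2"
    and u: "1 \<le> u2" "c * u2 \<le> s * u1 - 1" "u1 \<le> a * k - 1" "1 \<le> u4" "1 \<le> u3" "u3 \<le> h * k - 1"
  shows "3 + sqrt 3 \<le> a * k"
    "(1 - 4 / 3 * a\<^sup>2 - h\<^sup>2) * k\<^sup>2 + (2 + 4 * a + 2 * h) * k - 5 \<le> R"
proof -
  have "sqrt 3 * u2 \<le> u1 - 2" using u(2) c by simp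
  then have u21: "sqrt 3 * u2 \<le> a * k - 3" using u(3) by simp
  have "sqrt 3 * 1 \<le> sqrt 3 * u2" using u(1) by (intro mult_left_mono) auto
  then show k: "3 + sqrt 3 \<le> a * k" using u21 by linarith
  have "0 < a * k" using k by (smt (verit) real_sqrt_ge_zero)
  then have k0: "0 < k" using a by (simp add: zero_less_mult_iff)
  have "0 \<le> u1" using u21 \<open>sqrt 3 * u2 \<le> u1 - 2\<close> \<open>sqrt 3 * 1 \<le> sqrt 3 * u2\<close>
    by (smt (verit) real_sqrt_ge_zero)
  then have 1: "u1\<^sup>2 \<le> (a * k - 1)\<^sup>2" using u by (intro power_mono) auto
  have "(sqrt 3 * u2)\<^sup>2 \<le> (a * k - 3)\<^sup>2" using u u21 by (intro power_mono) auto
  then have 2: "3 * u2\<^sup>2 \<le> (a * k - 3)\<^sup>2" by (simp add: power_mult_distrib)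
  have 3: "u3\<^sup>2 \<le> (h * k - 1)\<^sup>2" using u by (intro power_mono) auto
  have 4: "2 * k \<le> 2 * k * u4" using u k0 by simp
  have "k\<^sup>2 + 2 * k - (a * k - 1)\<^sup>2 - (a * k - 3)\<^sup>2 / 3 - (h * k - 1)\<^sup>2 \<le> R"
    unfolding eq using 1 2 3 4 by linarith
  moreover have "k\<^sup>2 + 2 * k - (a * k - 1)\<^sup>2 - (a * k - 3)\<^sup>2 / 3 - (h * k - 1)\<^sup>2
      = (1 - 4 / 3 * a\<^sup>2 - h\<^sup>2) * k\<^sup>2 + (2 + 4 * a + 2 * h) * k - 5"
    by (simp add: power2_eq_square field_simps)
  ultimately show "(1 - 4 / 3 * a\<^sup>2 - h\<^sup>2) * k\<^sup>2 + (2 + 4 * a + 2 * h) * k - 5 \<le> R" by simp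
qed

section \<open>Comparison of the densities\<close>

text \<open>
  A set of infinite measure has \<^const>\<open>measure\<close> zero by convention.  Division by zero then makes the
  density zero, so lower bounds for \<^const>\<open>emeasure\<close> are enough to bound densities from above.
\<close>

lemma measure_ge_or_zero:
  assumes "ennreal Y \<le> emeasure M A" "0 \<le> Y"
  shows "measure M A = 0 \<or> Y \<le> measure M A"
proof (cases "emeasure M A = top")
  case True
  then show ?thesis by (simp add: measure_def)
next
  case False
  then have "enn2real (ennreal Y) \<le> measure M A"
    unfolding measure_def using assms(1) by (intro enn2real_mono) (auto simp: less_top)
  then show ?thesis using assms(2) by simp
qed

definition ball_volume_polynomial :: "real \<Rightarrow> real" where
  "ball_volume_polynomial C = (C - 1)\<^sup>2 * (C + 2)"

lemma ball_volume_polynomial_mono: "1 \<le> C \<Longrightarrow> C \<le> D \<Longrightarrow> ball_volume_polynomial C \<le> ball_volume_polynomial D"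
  unfolding ball_volume_polynomial_def by (intro mult_mono power_mono) auto

lemma ball_volume_polynomial_strict_mono: "1 \<le> C \<Longrightarrow> C < D \<Longrightarrow> ball_volume_polynomial C < ball_volume_polynomial D"
  unfolding ball_volume_polynomial_def by (intro mult_less_le_imp_less power_strict_mono) auto

text \<open>
  \<open>N\<close> is a lower bound for \<open>1 / sinh\<^sup>2 r\<close>, \<open>C\<close> an upper bound for \<open>cosh r\<close>, and \<open>Y\<close> a lower bound for
  the volume of the polytope.
\<close>

lemma packing_density_less:
  fixes b :: "nat \<Rightarrow> real \<times> (real ^ 4)"
  assumes "x \<in> ball 0 1" "r > 0"
    and C: "1 + 1 / N \<le> C\<^sup>2" "1 \<le> C" and N: "0 < N" "N \<le> 1 / (sinh r)\<^sup>2"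
    and Y: "ennreal Y \<le> emeasure hyp_measure (truncated_orthoscheme b)" "0 < Y"
    and q: "2 * pi\<^sup>2 / 3 * ball_volume_polynomial C < q * Y" "0 < q"
  shows "packing_density b (hyp_cball x r) < q"
proof -
  have sh: "sinh r > 0" using assms(2) by simp
  have "(sinh r)\<^sup>2 \<le> 1 / N" using N sh by (simp add: divide_simps mult.commute)
  then have "(cosh r)\<^sup>2 \<le> C\<^sup>2" using C(1) by (simp add: cosh_square_eq)
  then have "cosh r \<le> C" using C(2) power2_le_imp_le[of "cosh r" C] by simp
  then have "ball_volume_polynomial (cosh r) \<le> ball_volume_polynomial C"
    by (intro ball_volume_polynomial_mono cosh_real_ge_1)
  then have "hyp_vol (hyp_cball x r) \<le> 2 * pi\<^sup>2 / 3 * ball_volume_polynomial C"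
    using hyp_vol_hyp_cball[OF assms(1,2)]
    by (simp only: ball_volume_polynomial_def[symmetric]) (intro mult_left_mono; simp)
  then have V: "hyp_vol (hyp_cball x r) < q * Y" using q(1) by simp
  from measure_ge_or_zero[OF Y(1)] Y(2)
  consider "hyp_vol (truncated_orthoscheme b) = 0" | "Y \<le> hyp_vol (truncated_orthoscheme b)" by fastforce
  then show ?thesis
  proof cases
    case 1
    then show ?thesis using q(2) by (simp add: packing_density_def)
  next
    case 2
    then have "q * Y \<le> q * hyp_vol (truncated_orthoscheme b)" using q(2) by simp
    then have "hyp_vol (hyp_cball x r) < q * hyp_vol (truncated_orthoscheme b)" using V by simp
    then show ?thesis using 2 Y(2) by (simp add: packing_density_def divide_simps)
  qed
qed

lemma pi_squared_bounds: "9869 / 1000 \<le> pi\<^sup>2" "pi\<^sup>2 \<le> 98697 / 10000"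
proof -
  have "(31415 / 10000)\<^sup>2 \<le> pi\<^sup>2" using pi_approx by (intro power_mono) auto
  then show "9869 / 1000 \<le> pi\<^sup>2" by (simp add: power2_eq_square)
  have "pi\<^sup>2 \<le> (31416 / 10000)\<^sup>2" using pi_approx by (intro power_mono) auto
  then show "pi\<^sup>2 \<le> 98697 / 10000" by (simp add: power2_eq_square)
qed

lemma sqrt_2_bounds: "141421356 / 100000000 \<le> sqrt 2" "sqrt 2 \<le> 141421357 / 100000000"
  by (intro real_le_rsqrt real_le_lsqrt; simp add: power2_eq_square)+

lemma sqrt_3_bounds: "173205 / 100000 \<le> sqrt 3" "sqrt 3 \<le> 173206 / 100000"
  by (intro real_le_rsqrt real_le_lsqrt; simp add: power2_eq_square)+

text \<open>
  The smallest possible null coordinate is \<open>K = 4 + 2 sqrt 2\<close>; there the three sides of the triangle are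
  all at distance \<open>1\<close>.  The quadratic polynomial \<open>P\<close> increases from \<open>P K = 25 + 16 sqrt 2\<close> on, so
  \<open>1 / sinh\<^sup>2 r\<close> is minimal for exactly one centre \<open>y0\<close>.  The ball around it touches every facet
  except \<open>H\<^sup>5\<close>.
\<close>

lemma inball_4433:
  fixes b :: "nat \<Rightarrow> real \<times> (real ^ 4)"
  assumes b: "normals [4, 4, 3, 3] b"
  obtains x0 r0 where "x0 \<in> ball 0 1" "r0 > 0" "(sinh r0)\<^sup>2 = 1 / (25 + 16 * sqrt 2)"
    "hyp_cball x0 r0 \<subseteq> truncated_orthoscheme b"
    "\<And>x r. x \<in> ball 0 1 \<Longrightarrow> r > 0 \<Longrightarrow> hyp_cball x r \<subseteq> truncated_orthoscheme b \<Longrightarrow> r \<le> r0 \<and> (r = r0 \<longrightarrow> x = x0)"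
proof -
  let ?N = "model_normals (sqrt 2 / 2) (sqrt 2 / 2) (1 / 2) (1 / 2)"
  obtain L where L: "linear L" "\<And>x y. lorentz (L x) (L y) = lorentz x y" "surj L"
    "\<And>y i. i \<le> 5 \<Longrightarrow> lorentz (L y) (b i) = lorentz y (?N i)"
    using frame_of_normals[OF b] by (auto simp: cos_45 sin_45 cos_60)
  define Q where "Q = 25 + 16 * sqrt 2"
  have Q: "Q > 0" by (simp add: Q_def add_pos_nonneg)
  define \<sigma> where "\<sigma> = 1 / sqrt Q"
  have \<sigma>: "\<sigma> > 0" "\<sigma>\<^sup>2 = 1 / Q" using Q by (simp_all add: \<sigma>_def power_divide)
  define y0 :: "real \<times> (real ^ 4)" where
    "y0 = (\<sigma> * (4 + 2 * sqrt 2 + 1), \<sigma> *\<^sub>R vector [1 + sqrt 2, 1, 1 + sqrt 2, 1])"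
  have y0: "lorentz y0 y0 = - 1"
  proof -
    have "lorentz y0 y0 = - (\<sigma>\<^sup>2 * Q)"
      by (simp add: y0_def lorentz_coordinates Q_def power2_eq_square algebra_simps)
    then show ?thesis using \<sigma> Q by simp
  qed
  have "\<forall>i \<le> 5. lorentz y0 (?N i) \<le> - \<sigma>"
    using \<sigma>(1) by (simp add: all_le_5 y0_def lorentz_coordinates algebra_simps)
  then have y0b: "lorentz (L y0) (b i) \<le> - \<sigma>" if "i \<le> 5" for i
    using that by (simp add: L(4))
  have f0: "fst (L y0) > 0"
  proof (rule future_if_inside[OF b])
    show "lorentz (L y0) (L y0) < 0" by (simp add: L(2) y0)
    show "lorentz (L y0) (b i) \<le> 0" if "i \<le> DIM(real ^ 4) + 1" for i
      using y0b[of i] \<sigma>(1) that by simp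
  qed
  define x0 where "x0 = proj (L y0)"
  have x0: "x0 \<in> ball 0 1" unfolding x0_def by (rule proj_in_ball) (simp add: L(2) y0)
  have ux0: "unit_lift x0 = L y0"
    using unit_lift_proj[of "L y0"] f0 by (simp add: x0_def L(2) y0)
  define r0 where "r0 = arsinh \<sigma>"
  have r0: "r0 > 0" "sinh r0 = \<sigma>" using \<sigma> by (simp_all add: r0_def)
  have unit: "lorentz (b i) (b i) = 1" if "i \<le> DIM(real ^ 4) + 1" for i
    using b that by (simp add: normals_def)
  have in0: "hyp_cball x0 r0 \<subseteq> truncated_orthoscheme b"
    using y0b by (subst ball_in_truncated_orthoscheme_iff[OF x0 r0(1) unit]) (auto simp: ux0 r0(2))
  have max: "r \<le> r0 \<and> (r = r0 \<longrightarrow> x = x0)"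
    if x: "x \<in> ball 0 1" and r: "r > 0" and sub: "hyp_cball x r \<subseteq> truncated_orthoscheme b" for x r
  proof -
    have sh: "sinh r > 0" using r by simp
    obtain y where y: "unit_lift x = L y" "lorentz y y = - 1" "\<And>i. i \<le> 5 \<Longrightarrow> lorentz y (?N i) \<le> - sinh r"
      using ball_in_orthoscheme_frame[OF b x r L(3,2,4) sub] by blast
    obtain k u1 u2 u3 u4 where k: "y = (sinh r * (k + u4), sinh r *\<^sub>R vector [u1, u2, u3, u4])"
      and eq: "1 / (sinh r)\<^sup>2 = k\<^sup>2 + 2 * k * u4 - u1\<^sup>2 - u2\<^sup>2 - u3\<^sup>2"
      and u: "1 \<le> u2" "sqrt 2 / 2 * u2 \<le> sqrt 2 / 2 * u1 - 1" "u1 \<le> 1 / 2 * k - 1" "1 \<le> u4" "1 \<le> u3" "u3 \<le> 1 / 2 * k - 1"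
      using insphere_constraints[OF sh y(2,3)] by metis
    have u': "u1 \<le> k / 2 - 1" using u(3) by simp
    note B = square_faced_radius_bound[OF refl refl eq u(1,2) u' u(4-6)]
    define K where "K = 4 + 2 * sqrt 2"
    define P where "P k = (1 / 2 - (1 / 2)\<^sup>2) * k\<^sup>2 + (4 + sqrt 2 + 2 * (1 / 2)) * k - (5 + 2 * sqrt 2)" for k :: real
    have kK: "K \<le> k" "0 \<le> K" using B(1) by (simp_all add: K_def)
    have PK: "P K = Q" by (simp add: P_def K_def Q_def power2_eq_square algebra_simps)
    have "P k - P K = (k - K) * ((k + K) / 4 + 5 + sqrt 2)"
      by (simp add: P_def power2_eq_square field_simps)
    also have "\<dots> \<ge> (k - K) * 5" using kK by (intro mult_left_mono) auto
    finally have Pk: "5 * (k - K) \<le> P k - Q" using PK by (simp add: algebra_simps)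
    define R where "R = 1 / (sinh r)\<^sup>2"
    have PR: "P k \<le> R" using B(2) by (simp only: P_def R_def)
    have QR: "Q \<le> 1 / (sinh r)\<^sup>2" using PR Pk kK by (simp add: R_def)
    then have "(sinh r)\<^sup>2 \<le> \<sigma>\<^sup>2" using Q sh by (simp add: \<sigma>(2) divide_simps mult.commute)
    then have "sinh r \<le> sinh r0" using \<sigma> sh power2_le_imp_le[of "sinh r" \<sigma>] by (simp add: r0)
    then have "r \<le> r0" by simp
    moreover have "x = x0" if "r = r0"
    proof -
      have s: "sinh r = \<sigma>" using that r0 by simp
      then have "R = Q" using \<sigma> by (simp add: R_def)
      then have "5 * (k - K) \<le> 0" using PR Pk by simp
      then have kK': "k = K" using kK(1) by simp
      have "1 / (sinh r)\<^sup>2 \<le> P k" using \<open>R = Q\<close> PK by (simp add: kK' R_def)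
      from B(3)[OF this[unfolded P_def]]
      have 1: "u1 = 1 + sqrt 2" and 2: "u2 = 1" and 3: "u3 = 1 + sqrt 2" and 4: "u4 = 1"
        by (simp_all add: kK' K_def add_divide_distrib)
      have "y = y0" unfolding k s y0_def 1 2 3 4 kK' K_def by (rule refl)
      then show "x = x0" using y(1) proj_unit_lift[OF x] by (simp add: x0_def)
    qed
    ultimately show ?thesis by blast
  qed
  show ?thesis using that[OF x0 r0(1) _ in0 max] r0(2) \<sigma>(2) by (simp add: Q_def)
qed

lemma packing_density_4433:
  fixes b :: "nat \<Rightarrow> real \<times> (real ^ 4)"
  assumes "normals [4, 4, 3, 3] b" "x \<in> ball 0 1" "r > 0"
  shows "packing_density b (hyp_cball x r) = 192 * ball_volume_polynomial (cosh r)"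
  using assms by (simp add: packing_density_def hyp_vol_orthoscheme_4433 hyp_vol_hyp_cball ball_volume_polynomial_def[symmetric])

text \<open>
  The two decimal fractions enclose \<open>cosh r = sqrt (1 + 1 / (25 + 16 sqrt 2)) = 1.01044362\<dots>\<close>.
\<close>

lemma optimal_density_bounds:
  assumes r: "(sinh r)\<^sup>2 = 1 / (25 + 16 * sqrt 2)"
  shows "0.06303 \<le> 192 * ball_volume_polynomial (cosh r)"
    "\<bar>192 * ball_volume_polynomial (cosh r) - 0.06304\<bar> \<le> 0.00001"
proof -
  define w where "w = 25 + 16 * sqrt 2"
  have w: "4762741696 / 100000000 \<le> w" "w \<le> 4762741712 / 100000000"
    using sqrt_2_bounds by (auto simp: w_def)
  have C: "(cosh r)\<^sup>2 = 1 + 1 / w" using r by (simp add: cosh_square_eq w_def)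
  have "1 / (4762741712 / 100000000) \<le> 1 / w" "1 / w \<le> 1 / (4762741696 / 100000000)"
    using w by (intro divide_left_mono; simp)+
  then have "(10104434 / 10000000)\<^sup>2 \<le> (cosh r)\<^sup>2" "(cosh r)\<^sup>2 \<le> (10104438 / 10000000)\<^sup>2"
    unfolding C by (simp_all add: power2_eq_square)
  then have "10104434 / 10000000 \<le> cosh r" "cosh r \<le> 10104438 / 10000000"
    using power2_le_imp_le[of "10104434 / 10000000" "cosh r"] power2_le_imp_le[of "cosh r" "10104438 / 10000000"]
    by simp_all
  then have "ball_volume_polynomial (10104434 / 10000000) \<le> ball_volume_polynomial (cosh r)"
    "ball_volume_polynomial (cosh r) \<le> ball_volume_polynomial (10104438 / 10000000)"
    by (auto intro!: ball_volume_polynomial_mono)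
  then have "0.06303 \<le> 192 * ball_volume_polynomial (cosh r)" "192 * ball_volume_polynomial (cosh r) \<le> 0.06305"
    by (simp_all add: ball_volume_polynomial_def power2_eq_square)
  then show "0.06303 \<le> 192 * ball_volume_polynomial (cosh r)"
    "\<bar>192 * ball_volume_polynomial (cosh r) - 0.06304\<bar> \<le> 0.00001"
    unfolding abs_le_iff by linarith+
qed

text \<open>
  The constants \<open>N\<close>, \<open>C\<close> and \<open>Y\<close> in the applications below are decimal roundings of the bounds
  for the respective polytope; \<open>6.58\<close> exceeds \<open>2 \<pi>\<^sup>2 / 3\<close>.
\<close>

lemma packing_density_less_rational:
  fixes b :: "nat \<Rightarrow> real \<times> (real ^ 4)"
  assumes "x \<in> ball 0 1" "r > 0" "1 + 1 / N \<le> C\<^sup>2" "1 \<le> C" "0 < N" "N \<le> 1 / (sinh r)\<^sup>2"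
    and Y: "ennreal V \<le> emeasure hyp_measure (truncated_orthoscheme b)" "Y \<le> V" "0 < Y"
    and q: "6.58 * ball_volume_polynomial C < 0.06303 * Y"
  shows "packing_density b (hyp_cball x r) < 0.06303"
proof (rule packing_density_less[OF assms(1-6)])
  show "ennreal Y \<le> emeasure hyp_measure (truncated_orthoscheme b)"
    using ennreal_leI[OF Y(2)] Y(1) by (rule order_trans)
  have "0 \<le> ball_volume_polynomial C" using assms(4) by (simp add: ball_volume_polynomial_def)
  then have "2 * pi\<^sup>2 / 3 * ball_volume_polynomial C \<le> 6.58 * ball_volume_polynomial C"
    using pi_squared_bounds by (intro mult_right_mono) auto
  then show "2 * pi\<^sup>2 / 3 * ball_volume_polynomial C < 0.06303 * Y" using q by simp
qed (use Y in auto)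

lemma ball_in_orthoscheme_constraints:
  fixes b :: "nat \<Rightarrow> real \<times> (real ^ 4)"
  assumes b: "normals [m1, m2, m3, m4] b" and x: "x \<in> ball 0 1" "r > 0"
    and sub: "hyp_cball x r \<subseteq> truncated_orthoscheme b"
    and nz: "sin (pi / m1) \<noteq> 0" "cos (pi / m4) \<noteq> 0" and m2: "sin (pi / m1) = cos (pi / m2)"
  obtains k u1 u2 u3 u4 where
    "1 / (sinh r)\<^sup>2 = k\<^sup>2 + 2 * k * u4 - u1\<^sup>2 - u2\<^sup>2 - u3\<^sup>2"
    "1 \<le> u2" "cos (pi / m1) * u2 \<le> sin (pi / m1) * u1 - 1" "u1 \<le> cos (pi / m3) * k - 1"
    "1 \<le> u4" "1 \<le> u3" "u3 \<le> cos (pi / m4) * k - 1"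
proof -
  obtain L where L: "linear L" "\<And>x y. lorentz (L x) (L y) = lorentz x y" "surj L"
    "\<And>y i. i \<le> 5 \<Longrightarrow> lorentz (L y) (b i) =
       lorentz y (model_normals (cos (pi / m1)) (sin (pi / m1)) (cos (pi / m3)) (cos (pi / m4)) i)"
    using frame_of_normals[OF b nz m2] by blast
  have sh: "sinh r > 0" using x by simp
  from ball_in_orthoscheme_frame[OF b x L(3,2,4) sub] insphere_constraints[OF sh]
  show ?thesis using that by metis
qed

lemma packing_density_4434_less:
  fixes b :: "nat \<Rightarrow> real \<times> (real ^ 4)"
  assumes b: "normals [4, 4, 3, 4] b" and x: "x \<in> ball 0 1" "r > 0" "hyp_cball x r \<subseteq> truncated_orthoscheme b"
  shows "packing_density b (hyp_cball x r) < 0.06303"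
proof -
  obtain k u1 u2 u3 u4 where eq: "1 / (sinh r)\<^sup>2 = k\<^sup>2 + 2 * k * u4 - u1\<^sup>2 - u2\<^sup>2 - u3\<^sup>2"
    and u: "1 \<le> u2" "sqrt 2 / 2 * u2 \<le> sqrt 2 / 2 * u1 - 1" "u1 \<le> 1 / 2 * k - 1" "1 \<le> u4" "1 \<le> u3" "u3 \<le> sqrt 2 / 2 * k - 1"
    by (rule ball_in_orthoscheme_constraints[OF b x]) (auto simp: cos_45 sin_45 cos_60)
  have u': "u1 \<le> k / 2 - 1" using u(3) by simp
  note B = square_faced_radius_bound[OF refl refl eq u(1,2) u' u(4-6)]
  have h2: "(sqrt 2 / 2)\<^sup>2 = (1 / 2 :: real)" by (simp add: power_divide)
  have "(4 + 2 * sqrt 2) * k - (5 + 2 * sqrt 2) \<le> 1 / (sinh r)\<^sup>2"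
    using B(2) unfolding h2 by (simp add: add.commute)
  moreover have "(4 + 2 * sqrt 2) * (4 + 2 * sqrt 2) \<le> (4 + 2 * sqrt 2) * k"
    using B(1) by (intro mult_left_mono) auto
  moreover have "(4 + 2 * sqrt 2) * (4 + 2 * sqrt 2) = 24 + 16 * sqrt 2" by (simp add: algebra_simps)
  ultimately have "38.7 \<le> 1 / (sinh r)\<^sup>2" using sqrt_2_bounds by simp
  then show ?thesis
    using pi_squared_bounds
    by (intro packing_density_less_rational[OF x(1,2), where N = "38.7" and C = "1.0129" and Y = "0.057", OF _ _ _ _ emeasure_orthoscheme_4434_ge[OF b]])
       (auto simp: ball_volume_polynomial_def power2_eq_square)
qed

lemma ball_radius_bound_633k:
  fixes b :: "nat \<Rightarrow> real \<times> (real ^ 4)"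
  assumes b: "normals [6, 3, 3, k'] b" and x: "x \<in> ball 0 1" "r > 0" "hyp_cball x r \<subseteq> truncated_orthoscheme b"
    and h: "h = cos (pi / k')" "0 < h"
  obtains k where "946 / 100 \<le> k" "(2 / 3 - h\<^sup>2) * k\<^sup>2 + (4 + 2 * h) * k - 5 \<le> 1 / (sinh r)\<^sup>2"
proof -
  obtain k u1 u2 u3 u4 where eq: "1 / (sinh r)\<^sup>2 = k\<^sup>2 + 2 * k * u4 - u1\<^sup>2 - u2\<^sup>2 - u3\<^sup>2"
    and u: "1 \<le> u2" "sqrt 3 / 2 * u2 \<le> 1 / 2 * u1 - 1" "u1 \<le> 1 / 2 * k - 1" "1 \<le> u4" "1 \<le> u3" "u3 \<le> h * k - 1"
    by (rule ball_in_orthoscheme_constraints[OF b x]) (use h in \<open>auto simp: cos_30 sin_30 cos_60\<close>)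
  have "0 < (1 / 2 :: real)" by simp
  note B = hexagon_faced_radius_bound[OF refl refl this eq u]
  show ?thesis
  proof (rule that)
    show "946 / 100 \<le> k" using B(1) sqrt_3_bounds by simp
    show "(2 / 3 - h\<^sup>2) * k\<^sup>2 + (4 + 2 * h) * k - 5 \<le> 1 / (sinh r)\<^sup>2"
      using B(2) by (simp add: power2_eq_square[of "1 / 2"])
  qed
qed

lemma hexagonal_constant: "0.0864 \<le> (sqrt 2 / 2 - sqrt 3 / 3) / (3 / 2 :: real)"
  using sqrt_2_bounds sqrt_3_bounds by simp

lemma third_ge: "p \<le> x \<Longrightarrow> 3 * q \<le> p \<Longrightarrow> q \<le> x / (3::real)"
  by simp

lemma packing_density_6333_less:
  fixes b :: "nat \<Rightarrow> real \<times> (real ^ 4)"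
  assumes b: "normals [6, 3, 3, 3] b" and x: "x \<in> ball 0 1" "r > 0" "hyp_cball x r \<subseteq> truncated_orthoscheme b"
  shows "packing_density b (hyp_cball x r) < 0.06303"
proof -
  obtain k where k: "946 / 100 \<le> k" "(2 / 3 - (1 / 2)\<^sup>2) * k\<^sup>2 + (4 + 2 * (1 / 2)) * k - 5 \<le> 1 / (sinh r)\<^sup>2"
    using ball_radius_bound_633k[OF b x, of "1 / 2"] by (auto simp: cos_60)
  have "(946 / 100)\<^sup>2 \<le> k\<^sup>2" using k(1) by (intro power_mono) auto
  then have N: "79 \<le> 1 / (sinh r)\<^sup>2" using k by (simp add: power2_eq_square)
  have v: "ennreal ((sqrt 2 / 2 - sqrt 3 / 3) / (3 / 2) * (pi / 2 - pi / 3) / 3) \<le> emeasure hyp_measure (truncated_orthoscheme b)"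
    using emeasure_orthoscheme_633k_ge[OF b] by (simp add: cos_60 power2_eq_square)
  have "0.0864 * 0.5235 \<le> (sqrt 2 / 2 - sqrt 3 / 3) / (3 / 2) * (pi / 2 - pi / 3)"
    using hexagonal_constant pi_approx by (intro mult_mono) auto
  then have "0.015 \<le> (sqrt 2 / 2 - sqrt 3 / 3) / (3 / 2) * (pi / 2 - pi / 3) / 3" by (rule third_ge) simp
  then show ?thesis
    using N by (intro packing_density_less_rational[OF x(1,2), where N = "79" and C = "1.0064" and Y = "0.015", OF _ _ _ _ v])
       (auto simp: ball_volume_polynomial_def power2_eq_square)
qed

lemma packing_density_6334_less:
  fixes b :: "nat \<Rightarrow> real \<times> (real ^ 4)"
  assumes b: "normals [6, 3, 3, 4] b" and x: "x \<in> ball 0 1" "r > 0" "hyp_cball x r \<subseteq> truncated_orthoscheme b"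
  shows "packing_density b (hyp_cball x r) < 0.06303"
proof -
  have h2: "(sqrt 2 / 2)\<^sup>2 = (1 / 2 :: real)" by (simp add: power_divide)
  obtain k where k: "946 / 100 \<le> k" "(2 / 3 - 1 / 2) * k\<^sup>2 + (4 + sqrt 2) * k - 5 \<le> 1 / (sinh r)\<^sup>2"
    using ball_radius_bound_633k[OF b x, of "sqrt 2 / 2"] unfolding h2 by (auto simp: cos_45)
  have "(946 / 100)\<^sup>2 \<le> k\<^sup>2" using k(1) by (intro power_mono) auto
  moreover have "(4 + 141 / 100) * (946 / 100) \<le> (4 + sqrt 2) * k"
    by (rule mult_mono) (use k(1) sqrt_2_bounds in auto)
  ultimately have N: "61 \<le> 1 / (sinh r)\<^sup>2" using k by (simp add: power2_eq_square)
  have v: "ennreal ((sqrt 2 / 2 - sqrt 3 / 3) / (3 / 2) * (pi / 2 - pi / 4) / 3) \<le> emeasure hyp_measure (truncated_orthoscheme b)"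
    using emeasure_orthoscheme_633k_ge[OF b] by (simp add: cos_45 h2)
  have "0.0864 * 0.7853 \<le> (sqrt 2 / 2 - sqrt 3 / 3) / (3 / 2) * (pi / 2 - pi / 4)"
    using hexagonal_constant pi_approx by (intro mult_mono) auto
  then have "0.0225 \<le> (sqrt 2 / 2 - sqrt 3 / 3) / (3 / 2) * (pi / 2 - pi / 4) / 3" by (rule third_ge) simp
  then show ?thesis
    using N by (intro packing_density_less_rational[OF x(1,2), where N = "61" and C = "1.0082" and Y = "0.0225", OF _ _ _ _ v])
       (auto simp: ball_volume_polynomial_def power2_eq_square)
qed

lemma packing_density_6335_less:
  fixes b :: "nat \<Rightarrow> real \<times> (real ^ 4)"
  assumes b: "normals [6, 3, 3, 5] b" and x: "x \<in> ball 0 1" "r > 0" "hyp_cball x r \<subseteq> truncated_orthoscheme b"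
  shows "packing_density b (hyp_cball x r) < 0.06303"
proof -
  define h where "h = cos (pi / 5)"
  have h: "809 / 1000 \<le> h" "h\<^sup>2 \<le> 2 / 3" using cos_pi_5 by (auto simp: h_def)
  obtain k where k: "946 / 100 \<le> k" "(2 / 3 - h\<^sup>2) * k\<^sup>2 + (4 + 2 * h) * k - 5 \<le> 1 / (sinh r)\<^sup>2"
    using ball_radius_bound_633k[OF b x, of h] h by (auto simp: h_def)
  have "0 \<le> (2 / 3 - h\<^sup>2) * k\<^sup>2" using h by simp
  moreover have "(4 + 2 * (809 / 1000)) * (946 / 100) \<le> (4 + 2 * h) * k"
    by (rule mult_mono) (use k(1) h in auto)
  ultimately have N: "48 \<le> 1 / (sinh r)\<^sup>2" using k by simp
  have "0.0864 * 0.7853 \<le> (sqrt 2 / 2 - sqrt 3 / 3) / (3 / 2) * (pi / 4)"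
    using hexagonal_constant pi_approx by (intro mult_mono) auto
  then have "0.0225 \<le> (sqrt 2 / 2 - sqrt 3 / 3) / (3 / 2) * (pi / 4) / 3" by (rule third_ge) simp
  moreover have "0.0137 \<le> pi\<^sup>2 / 720" using pi_squared_bounds by simp
  ultimately have "0.0225 + 0.0137 \<le> (sqrt 2 / 2 - sqrt 3 / 3) / (3 / 2) * (pi / 4) / 3 + pi\<^sup>2 / 720"
    by (rule add_mono)
  then have "0.0362 \<le> (sqrt 2 / 2 - sqrt 3 / 3) / (3 / 2) * (pi / 4) / 3 + pi\<^sup>2 / 720"
    by (rule order_trans[rotated]) simp
  then show ?thesis
    using N by (intro packing_density_less_rational[OF x(1,2), where N = "48" and C = "1.0104" and Y = "0.0362", OF _ _ _ _ emeasure_orthoscheme_6335_ge[OF b]])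
       (auto simp: ball_volume_polynomial_def power2_eq_square)
qed

lemma packing_density_6343_less:
  fixes b :: "nat \<Rightarrow> real \<times> (real ^ 4)"
  assumes b: "normals [6, 3, 4, 3] b" and x: "x \<in> ball 0 1" "r > 0" "hyp_cball x r \<subseteq> truncated_orthoscheme b"
  shows "packing_density b (hyp_cball x r) < 0.06303"
proof -
  obtain k u1 u2 u3 u4 where eq: "1 / (sinh r)\<^sup>2 = k\<^sup>2 + 2 * k * u4 - u1\<^sup>2 - u2\<^sup>2 - u3\<^sup>2"
    and u: "1 \<le> u2" "sqrt 3 / 2 * u2 \<le> 1 / 2 * u1 - 1" "u1 \<le> sqrt 2 / 2 * k - 1" "1 \<le> u4" "1 \<le> u3" "u3 \<le> 1 / 2 * k - 1"
    by (rule ball_in_orthoscheme_constraints[OF b x]) (auto simp: cos_30 sin_30 cos_60 cos_45)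
  have "0 < (sqrt 2 / 2 :: real)" by simp
  note B = hexagon_faced_radius_bound[OF refl refl this eq u]
  have h2: "(sqrt 2 / 2)\<^sup>2 = (1 / 2 :: real)" by (simp add: power_divide)
  have k: "6.692 \<le> k"
  proof -
    have "6.692 \<le> 1.41421 * (3 + 1.73205 :: real)" by simp
    also have "\<dots> \<le> sqrt 2 * (3 + sqrt 3)"
      using sqrt_2_bounds sqrt_3_bounds by (intro mult_mono) auto
    also have "\<dots> \<le> sqrt 2 * (sqrt 2 / 2 * k)"
      using B(1) by (intro mult_left_mono) auto
    also have "\<dots> = k" by simp
    finally show ?thesis .
  qed
  have "6.692\<^sup>2 \<le> k\<^sup>2" "(3 + 2 * 1.41421) * 6.692 \<le> (3 + 2 * sqrt 2) * k"
    using k sqrt_2_bounds by (intro power_mono mult_mono; simp)+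
  moreover have "1 / 12 * k\<^sup>2 + (3 + 2 * sqrt 2) * k - 5 \<le> 1 / (sinh r)\<^sup>2"
    using B(2) unfolding h2 by (simp add: power2_eq_square[of "1 / 2"])
  ultimately have N: "37.73 \<le> 1 / (sinh r)\<^sup>2" by (simp add: power2_eq_square)
  have "0.13706 \<le> pi\<^sup>2 / 72" using pi_squared_bounds by simp
  moreover have "0.02687 \<le> (sqrt 3 / 3 - pi / 6) / 2"
    using pi_approx sqrt_3_bounds by (simp add: field_simps)
  ultimately have "0.13706 + 0.02687 \<le> pi\<^sup>2 / 72 + (sqrt 3 / 3 - pi / 6) / 2" by (rule add_mono)
  then have "0.05464 \<le> (pi\<^sup>2 / 72 + (sqrt 3 / 3 - pi / 6) / 2) / 3" by (rule third_ge) simp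
  then show ?thesis
    using N by (intro packing_density_less_rational[OF x(1,2), where N = "37.73" and C = "1.01317" and Y = "0.05464", OF _ _ _ _ emeasure_orthoscheme_6343_ge[OF b]])
       (auto simp: ball_volume_polynomial_def power2_eq_square)
qed

lemma normals_exist:
  assumes "m \<in> parallel_symbols_4"
  shows "\<exists>b :: nat \<Rightarrow> real \<times> (real ^ 4). normals m b"
proof -
  have m4: "cos (pi / real n) > 0" if "n \<in> {3, 4, 5}" for n
    using that pi_gt_zero by (intro cos_gt_zero) auto
  have "\<exists>b :: nat \<Rightarrow> real \<times> (real ^ 4). normals [m1, m2, m3, m4] b"
    if "m1 = 4 \<and> m2 = 4 \<or> m1 = 6 \<and> m2 = 3" "m3 \<in> {3, 4, 5}" "m4 \<in> {3, 4, 5}" for m1 m2 m3 m4 :: nat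
  proof -
    have "cos (pi / m1) > 0 \<and> sin (pi / m1) > 0 \<and> sin (pi / m1) = cos (pi / m2)"
      using that(1) by (auto simp: cos_45 sin_45 cos_30 sin_30 cos_60)
    then show ?thesis
      using model_normals_are_normals[of m1 m3 m4 m2] m4[OF that(2)] m4[OF that(3)] by blast
  qed
  then show ?thesis using assms by (auto simp: parallel_symbols_4_def)
qed

theorem theorem3p5:
  shows "(\<forall>m \<in> parallel_symbols_4. \<exists>b :: nat \<Rightarrow> real \<times> (real ^ 4). normals m b) \<and>
    (\<forall>b :: nat \<Rightarrow> real \<times> (real ^ 4). normals [4,4,3,3] b \<longrightarrow>
       (\<exists>!B. is_inball (truncated_orthoscheme b) B)) \<and>
    (\<forall>(P :: (real ^ 4) set set) d. inball_packing [4,4,3,3] P d \<longrightarrow>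
       \<bar>d - 0.06304\<bar> \<le> 0.00001 \<and>
       (\<forall>m \<in> parallel_symbols_4. \<forall>(Q :: (real ^ 4) set set) e. ball_packing m Q e \<longrightarrow>
          e < d \<or> (m = [4,4,3,3] \<and> inball_packing m Q e \<and> e = d)))"
proof (intro conjI allI impI)
  show "\<forall>m \<in> parallel_symbols_4. \<exists>b :: nat \<Rightarrow> real \<times> (real ^ 4). normals m b"
    using normals_exist by blast
next
  fix b :: "nat \<Rightarrow> real \<times> (real ^ 4)" assume b: "normals [4,4,3,3] b"
  obtain x0 r0 where *: "x0 \<in> ball 0 1" "r0 > 0" "hyp_cball x0 r0 \<subseteq> truncated_orthoscheme b"
    "\<And>x r. x \<in> ball 0 1 \<Longrightarrow> r > 0 \<Longrightarrow> hyp_cball x r \<subseteq> truncated_orthoscheme b \<Longrightarrow> r \<le> r0 \<and> (r = r0 \<longrightarrow> x = x0)"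
    using inball_4433[OF b] by metis
  show "\<exists>!B. is_inball (truncated_orthoscheme b) B"
  proof (rule ex1I[of _ "hyp_cball x0 r0"])
    show "is_inball (truncated_orthoscheme b) (hyp_cball x0 r0)"
      unfolding is_inball_def using * by blast
    show "B = hyp_cball x0 r0" if "is_inball (truncated_orthoscheme b) B" for B
      using that * unfolding is_inball_def by (metis order_antisym)
  qed
next
  have inball_radius: "\<exists>x r. x \<in> ball 0 1 \<and> r > 0 \<and> B = hyp_cball x r \<and> (sinh r)\<^sup>2 = 1 / (25 + 16 * sqrt 2)"
    if nb: "normals [4,4,3,3] b" and ib: "is_inball (truncated_orthoscheme b) B" for b :: "nat \<Rightarrow> real \<times> (real ^ 4)" and B
  proof -
    obtain x0 r0 where *: "x0 \<in> ball 0 1" "r0 > 0" "(sinh r0)\<^sup>2 = 1 / (25 + 16 * sqrt 2)"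
      "hyp_cball x0 r0 \<subseteq> truncated_orthoscheme b"
      "\<And>x r. x \<in> ball 0 1 \<Longrightarrow> r > 0 \<Longrightarrow> hyp_cball x r \<subseteq> truncated_orthoscheme b \<Longrightarrow> r \<le> r0 \<and> (r = r0 \<longrightarrow> x = x0)"
      using inball_4433[OF nb] by metis
    then have "B = hyp_cball x0 r0" using ib unfolding is_inball_def by (metis order_antisym)
    then show ?thesis using * by blast
  qed
  fix P :: "(real ^ 4) set set" and d assume "inball_packing [4,4,3,3] P d"
  then obtain x r where "x \<in> ball (0 :: real ^ 4) 1" and r: "r > 0" "(sinh r)\<^sup>2 = 1 / (25 + 16 * sqrt 2)"
    and d: "d = 192 * ball_volume_polynomial (cosh r)"
    unfolding inball_packing_def by (metis inball_radius packing_density_4433)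
  show "\<bar>d - 0.06304\<bar> \<le> 0.00001" unfolding d by (rule optimal_density_bounds(2)[OF r(2)])
  have dge: "0.06303 \<le> d" unfolding d by (rule optimal_density_bounds(1)[OF r(2)])
  show "\<forall>m \<in> parallel_symbols_4. \<forall>(Q :: (real ^ 4) set set) e. ball_packing m Q e \<longrightarrow>
          e < d \<or> (m = [4,4,3,3] \<and> inball_packing m Q e \<and> e = d)"
  proof (intro ballI allI impI)
    fix m and Q :: "(real ^ 4) set set" and e
    assume m: "m \<in> parallel_symbols_4" and "ball_packing m Q e"
    then obtain b :: "nat \<Rightarrow> real \<times> (real ^ 4)" and x' r' where b: "normals m b"
      and x': "x' \<in> ball 0 1" "r' > 0" "hyp_cball x' r' \<subseteq> truncated_orthoscheme b"
      and Qe: "Q = orbit b (hyp_cball x' r')" "e = packing_density b (hyp_cball x' r')"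
      unfolding ball_packing_def is_ball_in_def by blast
    show "e < d \<or> (m = [4,4,3,3] \<and> inball_packing m Q e \<and> e = d)"
    proof (cases "m = [4,4,3,3]")
      case False
      then have "e < 0.06303"
        using m b x' packing_density_4434_less packing_density_6333_less packing_density_6334_less
          packing_density_6335_less packing_density_6343_less
        unfolding parallel_symbols_4_def Qe(2) by blast
      then show ?thesis using dge by simp
    next
      case True
      have e: "e = 192 * ball_volume_polynomial (cosh r')"
        using packing_density_4433 b True x' by (simp add: Qe(2))
      obtain x0 r0 where *: "x0 \<in> ball 0 1" "r0 > 0" "(sinh r0)\<^sup>2 = 1 / (25 + 16 * sqrt 2)"
        "hyp_cball x0 r0 \<subseteq> truncated_orthoscheme b"
        "\<And>x r. x \<in> ball 0 1 \<Longrightarrow> r > 0 \<Longrightarrow> hyp_cball x r \<subseteq> truncated_orthoscheme b \<Longrightarrow> r \<le> r0 \<and> (r = r0 \<longrightarrow> x = x0)"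
        using inball_4433[of b] b True by metis
      have "sinh r0 = sinh r" using *(2,3) r power2_eq_imp_eq[of "sinh r0" "sinh r"] by simp
      then have r0: "r0 = r" by simp
      show ?thesis
      proof (cases "r' = r")
        case True
        then have "is_inball (truncated_orthoscheme b) (hyp_cball x' r')"
          unfolding is_inball_def using x' *(5) r0 by blast
        then have "inball_packing m Q e" unfolding inball_packing_def using b Qe by blast
        then show ?thesis using \<open>m = [4,4,3,3]\<close> e d True by simp
      next
        case False
        then have "r' < r" using *(5)[OF x'] r0 by simp
        then have "cosh r' < cosh r" using x'(2) by (simp add: cosh_real_nonneg_less_iff)
        then have "ball_volume_polynomial (cosh r') < ball_volume_polynomial (cosh r)"
          by (intro ball_volume_polynomial_strict_mono cosh_real_ge_1)
        then show ?thesis by (simp add: e d)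
      qed
    qed
  qed
qed

end
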